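(* Let $c\in(0,1]$ and let $H$, $F$, $\underline F$, $\underline m$, $\underline g$ be as in the context. Assume that $\int t\,\mathrm{d}H(s,t)<\infty$, $\int t^{-1}\,\mathrm{d}H(s,t)<\infty$ and $\int (s/t)\,\mathrm{d}H(s,t)\le 1/c$. Then for every $x\in\mathbb{R}\setminus\{0\}$ the limit $$\lim_{z\in\mathbb{C}^+,\,z\to x}m_{\underline F}(z)\equiv\underline m(x)$$ exists. The function $\underline m$ is continuous on $\mathbb{R}\setminus\{0\}$, and $\underline F$ has a continuous derivative $f$ on $\mathbb{R}\setminus\{0\}$ given by $f(x)=\frac1\pi\Im\underline m(x)$. Furthermore, if $\Im\underline m(x)>0$ (that is, $f(x)>0$) for some $x\in(0,\infty)$, then the density $f$ is analytic about $x$.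
   Context: Setting. $\mathbb{C}^+=\{z\in\mathbb{C}:\Im z>0\}$; the Stieltjes transform of a distribution function $G$ is $m_G(z)=\int\frac{1}{\lambda-z}\mathrm{d}G(\lambda)$, $z\in\mathbb{C}^+$. Let $c\in(0,1]$ and $H$ a probability distribution on $[0,\infty)^2$. For each $n$ let $N=N(n)$ with $n/N\to c$ as $\min\{n,N\}\to\infty$; let $X_n=(x_{jk}^{(n)})$ be an $n\times N$ random matrix with independent entries of mean $0$ and $\mathbf{E}|x_{jk}^{(n)}|^2=1$ with $\frac{1}{\eta^2nN}\sum_{j,k}\mathbf{E}(|x^{(n)}_{jk}|^2I(|x^{(n)}_{jk}|\ge\eta\sqrt n))\to0$ for every $\eta>0$; let $T_n$ ($n\times n$, nonnegative definite) and $R_n$ ($n\times N$) be nonrandom with $T_n$ and $R_nR_n^*$ commuting, and such that $n^{-1}\sum_{i=1}^nI(s_i\le s,t_i\le t)$ converges weakly to $H$, where $(s_i,t_i)$ are the eigenvalues of $\frac1NR_nR_n^*$ and $T_n$ paired by a common orthonormal eigenbasis. $F$ is the (nonrandom) almost sure weak limit of the empirical spectral distributions of $B_n=\frac1N(R_n+T_n^{1/2}X_n)(R_n+T_n^{1/2}X_n)^*$, with Stieltjes transform $m(z)$, and $\underline F=(1-c)I_{[0,\infty)}+cF$ is the corresponding limit for the $N\times N$ matrices $\frac1N(R_n+T_n^{1/2}X_n)^*(R_n+T_n^{1/2}X_n)$. Its Stieltjes transform is $\underline m(z)=m_{\underline F}(z)=-\frac{1-c}{z}+c\,m(z)$. There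 is a companion function $g(z)$ on $\mathbb{C}^+$ such that $$m=\int\frac{\mathrm{d}H(s,t)}{\frac{s}{1+cg}-(1+cmt)z+t(1-c)},\qquad g=\int\frac{t\,\mathrm{d}H(s,t)}{\frac{s}{1+cg}-(1+cmt)z+t(1-c)},$$ and $\underline g(z)=-\frac{1}{z(1+cg(z))}$ is the Stieltjes transform of a probability measure on $[0,\infty)$. In terms of $\underline m,\underline g$ the equations read $$z=-\frac{1-c}{\underline m}-\frac{c}{\underline m}\int\frac{\mathrm{d}H(s,t)}{1+s\underline g+t\underline m},\qquad z=-\frac1{\underline g}+c\int\frac{t\,\mathrm{d}H(s,t)}{1+s\underline g+t\underline m}.$$ For real $x\ne0$, $\underline m(x)$ denotes the solution component at $z=x$ of these equations obtained as a limit from $\mathbb{C}^+$. *)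

theory Defs
  imports
    "HOL-Probability.Probability"
    "Jordan_Normal_Form.Schur_Decomposition"
begin

section \<open>Distribution functions and Stieltjes transforms\<close>

definition distribution_function :: "(real \<Rightarrow> real) \<Rightarrow> bool" where
  "distribution_function G \<longleftrightarrow>
     mono G \<and> (\<forall>x. continuous (at_right x) G) \<and> (G \<longlongrightarrow> 0) at_bot \<and> (G \<longlongrightarrow> 1) at_top"

abbreviation upper_half_plane :: "complex set" (\<open>\<complex>\<^sup>+\<close>) where
  "\<complex>\<^sup>+ \<equiv> {z. Im z > 0}"

definition stieltjes :: "(real \<Rightarrow> real) \<Rightarrow> complex \<Rightarrow> complex" where
  "stieltjes G z = (\<integral>l. 1 / (complex_of_real l - z) \<partial>interval_measure G)"

text \<open>The limiting distribution function of the \<open>N \<times> N\<close> matrices, in terms of the one of the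
  \<open>n \<times> n\<close> matrices.\<close>

definition lower_df :: "real \<Rightarrow> (real \<Rightarrow> real) \<Rightarrow> real \<Rightarrow> real" where
  "lower_df c F x = (1 - c) * indicator {0..} x + c * F x"

definition real_analytic_at :: "(real \<Rightarrow> real) \<Rightarrow> real \<Rightarrow> bool" where
  "real_analytic_at f x \<longleftrightarrow>
     (\<exists>a r. r > 0 \<and> (\<forall>y. \<bar>y - x\<bar> < r \<longrightarrow> (\<lambda>k. a k * (y - x) ^ k) sums f y))"


section \<open>The random matrix model\<close>

text \<open>The order on \<^typ>\<open>complex\<close> is the one of \<^theory>\<open>HOL-Library.Complex_Order\<close>:
  \<open>0 \<le> w\<close> says that \<open>w\<close> is real and nonnegative. Hence such a matrix is Hermitian.\<close>

definition nonneg_definite :: "nat \<Rightarrow> complex mat \<Rightarrow> bool" where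
  "nonneg_definite n A \<longleftrightarrow>
     A \<in> carrier_mat n n \<and> (\<forall>v \<in> carrier_vec n. 0 \<le> (A *\<^sub>v v) \<bullet>c v)"

definition mat_sqrt :: "complex mat \<Rightarrow> complex mat" where
  "mat_sqrt A = (THE S. nonneg_definite (dim_row A) S \<and> S * S = A)"

text \<open>Empirical spectral distribution function; eigenvalues are counted with algebraic
  multiplicity. It is only used for Hermitian matrices, whose eigenvalues are real.\<close>

definition esd :: "complex mat \<Rightarrow> real \<Rightarrow> real" where
  "esd A x = real (size {#l \<in># proots (char_poly A). Re l \<le> x#}) / real (dim_row A)"

definition paired_eigenvalues ::
  "nat \<Rightarrow> complex mat \<Rightarrow> complex mat \<Rightarrow> (nat \<Rightarrow> real) \<Rightarrow> (nat \<Rightarrow> real) \<Rightarrow> bool" where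
  "paired_eigenvalues n A B s t \<longleftrightarrow>
     (\<exists>u :: nat \<Rightarrow> complex vec.
        (\<forall>i<n. u i \<in> carrier_vec n) \<and>
        (\<forall>i<n. \<forall>j<n. u i \<bullet>c u j = (if i = j then 1 else 0)) \<and>
        (\<forall>i<n. A *\<^sub>v u i = complex_of_real (s i) \<cdot>\<^sub>v u i \<and>
               B *\<^sub>v u i = complex_of_real (t i) \<cdot>\<^sub>v u i))"

definition gram :: "nat \<Rightarrow> complex mat \<Rightarrow> complex mat" where
  "gram N A = complex_of_real (1 / real N) \<cdot>\<^sub>m (A * mat_adjoint A)"

definition info_noise_matrix ::
  "(nat \<Rightarrow> nat) \<Rightarrow> (nat \<Rightarrow> complex mat) \<Rightarrow> (nat \<Rightarrow> complex mat) \<Rightarrow>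
   (nat \<Rightarrow> nat \<Rightarrow> nat \<Rightarrow> 'w \<Rightarrow> complex) \<Rightarrow> nat \<Rightarrow> 'w \<Rightarrow> complex mat" where
  "info_noise_matrix N R T X n \<omega> =
     gram (N n) (R n + mat_sqrt (T n) * mat n (N n) (\<lambda>(j, k). X n j k \<omega>))"

definition joint_df :: "(real \<times> real) measure \<Rightarrow> real \<times> real \<Rightarrow> real" where
  "joint_df H p = measure H ({..fst p} \<times> {..snd p})"

text \<open>Since \<open>c > 0\<close> below, \<open>ratio\<close> makes \<open>N n\<close> tend to infinity with \<open>n\<close>, so
  \<open>min{n, N} \<rightarrow> \<infinity>\<close> is the same as \<open>n \<rightarrow> \<infinity>\<close>. \<open>weak_H\<close> is weak convergence of bivariate
  distribution functions: convergence at all continuity points of the limit.\<close>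

locale information_plus_noise = prob_space P
  for P :: "'w measure" +
  fixes c :: real
    and N :: "nat \<Rightarrow> nat"
    and X :: "nat \<Rightarrow> nat \<Rightarrow> nat \<Rightarrow> 'w \<Rightarrow> complex"
    and R T :: "nat \<Rightarrow> complex mat"
    and s t :: "nat \<Rightarrow> nat \<Rightarrow> real"
    and H :: "(real \<times> real) measure"
  assumes N_pos: "\<And>n. N n > 0"
    and ratio: "(\<lambda>n. real n / real (N n)) \<longlonglongrightarrow> c"
    and indep: "\<And>n. indep_vars (\<lambda>_. borel) (\<lambda>(j, k). X n j k) ({..<n} \<times> {..<N n})"
    and mean_zero: "\<And>n j k. j < n \<Longrightarrow> k < N n \<Longrightarrow>
          integrable P (X n j k) \<and> expectation (X n j k) = 0"
    and unit_variance: "\<And>n j k. j < n \<Longrightarrow> k < N n \<Longrightarrow>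
          integrable P (\<lambda>\<omega>. (cmod (X n j k \<omega>))\<^sup>2) \<and>
          expectation (\<lambda>\<omega>. (cmod (X n j k \<omega>))\<^sup>2) = 1"
    and lindeberg: "\<And>\<eta>. \<eta> > 0 \<Longrightarrow>
          (\<lambda>n. 1 / (\<eta>\<^sup>2 * real n * real (N n)) *
               (\<Sum>j<n. \<Sum>k<N n. expectation (\<lambda>\<omega>. (cmod (X n j k \<omega>))\<^sup>2 *
                  indicator {\<omega>. cmod (X n j k \<omega>) \<ge> \<eta> * sqrt (real n)} \<omega>)))
          \<longlonglongrightarrow> 0"
    and T_nonneg: "\<And>n. nonneg_definite n (T n)"
    and R_carrier: "\<And>n. R n \<in> carrier_mat n (N n)"
    and commute: "\<And>n. T n * (R n * mat_adjoint (R n)) = R n * mat_adjoint (R n) * T n"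
    and eigenvalues: "\<And>n. paired_eigenvalues n (gram (N n) (R n)) (T n) (s n) (t n)"
    and prob_H: "prob_space H"
    and sets_H: "sets H = sets borel"
    and support_H: "AE p in H. 0 \<le> fst p \<and> 0 \<le> snd p"
    and weak_H: "\<And>a b. isCont (joint_df H) (a, b) \<Longrightarrow>
          (\<lambda>n. real (card {i. i < n \<and> s n i \<le> a \<and> t n i \<le> b}) / real n)
          \<longlonglongrightarrow> joint_df H (a, b)"


section \<open>The companion function\<close>

definition denom :: "real \<Rightarrow> complex \<Rightarrow> complex \<Rightarrow> complex \<Rightarrow> real \<times> real \<Rightarrow> complex" where
  "denom c z m g = (\<lambda>(s, t).
     of_real s / (1 + of_real c * g) - (1 + of_real c * m * of_real t) * z + of_real (t * (1 - c)))"

definition companion ::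
  "real \<Rightarrow> (real \<times> real) measure \<Rightarrow> (complex \<Rightarrow> complex) \<Rightarrow> (complex \<Rightarrow> complex) \<Rightarrow> bool" where
  "companion c H m g \<longleftrightarrow>
     (\<forall>z \<in> \<complex>\<^sup>+.
        has_bochner_integral H (\<lambda>p. 1 / denom c z (m z) (g z) p) (m z) \<and>
        has_bochner_integral H (\<lambda>p. of_real (snd p) / denom c z (m z) (g z) p) (g z)) \<and>
     (\<exists>G. distribution_function G \<and> (\<forall>x<0. G x = 0) \<and>
        (\<forall>z \<in> \<complex>\<^sup>+. - 1 / (z * (1 + of_real c * g z)) = stieltjes G z))"

end

theory Submission
  imports Defs "HOL-Complex_Analysis.Complex_Analysis"
begin

text \<open>The substitution \<open>w = csqrt z\<close> symmetrises the problem. For \<open>z\<close> in the upper half-plane put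
  \<open>M = w * m\<close> and \<open>G = w * g\<close>, where \<open>m\<close> is the Stieltjes transform of the limit law of the
  \<open>N \<times> N\<close> matrices and \<open>g\<close> that of the companion law. Both laws live on \<open>[0, \<infinity>)\<close>, so \<open>M\<close> and
  \<open>G\<close> again lie in the upper half-plane, and with \<open>Q = w + s G + t M\<close> the two equations become
  \<open>M = - (1 - c) / w - c \<integral> 1 / Q\<close> and \<open>- 1 / G = w - c \<integral> t / Q\<close>.

  The imaginary parts of these identities give inequalities with positive coefficients,
  \<open>c \<integral> (s Im G + t Im M) / |Q|^2 \<le> Im M\<close> and \<open>c \<integral> t (s Im G + t Im M) / |Q|^2 \<le> Im G / |G|^2\<close>;
  in particular \<open>c \<integral> t / |Q|^2 \<le> 1\<close> (\<open>solution_energy\<close>). Since \<open>t\<close> and \<open>1 / t\<close> are integrable, this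
  \<open>L\<^sup>2\<close> bound keeps \<open>M\<close> and \<open>1 / G\<close> bounded and makes the integrals of \<open>1 / Q\<close> and \<open>t / Q\<close> converge along
  every convergent sequence (\<open>weighted_L2_convergence\<close>). Hence each limit point at a real \<open>x > 0\<close>
  solves the equations at \<open>w = sqrt x\<close>, and the inequalities, rescaled to \<open>Im G + Im M = 1\<close>, survive
  by Fatou's lemma (\<open>solution_limit\<close>).

  The heart of the matter is \<open>linearization_kernel\<close>. The difference of two solutions lies in the kernel
  of a \<open>2 \<times> 2\<close> matrix with entries such as \<open>1 - c \<integral> t / (Q Q')\<close>. By the Cauchy-Schwarz inequality this
  matrix dominates the geometric mean of the two matrices with \<open>|Q|^2\<close> and \<open>|Q'|^2\<close> in place of
  \<open>Q Q'\<close>, which have positive supersolutions. So the kernel is trivial unless equality holds throughout, which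
  forces \<open>Q' = cnj Q\<close>; as both have nonnegative imaginary part, then \<open>Q = Q'\<close> is real and the solutions
  agree. Thus the limit point is unique, real or not, and the limit exists
  (\<open>boundary_limit\<close>).

  Continuity of the boundary values and the formula for the density follow by integrating the Poisson
  kernel (\<open>density_of_boundary_limit\<close>). Where \<open>Im M > 0\<close>, the same lemma applied to two equal
  solutions shows that the Jacobian of the system is invertible, and the implicit function theorem
  continues \<open>M\<close> analytically across the real axis (\<open>boundary_analytic\<close>). For \<open>x < 0\<close> everything is
  explicit, because the law has no mass there (\<open>limit_distribution_nonneg\<close>).\<close>

section \<open>Limits of integrals under weighted square-integrable bounds\<close>

text \<open>Fatou's lemma in the form needed for inequalities: the bound may vary along the sequence.\<close>

lemma integral_Fatou:
  fixes f :: "nat \<Rightarrow> 'a \<Rightarrow> real"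
  assumes int: "\<And>n. integrable M (f n)" and nn: "\<And>n. AE p in M. 0 \<le> f n p"
    and lim: "AE p in M. (\<lambda>n. f n p) \<longlonglongrightarrow> g p" and g[measurable]: "g \<in> borel_measurable M"
    and bound: "\<And>n. integral\<^sup>L M (f n) \<le> C n" and C: "C \<longlonglongrightarrow> K"
  shows "integrable M g" "integral\<^sup>L M g \<le> K"
proof -
  have [measurable]: "f n \<in> borel_measurable M" for n
    using int by blast
  have nnA: "AE p in M. \<forall>n. 0 \<le> f n p"
    using nn by (simp add: AE_all_countable)
  have g0: "AE p in M. 0 \<le> g p"
    using nnA lim by eventually_elim (metis LIMSEQ_le_const)
  have fn: "(\<integral>\<^sup>+p. ennreal (f n p) \<partial>M) = ennreal (integral\<^sup>L M (f n))" for n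
    by (rule nn_integral_eq_integral[OF int nn])
  have C0: "0 \<le> C n" for n
    using bound[of n] integral_nonneg_AE[OF nn, of n] by linarith
  have K0: "0 \<le> K" using C C0 by (metis LIMSEQ_le_const)
  have "(\<integral>\<^sup>+p. ennreal (g p) \<partial>M) = (\<integral>\<^sup>+p. liminf (\<lambda>n. ennreal (f n p)) \<partial>M)"
  proof (rule nn_integral_cong_AE, use lim in eventually_elim)
    fix p assume "(\<lambda>n. f n p) \<longlonglongrightarrow> g p"
    then have "(\<lambda>n. ennreal (f n p)) \<longlonglongrightarrow> ennreal (g p)" by (rule tendsto_ennrealI)
    then show "ennreal (g p) = liminf (\<lambda>n. ennreal (f n p))"
      by (simp add: lim_imp_Liminf)
  qed
  also have "\<dots> \<le> liminf (\<lambda>n. \<integral>\<^sup>+p. ennreal (f n p) \<partial>M)"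
    by (rule nn_integral_liminf) simp
  also have "\<dots> \<le> liminf (\<lambda>n. ennreal (C n))"
    by (intro Liminf_mono always_eventually allI) (simp add: fn ennreal_leI bound)
  also have "\<dots> = ennreal K"
    using C by (intro lim_imp_Liminf) (auto intro: tendsto_ennrealI)
  finally have *: "(\<integral>\<^sup>+p. ennreal (g p) \<partial>M) \<le> ennreal K" .
  show "integrable M g"
    using * g0 by (intro integrableI_nonneg) (auto simp: less_top[symmetric] top_unique)
  then show "integral\<^sup>L M g \<le> K"
    using * g0 K0 by (simp add: nn_integral_eq_integral)
qed

text \<open>A bounded weighted \<open>L^2\<close> norm excludes divergence to infinity on a set of positive measure. For
  \<open>y = 1 / Q\<close> this says that the limit of the denominators \<open>Q\<close> vanishes almost nowhere.\<close>

lemma weighted_L2_limit_finite: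
  fixes y :: "nat \<Rightarrow> 'a \<Rightarrow> complex" and z :: "'a \<Rightarrow> complex" and t :: "'a \<Rightarrow> real"
  assumes [measurable]: "\<And>n. y n \<in> borel_measurable M" "t \<in> borel_measurable M"
    and t: "AE p in M. 0 < t p"
    and int: "\<And>n. integrable M (\<lambda>p. t p * (cmod (y n p))^2)"
    and bound: "\<And>n. (LINT p|M. t p * (cmod (y n p))^2) \<le> K"
    and lim: "AE p in M. (\<lambda>n. y n p) \<longlonglongrightarrow> z p \<or> filterlim (\<lambda>n. cmod (y n p)) at_top sequentially"
  shows "AE p in M. (\<lambda>n. y n p) \<longlonglongrightarrow> z p"
proof -
  have "(\<integral>\<^sup>+p. liminf (\<lambda>n. ennreal (t p * (cmod (y n p))^2)) \<partial>M)
      \<le> liminf (\<lambda>n. \<integral>\<^sup>+p. ennreal (t p * (cmod (y n p))^2) \<partial>M)"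
    by (rule nn_integral_liminf) simp
  also have "\<dots> \<le> liminf (\<lambda>n. ennreal K)"
  proof (rule Liminf_mono, rule always_eventually, rule allI)
    fix n
    have "(\<integral>\<^sup>+p. ennreal (t p * (cmod (y n p))^2) \<partial>M) = ennreal (LINT p|M. t p * (cmod (y n p))^2)"
      using t by (intro nn_integral_eq_integral[OF int]) (auto elim!: eventually_mono)
    then show "(\<integral>\<^sup>+p. ennreal (t p * (cmod (y n p))^2) \<partial>M) \<le> ennreal K"
      by (auto intro!: ennreal_leI bound)
  qed
  also have "\<dots> = ennreal K" by (simp add: Liminf_const)
  finally have "(\<integral>\<^sup>+p. liminf (\<lambda>n. ennreal (t p * (cmod (y n p))^2)) \<partial>M) \<noteq> \<infinity>"
    by (auto simp: top_unique)
  then have "AE p in M. liminf (\<lambda>n. ennreal (t p * (cmod (y n p))^2)) \<noteq> \<infinity>"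
    by (intro nn_integral_PInf_AE) auto
  then show ?thesis
    using lim t
  proof eventually_elim
    fix p assume a: "liminf (\<lambda>n. ennreal (t p * (cmod (y n p))^2)) \<noteq> \<infinity>" "0 < t p"
      and b: "(\<lambda>n. y n p) \<longlonglongrightarrow> z p \<or> filterlim (\<lambda>n. cmod (y n p)) at_top sequentially"
    have False if c: "filterlim (\<lambda>n. cmod (y n p)) at_top sequentially"
    proof -
      have "filterlim (\<lambda>n. t p * (cmod (y n p))^2) at_top sequentially"
        using a(2) c by (intro filterlim_tendsto_pos_mult_at_top[OF tendsto_const] filterlim_pow_at_top) auto
      then have "(\<lambda>n. ennreal (t p * (cmod (y n p))^2)) \<longlonglongrightarrow> (\<infinity>::ennreal)"
        by (simp add: ennreal_tendsto_top_eq_at_top)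
      then have "liminf (\<lambda>n. ennreal (t p * (cmod (y n p))^2)) = \<infinity>"
        by (intro lim_imp_Liminf) auto
      then show False using a(1) by simp
    qed
    then show "(\<lambda>n. y n p) \<longlonglongrightarrow> z p" using b by auto
  qed
qed

text \<open>The weight \<open>t\<close> controls integrals against \<open>k\<close> as soon as \<open>k^2 / t\<close> is integrable, by Cauchy-Schwarz;
  the boundedness in \<open>L^2\<close> gives the uniform integrability. It is applied with \<open>k = 1\<close> and \<open>k = t\<close>,
  and the two conditions are the integrability of \<open>1 / t\<close> and of \<open>t\<close>.\<close>

lemma weighted_L2_convergence:
  fixes y :: "nat \<Rightarrow> 'a \<Rightarrow> complex" and z :: "'a \<Rightarrow> complex" and t k :: "'a \<Rightarrow> real"
  assumes [measurable]: "\<And>n. y n \<in> borel_measurable M" "t \<in> borel_measurable M"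
      "z \<in> borel_measurable M" "k \<in> borel_measurable M"
    and t: "AE p in M. 0 < t p"
    and int: "\<And>n. integrable M (\<lambda>p. t p * (cmod (y n p))^2)"
    and bound: "\<And>n. (LINT p|M. t p * (cmod (y n p))^2) \<le> K"
    and lim: "AE p in M. (\<lambda>n. y n p) \<longlonglongrightarrow> z p"
    and k: "integrable M (\<lambda>p. (k p)^2 / t p)"
  shows "integrable M (\<lambda>p. t p * (cmod (z p))^2)" "(LINT p|M. t p * (cmod (z p))^2) \<le> K"
    "integrable M (\<lambda>p. k p * z p)"
    "(\<lambda>n. \<integral>p. k p * y n p \<partial>M) \<longlonglongrightarrow> (LINT p|M. k p * z p)"
proof -
  have lim2: "AE p in M. (\<lambda>n. t p * (cmod (y n p))^2) \<longlonglongrightarrow> t p * (cmod (z p))^2"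
    using lim by eventually_elim (intro tendsto_intros)
  have nn: "AE p in M. 0 \<le> t p * (cmod (y n p))^2" for n
    using t by eventually_elim simp
  show z2: "integrable M (\<lambda>p. t p * (cmod (z p))^2)" and zK: "(LINT p|M. t p * (cmod (z p))^2) \<le> K"
    using integral_Fatou[where f="\<lambda>n p. t p * (cmod (y n p))^2" and C="\<lambda>_. K" and K=K, OF int nn lim2 _ bound]
    by auto
  have amgm: "cmod (k p * u) \<le> (k p)^2 / t p + t p * (cmod u)^2" if "0 < t p" for p and u :: complex
  proof -
    have "0 \<le> (\<bar>k p\<bar> / sqrt (t p) - sqrt (t p) * cmod u)^2" by simp
    also have "\<dots> = (k p)^2 / t p + t p * (cmod u)^2 - 2 * (\<bar>k p\<bar> * cmod u)"
      using that by (simp add: power2_diff power_divide power_mult_distrib)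
    finally have "2 * (\<bar>k p\<bar> * cmod u) \<le> (k p)^2 / t p + t p * (cmod u)^2" by simp
    moreover have "0 \<le> \<bar>k p\<bar> * cmod u" by simp
    ultimately have "\<bar>k p\<bar> * cmod u \<le> (k p)^2 / t p + t p * (cmod u)^2" by linarith
    then show ?thesis by (simp only: norm_mult norm_of_real)
  qed
  have int_k: "integrable M (\<lambda>p. k p * u p)"
    if [measurable]: "u \<in> borel_measurable M" and "integrable M (\<lambda>p. t p * (cmod (u p))^2)"
    for u :: "'a \<Rightarrow> complex"
  proof (rule Bochner_Integration.integrable_bound[OF Bochner_Integration.integrable_add[OF k that(2)]])
    show "AE p in M. norm (complex_of_real (k p) * u p) \<le> norm ((k p)^2 / t p + t p * (cmod (u p))^2)"
      using t
    proof eventually_elim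
      case (elim p)
      from amgm[OF this, of "u p"] show ?case by (metis abs_ge_self order_trans real_norm_def)
    qed
  qed measurable
  show kz: "integrable M (\<lambda>p. k p * z p)" by (rule int_k[OF _ z2]) measurable
  have ky: "integrable M (\<lambda>p. k p * y n p)" for n by (rule int_k[OF _ int]) measurable
  have K0: "0 \<le> K" using integral_nonneg_AE[OF nn, of 0] bound[of 0] by linarith
  define e where "e n p = cmod (k p * (y n p - z p))" for n p
  have e[measurable]: "e n \<in> borel_measurable M" for n unfolding e_def by measurable
  have ei: "integrable M (e n)" for n
    unfolding e_def using Bochner_Integration.integrable_diff[OF ky kz, THEN integrable_norm]
    by (simp add: algebra_simps)
  have d2: "integrable M (\<lambda>p. t p * (cmod (y n p - z p))^2)"
    and d4: "(LINT p|M. t p * (cmod (y n p - z p))^2) \<le> 4 * K" for n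
  proof -
    have le: "t p * (cmod (y n p - z p))^2 \<le> 2 * (t p * (cmod (y n p))^2) + 2 * (t p * (cmod (z p))^2)"
      if "0 < t p" for p
    proof -
      have "(cmod (y n p - z p))^2 \<le> (cmod (y n p) + cmod (z p))^2"
        by (intro power_mono norm_triangle_ineq4) auto
      also have "\<dots> \<le> 2 * (cmod (y n p))^2 + 2 * (cmod (z p))^2"
        using sum_squares_bound[of "cmod (y n p)" "cmod (z p)"] by (simp add: power2_sum)
      finally have "t p * (cmod (y n p - z p))^2 \<le> t p * (2 * (cmod (y n p))^2 + 2 * (cmod (z p))^2)"
        using that by (intro mult_left_mono) auto
      then show ?thesis by (simp add: algebra_simps)
    qed
    have i: "integrable M (\<lambda>p. 2 * (t p * (cmod (y n p))^2) + 2 * (t p * (cmod (z p))^2))"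
      using int z2 by auto
    show j: "integrable M (\<lambda>p. t p * (cmod (y n p - z p))^2)"
    proof (rule Bochner_Integration.integrable_bound[OF i])
      show "AE p in M. norm (t p * (cmod (y n p - z p))^2)
          \<le> norm (2 * (t p * (cmod (y n p))^2) + 2 * (t p * (cmod (z p))^2))"
        using t by eventually_elim (use le in \<open>auto\<close>)
    qed measurable
    have "(LINT p|M. t p * (cmod (y n p - z p))^2)
       \<le> (LINT p|M. 2 * (t p * (cmod (y n p))^2) + 2 * (t p * (cmod (z p))^2))"
      using t by (intro integral_mono_AE[OF j i]) (use le in \<open>auto elim!: eventually_mono\<close>)
    also have "\<dots> = 2 * (LINT p|M. t p * (cmod (y n p))^2) + 2 * (LINT p|M. t p * (cmod (z p))^2)"
      using int z2 by simp
    finally show "(LINT p|M. t p * (cmod (y n p - z p))^2) \<le> 4 * K"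
      using bound[of n] zK by linarith
  qed
  have e0: "AE p in M. (\<lambda>n. e n p) \<longlonglongrightarrow> 0"
    using lim
  proof eventually_elim
    case (elim p)
    have "(\<lambda>n. cmod (k p * (y n p - z p))) \<longlonglongrightarrow> cmod (k p * (z p - z p))"
      using elim by (intro tendsto_intros)
    then show ?case by (simp add: e_def)
  qed
  have trunc: "(\<lambda>n. \<integral>p. min (e n p) (L * ((k p)^2 / t p)) \<partial>M) \<longlonglongrightarrow> 0" if L: "L > 0" for L :: real
  proof -
    have "(\<lambda>n. \<integral>p. min (e n p) (L * ((k p)^2 / t p)) \<partial>M) \<longlonglongrightarrow> (LINT p|M. 0)"
    proof (rule integral_dominated_convergence)
      show "integrable M (\<lambda>p. L * ((k p)^2 / t p))" using k by (rule integrable_mult_right)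
      show "AE p in M. (\<lambda>n. min (e n p) (L * ((k p)^2 / t p))) \<longlonglongrightarrow> 0"
        using e0 t
      proof eventually_elim
        case (elim p)
        have "0 \<le> L * ((k p)^2 / t p)" using elim L by simp
        then show ?case
          using tendsto_min[OF elim(1) tendsto_const[of "L * ((k p)^2 / t p)"]] by (simp add: min_def)
      qed
      show "AE p in M. norm (min (e n p) (L * ((k p)^2 / t p))) \<le> L * ((k p)^2 / t p)" for n
        using t
      proof eventually_elim
        case (elim p)
        have "0 \<le> L * ((k p)^2 / t p)" using elim L by simp
        then show ?case by (simp add: e_def min_def)
      qed
    qed measurable
    then show ?thesis by simp
  qed
  \<comment> \<open>Where \<open>e\<close> exceeds \<open>L k^2 / t\<close>, it is at most \<open>t |y n - z|^2 / L\<close>; the first part tends to 0 by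
    dominated convergence, the second is uniformly small for large \<open>L\<close>.\<close>
  have split: "(LINT p|M. e n p) \<le> (LINT p|M. min (e n p) (L * ((k p)^2 / t p))) + 4 * K / L" if L: "L > 0" for L n
  proof -
    have le: "e n p \<le> min (e n p) (L * ((k p)^2 / t p)) + t p * (cmod (y n p - z p))^2 / L" if tp: "0 < t p" for p
    proof (cases "e n p \<le> L * ((k p)^2 / t p)")
      case False
      let ?d = "cmod (y n p - z p)"
      have "L * (k p)^2 < e n p * t p" using False tp by (simp add: field_simps)
      then have "L * (\<bar>k p\<bar> * \<bar>k p\<bar>) < \<bar>k p\<bar> * ?d * t p" by (simp add: e_def norm_mult power2_eq_square)
      then have "\<bar>k p\<bar> * (L * \<bar>k p\<bar>) < \<bar>k p\<bar> * (?d * t p)" by (simp add: ac_simps)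
      then have "L * \<bar>k p\<bar> < ?d * t p" by (simp add: mult_less_cancel_left)
      then have "L * \<bar>k p\<bar> * ?d \<le> ?d * t p * ?d" by (intro mult_right_mono) auto
      then have "\<bar>k p\<bar> * ?d \<le> t p * ?d^2 / L"
        using L by (subst pos_le_divide_eq) (simp_all only: power2_eq_square ac_simps)
      then have "e n p \<le> t p * ?d^2 / L" by (simp add: e_def norm_mult)
      moreover have "0 \<le> L * ((k p)^2 / t p)" using tp L by simp
      ultimately show ?thesis using False by (simp add: min_def)
    qed (use tp L in simp)
    have im: "integrable M (\<lambda>p. min (e n p) (L * ((k p)^2 / t p)))"
      by (rule Bochner_Integration.integrable_min[OF ei integrable_mult_right[OF k]])
    have "(LINT p|M. e n p) \<le> (LINT p|M. min (e n p) (L * ((k p)^2 / t p)) + t p * (cmod (y n p - z p))^2 / L)"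
      using t by (intro integral_mono_AE ei) (use le im d2 in \<open>auto elim!: eventually_mono\<close>)
    also have "\<dots> = (LINT p|M. min (e n p) (L * ((k p)^2 / t p))) + (LINT p|M. t p * (cmod (y n p - z p))^2) / L"
      using im d2 by simp
    also have "\<dots> \<le> (LINT p|M. min (e n p) (L * ((k p)^2 / t p))) + 4 * K / L"
      using d4 L by (simp add: divide_right_mono)
    finally show ?thesis .
  qed
  have en: "0 \<le> (LINT p|M. e n p)" for n by (rule Bochner_Integration.integral_nonneg) (simp add: e_def)
  have "(\<lambda>n. \<integral>p. e n p \<partial>M) \<longlonglongrightarrow> 0"
  proof (rule LIMSEQ_I)
    fix r :: real assume r: "0 < r"
    define L where "L = 8 * K / r + 1"
    have L: "L > 0" using K0 r by (simp add: L_def add_nonneg_pos)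
    have "r * L = 8 * K + r" using r by (simp add: L_def distrib_left)
    then have "4 * K < r / 2 * L" using r by simp
    then have lt: "4 * K / L < r / 2" using L by (simp add: pos_divide_less_eq)
    obtain n0 where n0: "\<forall>n\<ge>n0. norm ((LINT p|M. min (e n p) (L * ((k p)^2 / t p))) - 0) < r / 2"
      using LIMSEQ_D[OF trunc[OF L], of "r/2"] r by auto
    show "\<exists>n0. \<forall>n\<ge>n0. norm ((LINT p|M. e n p) - 0) < r"
    proof (intro exI[of _ n0] allI impI)
      fix n assume "n \<ge> n0"
      with n0 have "\<bar>\<integral>p. min (e n p) (L * ((k p)^2 / t p)) \<partial>M\<bar> < r / 2" by simp
      then show "norm ((LINT p|M. e n p) - 0) < r"
        using split[OF L, of n] en[of n] lt unfolding real_norm_def by linarith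
    qed
  qed
  then have e_lim: "(\<lambda>n. \<integral>p. e n p \<partial>M) \<longlonglongrightarrow> 0" .
  have bd: "cmod ((LINT p|M. k p * y n p) - (LINT p|M. k p * z p)) \<le> (LINT p|M. e n p)" for n
  proof -
    have "(LINT p|M. k p * y n p) - (LINT p|M. k p * z p) = (LINT p|M. k p * (y n p - z p))"
      using ky kz by (simp add: right_diff_distrib)
    then show ?thesis unfolding e_def by (simp only: integral_norm_bound)
  qed
  have "(\<lambda>n. (LINT p|M. k p * y n p) - (LINT p|M. k p * z p)) \<longlonglongrightarrow> 0"
    by (rule Lim_null_comparison[OF always_eventually e_lim]) (intro allI bd)
  then show "(\<lambda>n. \<integral>p. k p * y n p \<partial>M) \<longlonglongrightarrow> (LINT p|M. k p * z p)" by (rule LIM_zero_cancel)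
qed

section \<open>Cauchy-Schwarz and the comparison of two-by-two systems\<close>

lemma weighted_Cauchy_Schwarz:
  fixes f g :: "'a \<Rightarrow> complex" and k :: "'a \<Rightarrow> real"
  assumes [measurable]: "f \<in> borel_measurable M" "g \<in> borel_measurable M" "k \<in> borel_measurable M"
    and k: "AE p in M. 0 \<le> k p"
    and f2: "integrable M (\<lambda>p. k p * (cmod (f p))^2)" and g2: "integrable M (\<lambda>p. k p * (cmod (g p))^2)"
  shows "integrable M (\<lambda>p. k p * (f p * g p))"
    and "cmod (LINT p|M. k p * (f p * g p))
      \<le> sqrt ((LINT p|M. k p * (cmod (f p))^2) * (LINT p|M. k p * (cmod (g p))^2))"
proof -
  define X where "X = (LINT p|M. k p * (cmod (f p))^2)"
  define Y where "Y = (LINT p|M. k p * (cmod (g p))^2)"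
  have le: "cmod (k p * (f p * g p)) \<le> l / 2 * (k p * (cmod (f p))^2) + 1 / (2 * l) * (k p * (cmod (g p))^2)"
    if "0 \<le> k p" "0 < l" for l p
  proof -
    have "0 \<le> (sqrt l * cmod (f p) - cmod (g p) / sqrt l)^2" by simp
    also have "\<dots> = l * (cmod (f p))^2 + (cmod (g p))^2 / l - 2 * (cmod (f p) * cmod (g p))"
      using that by (simp add: power2_diff power_divide power_mult_distrib)
    finally have "cmod (f p) * cmod (g p) \<le> l / 2 * (cmod (f p))^2 + 1 / (2 * l) * (cmod (g p))^2"
      by simp
    from mult_left_mono[OF this that(1)] show ?thesis
      using that(1) by (simp only: norm_mult norm_of_real abs_of_nonneg distrib_left ac_simps)
  qed
  have i: "integrable M (\<lambda>p. l / 2 * (k p * (cmod (f p))^2) + 1 / (2 * l) * (k p * (cmod (g p))^2))" for l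
    by (intro Bochner_Integration.integrable_add integrable_mult_right f2 g2)
  show fg: "integrable M (\<lambda>p. k p * (f p * g p))"
  proof (rule Bochner_Integration.integrable_bound[OF i[of 1]])
    show "AE p in M. cmod (k p * (f p * g p))
        \<le> norm (1 / 2 * (k p * (cmod (f p))^2) + 1 / (2 * 1) * (k p * (cmod (g p))^2))"
      using k
    proof eventually_elim
      case (elim p)
      from le[OF this, of 1] show ?case unfolding real_norm_def by linarith
    qed
  qed measurable
  have b: "cmod (LINT p|M. k p * (f p * g p)) \<le> l / 2 * X + 1 / (2 * l) * Y" if l: "0 < l" for l
  proof -
    have "cmod (LINT p|M. k p * (f p * g p)) \<le> (LINT p|M. cmod (k p * (f p * g p)))"
      by (rule integral_norm_bound)
    also have "\<dots> \<le> (LINT p|M. l / 2 * (k p * (cmod (f p))^2) + 1 / (2 * l) * (k p * (cmod (g p))^2))"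
      by (rule integral_mono_AE[OF integrable_norm[OF fg] i]) (use k in eventually_elim, rule le[OF _ l])
    also have "\<dots> = l / 2 * X + 1 / (2 * l) * Y"
      unfolding X_def Y_def using f2 g2 by (subst Bochner_Integration.integral_add) auto
    finally show ?thesis .
  qed
  have X0: "0 \<le> X" unfolding X_def by (rule integral_nonneg_AE) (use k in \<open>auto elim!: eventually_mono\<close>)
  have Y0: "0 \<le> Y" unfolding Y_def by (rule integral_nonneg_AE) (use k in \<open>auto elim!: eventually_mono\<close>)
  have "cmod (LINT p|M. k p * (f p * g p)) \<le> sqrt (X * Y)"
  proof (cases "X = 0 \<or> Y = 0")
    case False
    then have XY: "0 < X" "0 < Y" using X0 Y0 by auto
    define u v where "u = sqrt X" and "v = sqrt Y"
    have uv: "0 < u" "0 < v" "X = u * u" "Y = v * v" using XY by (auto simp: u_def v_def)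
    have "v / u / 2 * X + 1 / (2 * (v / u)) * Y = u * v"
      using uv(1,2) unfolding uv(3,4) by (simp add: field_simps)
    then have "cmod (LINT p|M. k p * (f p * g p)) \<le> u * v"
      using b[of "v / u"] uv(1,2) by simp
    then show ?thesis by (simp add: u_def v_def real_sqrt_mult)
  next
    case True
    then have "AE p in M. k p * (cmod (f p))^2 = 0 \<or> k p * (cmod (g p))^2 = 0"
    proof
      assume "X = 0"
      then have "AE p in M. k p * (cmod (f p))^2 = 0"
        unfolding X_def by (subst (asm) integral_nonneg_eq_0_iff_AE[OF f2]) (use k in \<open>auto elim!: eventually_mono\<close>)
      then show ?thesis by eventually_elim simp
    next
      assume "Y = 0"
      then have "AE p in M. k p * (cmod (g p))^2 = 0"
        unfolding Y_def by (subst (asm) integral_nonneg_eq_0_iff_AE[OF g2]) (use k in \<open>auto elim!: eventually_mono\<close>)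
      then show ?thesis by eventually_elim simp
    qed
    then have "AE p in M. k p * (f p * g p) = 0" by eventually_elim auto
    then have "(LINT p|M. k p * (f p * g p)) = 0" by (rule integral_eq_zero_AE)
    then show ?thesis using X0 Y0 by simp
  qed
  then show "cmod (LINT p|M. k p * (f p * g p))
      \<le> sqrt ((LINT p|M. k p * (cmod (f p))^2) * (LINT p|M. k p * (cmod (g p))^2))"
    by (simp only: X_def Y_def)
qed

text \<open>The reverse Cauchy-Schwarz inequality for the Lorentzian form \<open>x^2 - u^2\<close>, with \<open>u^2 = A\<close>.\<close>

lemma Aczel:
  fixes x x' A A' :: real
  assumes "0 \<le> x" "0 \<le> x'" "0 \<le> A" "0 \<le> A'" "A \<le> x^2" "A' \<le> x'^2"
  shows "sqrt ((x^2 - A) * (x'^2 - A')) \<le> x * x' - sqrt (A * A')"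
proof -
  define u v where "u = sqrt A" and "v = sqrt A'"
  have uv: "A = u^2" "A' = v^2" "0 \<le> u" "0 \<le> v" using assms by (auto simp: u_def v_def)
  have "u \<le> x" "v \<le> x'" using assms uv by (auto intro: power2_le_imp_le)
  then have 1: "u * v \<le> x * x'" using uv assms by (intro mult_mono) auto
  have "0 \<le> (x * v - x' * u)^2" by simp
  also have "\<dots> = (x * x' - u * v)^2 - (x^2 - u^2) * (x'^2 - v^2)" by (simp add: power2_eq_square algebra_simps)
  finally have "sqrt ((x^2 - u^2) * (x'^2 - v^2)) \<le> x * x' - u * v"
    using 1 by (intro real_le_lsqrt) auto
  then show ?thesis by (simp add: u_def v_def real_sqrt_mult assms)
qed

text \<open>Think of \<open>P = |dG|\<close> and \<open>R = |dM|\<close> for a vector in the kernel of the matrix with diagonal entries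
  of modulus \<open>\<alpha>\<close>, \<open>\<beta>\<close>. Each of the two real systems has the positive supersolution \<open>(a, b)\<close>, so the
  product of its diagonal entries is at least that of the off-diagonal ones. The geometric means
  inherit this, and a nonzero kernel vector can only exist if \<open>\<beta>\<close> does not exceed the geometric mean
  of \<open>1 - E\<close> and \<open>1 - E'\<close>.\<close>

lemma supersolution_comparison:
  fixes P R \<alpha> \<beta> x x' A B S E A' B' S' E' a b a' b' :: real
  assumes pos: "0 < a" "0 < b" "0 < a'" "0 < b'" "0 < x" "0 < x'" "0 \<le> P" "0 \<le> R"
    and nonneg: "0 \<le> A" "0 < B" "0 \<le> S" "0 \<le> E" "0 \<le> A'" "0 < B'" "0 \<le> S'" "0 \<le> E'"
    and sup: "a * A + b * B \<le> a * x^2" "a * S + b * E \<le> b"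
      "a' * A' + b' * B' \<le> a' * x'^2" "a' * S' + b' * E' \<le> b'"
    and R: "R * \<beta> \<le> sqrt (S * S') * P" and P: "P * \<alpha> \<le> sqrt (B * B') * R"
    and \<alpha>: "x * x' - sqrt (A * A') \<le> \<alpha>"
  shows "R = 0 \<and> P = 0 \<or> \<beta> \<le> sqrt ((1 - E) * (1 - E'))"
proof -
  define r where "r = b / a" define r' where "r' = b' / a'"
  have r: "0 < r" "0 < r'" using pos by (auto simp: r_def r'_def)
  have u: "r * B \<le> x^2 - A" "r' * B' \<le> x'^2 - A'"
    using sup pos by (auto simp: r_def r'_def field_simps)
  have v: "S \<le> r * (1 - E)" "S' \<le> r' * (1 - E')"
    using sup pos by (auto simp: r_def r'_def field_simps)
  have u0: "0 < r * B" "0 < r' * B'" using r nonneg by auto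
  have E1: "0 \<le> 1 - E" "0 \<le> 1 - E'" using v r nonneg by (smt (verit) mult_pos_neg)+
  define U where "U = sqrt ((x^2 - A) * (x'^2 - A'))"
  define q where "q = sqrt (r * r')"
  have q: "0 < q" using r by (simp add: q_def)
  have U: "0 < U" "U \<le> \<alpha>" using Aczel[of x x' A A'] \<alpha> u u0 pos nonneg by (auto simp: U_def)
  have "q * sqrt (B * B') = sqrt ((r * B) * (r' * B'))" by (simp add: q_def real_sqrt_mult)
  also have "\<dots> \<le> U" unfolding U_def using u u0 by (intro real_sqrt_le_mono mult_mono) auto
  finally have 1: "q * sqrt (B * B') \<le> U" .
  have "q * (P * U) \<le> q * (P * \<alpha>)" using U q pos by (intro mult_left_mono) auto
  also have "\<dots> \<le> q * (sqrt (B * B') * R)" using P q by (intro mult_left_mono) auto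
  also have "\<dots> \<le> U * R" using mult_right_mono[OF 1, of R] pos by (simp add: mult.assoc)
  finally have PR: "q * P \<le> R" using U(1) by (simp add: mult.left_commute[of q] mult.commute[of U] mult.commute[of q])
  have "sqrt (S * S') \<le> sqrt ((r * (1 - E)) * (r' * (1 - E')))"
    using v nonneg E1 r by (intro real_sqrt_le_mono mult_mono) auto
  also have "\<dots> = q * sqrt ((1 - E) * (1 - E'))" by (simp add: q_def real_sqrt_mult)
  finally have "sqrt (S * S') * P \<le> q * sqrt ((1 - E) * (1 - E')) * P"
    using pos by (intro mult_right_mono) auto
  also have "\<dots> = sqrt ((1 - E) * (1 - E')) * (q * P)" by simp
  also have "\<dots> \<le> sqrt ((1 - E) * (1 - E')) * R" using PR E1 by (intro mult_left_mono) auto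
  finally have "R * \<beta> \<le> R * sqrt ((1 - E) * (1 - E'))" using R by (simp add: mult.commute)
  moreover have "P = 0" if "R = 0"
  proof -
    have "q * P \<le> q * 0" using PR that by simp
    then show "P = 0" using q pos by (simp add: mult_le_0_iff)
  qed
  ultimately show ?thesis using pos by (cases "R = 0") auto
qed

section \<open>The linearised equations\<close>

locale spectral_law = prob_space H for H :: "(real \<times> real) measure" +
  fixes c :: real
  assumes sets_H [measurable_cong]: "sets H = sets borel"
    and s_nonneg: "AE p in H. 0 \<le> fst p"
    and t_pos: "AE p in H. 0 < snd p"
    and t_integrable: "integrable H snd"
    and inverse_t_integrable: "integrable H (\<lambda>p. 1 / snd p)"
    and c_pos: "0 < c" and c_le_1: "c \<le> 1"
begin

lemma fst_measurable[measurable]: "fst \<in> borel_measurable H"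
  and snd_measurable[measurable]: "snd \<in> borel_measurable H"
  using sets_H by (simp_all add: measurable_cong_sets[OF sets_H refl] borel_measurable_continuous_onI continuous_on_fst continuous_on_snd)

text \<open>The inequalities that survive in the limit. Here \<open>y = 1 / Q\<close>, and \<open>(a, b)\<close> is the limit of
  \<open>(Im G, Im M)\<close> up to a positive factor; the factor makes the condition meaningful even where both
  imaginary parts tend to 0. The weight \<open>b\<close> may vanish, but only if \<open>s = 0\<close> almost surely.\<close>

definition admissible :: "(real \<times> real \<Rightarrow> complex) \<Rightarrow> complex \<Rightarrow> bool" where
  "admissible y G \<longleftrightarrow>
     G \<noteq> 0 \<and> y \<in> borel_measurable H \<and> (AE p in H. y p \<noteq> 0) \<and>
     integrable H (\<lambda>p. snd p * (cmod (y p))^2) \<and> c * (LINT p|H. snd p * (cmod (y p))^2) \<le> 1 \<and>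
     (\<exists>a b. 0 < a \<and> 0 \<le> b \<and>
       integrable H (\<lambda>p. (fst p * a + snd p * b) * (cmod (y p))^2) \<and>
       c * (LINT p|H. (fst p * a + snd p * b) * (cmod (y p))^2) \<le> b \<and>
       integrable H (\<lambda>p. snd p * (fst p * a + snd p * b) * (cmod (y p))^2) \<and>
       c * (LINT p|H. snd p * (fst p * a + snd p * b) * (cmod (y p))^2) \<le> a / (cmod G)^2)"

lemma admissible_nondegenerate:
  assumes adm: "admissible y G" and s: "\<not> (AE p in H. fst p = 0)"
  obtains a b where "0 < a" "0 < b"
    "integrable H (\<lambda>p. fst p * (cmod (y p))^2)" "integrable H (\<lambda>p. snd p * (cmod (y p))^2)"
    "integrable H (\<lambda>p. snd p * fst p * (cmod (y p))^2)" "integrable H (\<lambda>p. (snd p)^2 * (cmod (y p))^2)"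
    "a * (c * (LINT p|H. snd p * fst p * (cmod (y p))^2)) + b * (c * (LINT p|H. (snd p)^2 * (cmod (y p))^2))
       \<le> a * (1 / cmod G)^2"
    "a * (c * (LINT p|H. fst p * (cmod (y p))^2)) + b * (c * (LINT p|H. snd p * (cmod (y p))^2)) \<le> b"
    "0 < c * (LINT p|H. (snd p)^2 * (cmod (y p))^2)"
proof -
  have [measurable]: "y \<in> borel_measurable H" and y0: "AE p in H. y p \<noteq> 0"
    and E: "integrable H (\<lambda>p. snd p * (cmod (y p))^2)" using adm by (auto simp: admissible_def)
  obtain a b where a: "0 < a" and b: "0 \<le> b"
    and i1: "integrable H (\<lambda>p. (fst p * a + snd p * b) * (cmod (y p))^2)"
    and l1: "c * (LINT p|H. (fst p * a + snd p * b) * (cmod (y p))^2) \<le> b"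
    and i2: "integrable H (\<lambda>p. snd p * (fst p * a + snd p * b) * (cmod (y p))^2)"
    and l2: "c * (LINT p|H. snd p * (fst p * a + snd p * b) * (cmod (y p))^2) \<le> a / (cmod G)^2"
    using adm unfolding admissible_def by blast
  have dom: "integrable H (\<lambda>p. k p * (cmod (y p))^2)"
    if [measurable]: "k \<in> borel_measurable H" and K: "integrable H (\<lambda>p. K p * (cmod (y p))^2)"
      and le: "AE p in H. 0 \<le> k p \<and> k p \<le> d * K p" for k K and d :: real
  proof (rule Bochner_Integration.integrable_bound)
    show "integrable H (\<lambda>p. d * (K p * (cmod (y p))^2))" using K by (rule integrable_mult_right)
    show "AE p in H. norm (k p * (cmod (y p))^2) \<le> norm (d * (K p * (cmod (y p))^2))"
      using le
    proof eventually_elim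
      case (elim p)
      then have "k p * (cmod (y p))^2 \<le> d * K p * (cmod (y p))^2" "0 \<le> k p * (cmod (y p))^2"
        by (auto intro: mult_right_mono)
      then show ?case unfolding real_norm_def mult.assoc[symmetric] by linarith
    qed
  qed measurable
  have "AE p in H. 0 \<le> fst p \<and> fst p \<le> 1 / a * (fst p * a + snd p * b)"
    using s_nonneg t_pos by eventually_elim (use a b in \<open>simp add: field_simps\<close>)
  then have S: "integrable H (\<lambda>p. fst p * (cmod (y p))^2)" by (rule dom[OF fst_measurable i1])
  have b: "0 < b"
  proof (rule ccontr)
    assume "\<not> 0 < b"
    then have "b = 0" using b by simp
    moreover have "(LINT p|H. fst p * a * (cmod (y p))^2) = a * (LINT p|H. fst p * (cmod (y p))^2)"
      by (subst integral_mult_right_zero[symmetric]) (simp only: ac_simps)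
    ultimately have "c * (LINT p|H. fst p * (cmod (y p))^2) * a \<le> 0"
      using l1 by (simp add: ac_simps)
    then have "(LINT p|H. fst p * (cmod (y p))^2) \<le> 0" using a c_pos by (simp add: mult_le_0_iff zero_le_mult_iff)
    moreover have nn: "AE p in H. 0 \<le> fst p * (cmod (y p))^2" using s_nonneg by eventually_elim simp
    ultimately have "(LINT p|H. fst p * (cmod (y p))^2) = 0" using integral_nonneg_AE[OF nn] by linarith
    then have "AE p in H. fst p * (cmod (y p))^2 = 0" using integral_nonneg_eq_0_iff_AE[OF S nn] by simp
    then have "AE p in H. fst p = 0" using y0 by eventually_elim simp
    then show False using s by simp
  qed
  have meas: "(\<lambda>p. snd p * fst p) \<in> borel_measurable H" "(\<lambda>p. (snd p)^2) \<in> borel_measurable H" by measurable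
  have "AE p in H. 0 \<le> snd p * fst p \<and> snd p * fst p \<le> 1 / a * (snd p * (fst p * a + snd p * b))"
    using s_nonneg t_pos by eventually_elim (use a b in \<open>simp add: field_simps\<close>)
  then have A: "integrable H (\<lambda>p. snd p * fst p * (cmod (y p))^2)" by (rule dom[OF meas(1) i2])
  have "AE p in H. 0 \<le> (snd p)^2 \<and> (snd p)^2 \<le> 1 / b * (snd p * (fst p * a + snd p * b))"
    using s_nonneg t_pos by eventually_elim (use a b in \<open>simp add: field_simps power2_eq_square\<close>)
  then have B: "integrable H (\<lambda>p. (snd p)^2 * (cmod (y p))^2)" by (rule dom[OF meas(2) i2])
  have "(LINT p|H. (fst p * a + snd p * b) * (cmod (y p))^2)
      = (LINT p|H. a * (fst p * (cmod (y p))^2) + b * (snd p * (cmod (y p))^2))"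
    by (rule Bochner_Integration.integral_cong) (simp_all add: algebra_simps)
  also have "\<dots> = a * (LINT p|H. fst p * (cmod (y p))^2) + b * (LINT p|H. snd p * (cmod (y p))^2)"
    using S E by (subst Bochner_Integration.integral_add) auto
  finally have 1: "a * (c * (LINT p|H. fst p * (cmod (y p))^2)) + b * (c * (LINT p|H. snd p * (cmod (y p))^2)) \<le> b"
    using l1 by (simp only: distrib_left ac_simps)
  have "(LINT p|H. snd p * (fst p * a + snd p * b) * (cmod (y p))^2)
      = (LINT p|H. a * (snd p * fst p * (cmod (y p))^2) + b * ((snd p)^2 * (cmod (y p))^2))"
    by (rule Bochner_Integration.integral_cong) (simp_all add: algebra_simps power2_eq_square)
  also have "\<dots> = a * (LINT p|H. snd p * fst p * (cmod (y p))^2) + b * (LINT p|H. (snd p)^2 * (cmod (y p))^2)"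
    using A B by (subst Bochner_Integration.integral_add) auto
  finally have 2: "a * (c * (LINT p|H. snd p * fst p * (cmod (y p))^2)) + b * (c * (LINT p|H. (snd p)^2 * (cmod (y p))^2))
       \<le> a * (1 / cmod G)^2"
    using l2 by (simp only: distrib_left ac_simps power_divide power_one times_divide_eq_right mult_1_right)
  have nn: "AE p in H. 0 < (snd p)^2 * (cmod (y p))^2" using t_pos y0 by eventually_elim simp
  then have nn0: "AE p in H. 0 \<le> (snd p)^2 * (cmod (y p))^2" by eventually_elim simp
  have "(LINT p|H. (snd p)^2 * (cmod (y p))^2) \<noteq> 0"
  proof
    assume "(LINT p|H. (snd p)^2 * (cmod (y p))^2) = 0"
    then have "AE p in H. (snd p)^2 * (cmod (y p))^2 = 0" using integral_nonneg_eq_0_iff_AE[OF B nn0] by simp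
    with nn have "AE p in H. False" by eventually_elim simp
    then show False by (simp add: AE_False)
  qed
  then have 3: "0 < c * (LINT p|H. (snd p)^2 * (cmod (y p))^2)"
    using integral_nonneg_AE[OF nn0] c_pos by (intro mult_pos_pos) linarith+
  show thesis by (rule that[OF a b S E A B 2 1 3])
qed

text \<open>The case of equality: the integral of \<open>t |y' - cnj y|^2\<close> is the left-hand side of the hypothesis
  minus its right-hand side.\<close>

lemma conjugate_resolvents:
  fixes y y' :: "real \<times> real \<Rightarrow> complex"
  assumes [measurable]: "y \<in> borel_measurable H" "y' \<in> borel_measurable H"
    and i: "integrable H (\<lambda>p. snd p * (cmod (y p))^2)" and i': "integrable H (\<lambda>p. snd p * (cmod (y' p))^2)"
    and re: "(LINT p|H. snd p * (cmod (y p))^2) + (LINT p|H. snd p * (cmod (y' p))^2)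
        \<le> 2 * Re (LINT p|H. snd p * (y p * y' p))"
  shows "AE p in H. y' p = cnj (y p)"
proof -
  have t0: "AE p in H. 0 \<le> snd p" using t_pos by eventually_elim simp
  have ii: "integrable H (\<lambda>p. snd p * (y p * y' p))"
    by (rule weighted_Cauchy_Schwarz(1)[OF _ _ _ t0 i i']) measurable
  have eq: "snd p * (cmod (y p))^2 + snd p * (cmod (y' p))^2 - 2 * Re (snd p * (y p * y' p))
      = snd p * (cmod (y' p - cnj (y p)))^2" for p :: "real \<times> real"
  proof -
    have "(cmod (y p))^2 + (cmod (y' p))^2 - 2 * Re (y p * y' p) = (cmod (y' p - cnj (y p)))^2"
      unfolding cmod_power2 by (simp add: power2_eq_square algebra_simps)
    from arg_cong[OF this, of "\<lambda>v. snd p * v"] show ?thesis by (simp add: algebra_simps)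
  qed
  have j: "integrable H (\<lambda>p. snd p * (cmod (y' p - cnj (y p)))^2)"
    unfolding eq[symmetric]
    by (intro Bochner_Integration.integrable_diff Bochner_Integration.integrable_add i i'
        integrable_mult_right integrable_Re ii)
  have "(LINT p|H. snd p * (cmod (y' p - cnj (y p)))^2)
     = (LINT p|H. snd p * (cmod (y p))^2) + (LINT p|H. snd p * (cmod (y' p))^2)
       - 2 * (LINT p|H. Re (snd p * (y p * y' p)))"
    unfolding eq[symmetric]
    by (simp only: Bochner_Integration.integral_diff Bochner_Integration.integral_add i i'
        Bochner_Integration.integrable_add integrable_mult_right integrable_Re ii integral_mult_right_zero)
  also have "(LINT p|H. Re (snd p * (y p * y' p))) = Re (LINT p|H. snd p * (y p * y' p))"
    by (rule integral_Re[OF ii])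
  finally have le: "(LINT p|H. snd p * (cmod (y' p - cnj (y p)))^2) \<le> 0" using re by linarith
  have nn: "AE p in H. 0 \<le> snd p * (cmod (y' p - cnj (y p)))^2" using t0 by eventually_elim simp
  have "(LINT p|H. snd p * (cmod (y' p - cnj (y p)))^2) = 0"
    using integral_nonneg_AE[OF nn] le by linarith
  then have "AE p in H. snd p * (cmod (y' p - cnj (y p)))^2 = 0"
    using integral_nonneg_eq_0_iff_AE[OF j nn] by simp
  then show ?thesis using t_pos by eventually_elim simp
qed

text \<open>The two equations for \<open>(dM, dG)\<close> are the differences of the fixed-point equations of two solutions with
  \<open>y = 1 / Q\<close>, \<open>y' = 1 / Q'\<close>; with \<open>y = y'\<close> they describe the kernel of the Jacobian.\<close>

lemma linearization_kernel:
  fixes y y' :: "real \<times> real \<Rightarrow> complex" and dM dG :: complex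
  assumes adm: "admissible y G" and adm': "admissible y' G'"
    and e1: "dM = of_real c * (LINT p|H. (of_real (fst p) * dG + of_real (snd p) * dM) * (y p * y' p))"
    and e2: "dG / (G * G') = of_real c * (LINT p|H. of_real (snd p) * (of_real (fst p) * dG + of_real (snd p) * dM) * (y p * y' p))"
  shows "(dM = 0 \<and> dG = 0) \<or> (AE p in H. y' p = cnj (y p))"
proof -
  have G: "G \<noteq> 0" "G' \<noteq> 0" and [measurable]: "y \<in> borel_measurable H" "y' \<in> borel_measurable H"
    using adm adm' by (auto simp: admissible_def)
  have iE: "integrable H (\<lambda>p. snd p * (cmod (y p))^2)" "integrable H (\<lambda>p. snd p * (cmod (y' p))^2)"
    and lE: "c * (LINT p|H. snd p * (cmod (y p))^2) \<le> 1" "c * (LINT p|H. snd p * (cmod (y' p))^2) \<le> 1"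
    using adm adm' by (auto simp: admissible_def)
  have t0: "AE p in H. 0 \<le> snd p" using t_pos by eventually_elim simp
  have tt0: "AE p in H. 0 \<le> (snd p)^2" by simp
  have st0: "AE p in H. 0 \<le> snd p * fst p" using t0 s_nonneg by eventually_elim simp
  define \<zeta> where "\<zeta> = (LINT p|H. snd p * (y p * y' p))"
  define E where "E = c * (LINT p|H. snd p * (cmod (y p))^2)"
  define E' where "E' = c * (LINT p|H. snd p * (cmod (y' p))^2)"
  have i\<zeta>: "integrable H (\<lambda>p. snd p * (y p * y' p))"
    by (rule weighted_Cauchy_Schwarz(1)[OF _ _ _ t0 iE]) measurable
  \<comment> \<open>By the inequality of the means this bound on \<open>|1 - c \<zeta>|\<close> already forces equality.\<close>
  have conj: "AE p in H. y' p = cnj (y p)" if b: "cmod (1 - c * \<zeta>) \<le> sqrt ((1 - E) * (1 - E'))"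
  proof (rule conjugate_resolvents[OF _ _ iE])
    have "sqrt ((1 - E) * (1 - E')) \<le> ((1 - E) + (1 - E')) / 2"
      using arith_geo_mean_sqrt[of "1 - E" "1 - E'"] lE by (simp add: E_def E'_def)
    moreover have "1 - c * Re \<zeta> \<le> cmod (1 - c * \<zeta>)" using complex_Re_le_cmod[of "1 - c * \<zeta>"] by simp
    ultimately have "E + E' \<le> 2 * (c * Re \<zeta>)" using b by argo
    then have "c * ((LINT p|H. snd p * (cmod (y p))^2) + (LINT p|H. snd p * (cmod (y' p))^2)) \<le> c * (2 * Re \<zeta>)"
      by (simp add: E_def E'_def algebra_simps)
    then show "(LINT p|H. snd p * (cmod (y p))^2) + (LINT p|H. snd p * (cmod (y' p))^2)
        \<le> 2 * Re (LINT p|H. snd p * (y p * y' p))"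
      using c_pos unfolding \<zeta>_def[symmetric] by (simp only: mult_le_cancel_left_pos)
  qed measurable
  show ?thesis
  \<comment> \<open>If \<open>s = 0\<close>, then \<open>t^2 |y|^2\<close> need not be integrable, but the first equation decouples.\<close>
  proof (cases "AE p in H. fst p = 0")
    case True
    have "(LINT p|H. (of_real (fst p) * dG + of_real (snd p) * dM) * (y p * y' p)) = (LINT p|H. dM * (snd p * (y p * y' p)))"
    proof (rule integral_cong_AE)
      show "AE p in H. (of_real (fst p) * dG + of_real (snd p) * dM) * (y p * y' p) = dM * (of_real (snd p) * (y p * y' p))"
        using True by eventually_elim simp
    qed measurable
    then have eq: "dM * (1 - c * \<zeta>) = 0" using e1 by (simp add: \<zeta>_def algebra_simps)
    show ?thesis
    proof (cases "dM = 0")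
      case dM: True
      have "(LINT p|H. of_real (snd p) * (of_real (fst p) * dG + of_real (snd p) * dM) * (y p * y' p)) = 0"
      proof (rule integral_eq_zero_AE)
        show "AE p in H. of_real (snd p) * (of_real (fst p) * dG + of_real (snd p) * dM) * (y p * y' p) = 0"
          using True by eventually_elim (simp add: dM)
      qed
      then have "dG = 0" using e2 G by simp
      then show ?thesis using dM by simp
    next
      case False
      then have "1 - c * \<zeta> = 0" using eq by simp
      then show ?thesis using conj lE unfolding E_def E'_def by simp
    qed
  next
    case False
    obtain a b where ab: "0 < a" "0 < b"
      and S: "integrable H (\<lambda>p. fst p * (cmod (y p))^2)"
      and A: "integrable H (\<lambda>p. snd p * fst p * (cmod (y p))^2)"
      and B: "integrable H (\<lambda>p. (snd p)^2 * (cmod (y p))^2)"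
      and l: "a * (c * (LINT p|H. snd p * fst p * (cmod (y p))^2)) + b * (c * (LINT p|H. (snd p)^2 * (cmod (y p))^2))
         \<le> a * (1 / cmod G)^2"
        "a * (c * (LINT p|H. fst p * (cmod (y p))^2)) + b * (c * (LINT p|H. snd p * (cmod (y p))^2)) \<le> b"
      and B0: "0 < c * (LINT p|H. (snd p)^2 * (cmod (y p))^2)"
      by (rule admissible_nondegenerate[OF adm False])
    obtain a' b' where ab': "0 < a'" "0 < b'"
      and S': "integrable H (\<lambda>p. fst p * (cmod (y' p))^2)"
      and A': "integrable H (\<lambda>p. snd p * fst p * (cmod (y' p))^2)"
      and B': "integrable H (\<lambda>p. (snd p)^2 * (cmod (y' p))^2)"
      and l': "a' * (c * (LINT p|H. snd p * fst p * (cmod (y' p))^2)) + b' * (c * (LINT p|H. (snd p)^2 * (cmod (y' p))^2))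
         \<le> a' * (1 / cmod G')^2"
        "a' * (c * (LINT p|H. fst p * (cmod (y' p))^2)) + b' * (c * (LINT p|H. snd p * (cmod (y' p))^2)) \<le> b'"
      and B0': "0 < c * (LINT p|H. (snd p)^2 * (cmod (y' p))^2)"
      by (rule admissible_nondegenerate[OF adm' False])
    define \<sigma> where "\<sigma> = (LINT p|H. fst p * (y p * y' p))"
    define \<theta> where "\<theta> = (LINT p|H. (snd p * fst p) * (y p * y' p))"
    define \<tau> where "\<tau> = (LINT p|H. (snd p)^2 * (y p * y' p))"
    have cs: "integrable H (\<lambda>p. of_real (k p) * (y p * y' p))"
      "c * cmod (LINT p|H. of_real (k p) * (y p * y' p)) \<le> sqrt ((c * (LINT p|H. k p * (cmod (y p))^2)) * (c * (LINT p|H. k p * (cmod (y' p))^2)))"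
      if [measurable]: "k \<in> borel_measurable H" and k: "AE p in H. 0 \<le> k p"
        "integrable H (\<lambda>p. k p * (cmod (y p))^2)" "integrable H (\<lambda>p. k p * (cmod (y' p))^2)" for k
    proof -
      have scale: "c * sqrt (u * v) = sqrt ((c * u) * (c * v))" for u v
        using c_pos by (simp add: real_sqrt_mult)
      show "integrable H (\<lambda>p. of_real (k p) * (y p * y' p))"
        by (rule weighted_Cauchy_Schwarz(1)[OF _ _ _ k]) measurable
      show "c * cmod (LINT p|H. of_real (k p) * (y p * y' p)) \<le> sqrt ((c * (LINT p|H. k p * (cmod (y p))^2)) * (c * (LINT p|H. k p * (cmod (y' p))^2)))"
        unfolding scale[symmetric] using c_pos
        by (intro mult_left_mono weighted_Cauchy_Schwarz(2)[OF _ _ _ k]) auto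
    qed
    note i\<sigma> = cs(1)[OF fst_measurable s_nonneg S S'] and c\<sigma> = cs(2)[OF fst_measurable s_nonneg S S', folded \<sigma>_def]
    have m\<theta>: "(\<lambda>p. snd p * fst p) \<in> borel_measurable H" and m\<tau>: "(\<lambda>p. (snd p)^2) \<in> borel_measurable H" by measurable
    note i\<theta> = cs(1)[OF m\<theta> st0 A A'] and c\<theta> = cs(2)[OF m\<theta> st0 A A', folded \<theta>_def]
    note i\<tau> = cs(1)[OF m\<tau> tt0 B B'] and c\<tau> = cs(2)[OF m\<tau> tt0 B B', folded \<tau>_def]
    have "(LINT p|H. (of_real (fst p) * dG + of_real (snd p) * dM) * (y p * y' p))
        = (LINT p|H. dG * (fst p * (y p * y' p)) + dM * (snd p * (y p * y' p)))"
      by (rule Bochner_Integration.integral_cong) (simp_all add: algebra_simps)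
    also have "\<dots> = dG * \<sigma> + dM * \<zeta>"
      unfolding \<sigma>_def \<zeta>_def using i\<sigma> i\<zeta> by (subst Bochner_Integration.integral_add) auto
    finally have eq1: "dM * (1 - c * \<zeta>) = c * \<sigma> * dG" using e1 by (simp add: algebra_simps)
    have "(LINT p|H. of_real (snd p) * (of_real (fst p) * dG + of_real (snd p) * dM) * (y p * y' p))
        = (LINT p|H. dG * (complex_of_real (snd p * fst p) * (y p * y' p)) + dM * (complex_of_real ((snd p)^2) * (y p * y' p)))"
      by (rule Bochner_Integration.integral_cong) (simp_all add: algebra_simps power2_eq_square)
    also have "\<dots> = dG * \<theta> + dM * \<tau>"
      unfolding \<theta>_def \<tau>_def using i\<theta> i\<tau> by (subst Bochner_Integration.integral_add) auto
    finally have eq2: "dG * (1 / (G * G') - c * \<theta>) = c * \<tau> * dM" using e2 by (simp add: algebra_simps)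
    have nn: "0 \<le> c * integral\<^sup>L H f" if "AE p in H. 0 \<le> f p" for f :: "real \<times> real \<Rightarrow> real"
      using c_pos integral_nonneg_AE[OF that] by simp
    have "cmod dM = 0 \<and> cmod dG = 0 \<or> cmod (1 - c * \<zeta>) \<le> sqrt ((1 - E) * (1 - E'))"
    proof (rule supersolution_comparison[OF ab ab' _ _ _ _ _ B0 _ _ _ B0' _ _ l(1) l(2)[folded E_def] l'(1) l'(2)[folded E'_def]])
      show "0 < 1 / cmod G" "0 < 1 / cmod G'" using G by auto
      show "0 \<le> c * (LINT p|H. snd p * fst p * (cmod (y p))^2)" "0 \<le> c * (LINT p|H. snd p * fst p * (cmod (y' p))^2)"
        by (rule nn, use st0 in \<open>eventually_elim, simp\<close>)+
      show "0 \<le> c * (LINT p|H. fst p * (cmod (y p))^2)" "0 \<le> c * (LINT p|H. fst p * (cmod (y' p))^2)"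
        by (rule nn, use s_nonneg in \<open>eventually_elim, simp\<close>)+
      show "0 \<le> E" "0 \<le> E'" unfolding E_def E'_def
        by (rule nn, use t0 in \<open>eventually_elim, simp\<close>)+
      have "cmod dM * cmod (1 - c * \<zeta>) = (c * cmod \<sigma>) * cmod dG"
        using arg_cong[OF eq1, of cmod] c_pos by (simp add: norm_mult)
      also have "\<dots> \<le> sqrt ((c * (LINT p|H. fst p * (cmod (y p))^2)) * (c * (LINT p|H. fst p * (cmod (y' p))^2))) * cmod dG"
        by (rule mult_right_mono[OF c\<sigma>]) simp
      finally show "cmod dM * cmod (1 - c * \<zeta>) \<le> \<dots>" .
      have "cmod dG * cmod (1 / (G * G') - c * \<theta>) = (c * cmod \<tau>) * cmod dM"
        using arg_cong[OF eq2, of cmod] c_pos by (simp add: norm_mult)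
      also have "\<dots> \<le> sqrt ((c * (LINT p|H. (snd p)^2 * (cmod (y p))^2)) * (c * (LINT p|H. (snd p)^2 * (cmod (y' p))^2))) * cmod dM"
        by (rule mult_right_mono[OF c\<tau>]) simp
      finally show "cmod dG * cmod (1 / (G * G') - c * \<theta>) \<le> \<dots>" .
      have "1 / cmod G * (1 / cmod G') - c * cmod \<theta> = cmod (1 / (G * G')) - cmod (c * \<theta>)"
        using c_pos by (simp add: norm_mult norm_divide)
      also have "\<dots> \<le> cmod (1 / (G * G') - c * \<theta>)" by (rule norm_triangle_ineq2)
      finally show "1 / cmod G * (1 / cmod G') - sqrt ((c * (LINT p|H. snd p * fst p * (cmod (y p))^2)) * (c * (LINT p|H. snd p * fst p * (cmod (y' p))^2)))
          \<le> cmod (1 / (G * G') - c * \<theta>)" using c\<theta> by linarith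
    qed simp_all
    then show ?thesis using conj by auto
  qed
qed

section \<open>Solutions of the symmetrised equations\<close>

text \<open>The reciprocal of the denominator \<open>Q = w + s G + t M\<close>.\<close>

definition resolvent :: "complex \<Rightarrow> complex \<Rightarrow> complex \<Rightarrow> real \<times> real \<Rightarrow> complex" where
  "resolvent w M G p = inverse (w + of_real (fst p) * G + of_real (snd p) * M)"

lemma resolvent_measurable[measurable]: "resolvent w M G \<in> borel_measurable H"
  unfolding resolvent_def[abs_def] by measurable

definition solves :: "complex \<Rightarrow> complex \<Rightarrow> complex \<Rightarrow> bool" where
  "solves w M G \<longleftrightarrow>
     integrable H (resolvent w M G) \<and> integrable H (\<lambda>p. of_real (snd p) * resolvent w M G p) \<and>
     M = - of_real (1 - c) / w - of_real c * (LINT p|H. resolvent w M G p) \<and>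
     - 1 / G = w - of_real c * (LINT p|H. of_real (snd p) * resolvent w M G p)"

lemma Im_inverse_norm: "Im (inverse z) = - Im z * (cmod (inverse z))^2"
  by (simp add: norm_inverse cmod_power2 power_inverse divide_inverse)

text \<open>All bounds come from \<open>- Im (1 / Q) = Im Q / |Q|^2\<close>: the imaginary parts of the two equations express
  the integrals of \<open>Im Q / |Q|^2\<close> and \<open>t Im Q / |Q|^2\<close> by \<open>Im M\<close> and \<open>Im G\<close>, and \<open>Im Q\<close> is a sum of nonnegative
  terms.\<close>

lemma solution_energy:
  assumes sol: "solves w M G" and w: "0 \<le> Im w" and M: "0 < Im M" and G: "0 < Im G"
  defines "y \<equiv> resolvent w M G"
  shows "AE p in H. y p \<noteq> 0"
    and "integrable H (\<lambda>p. snd p * (cmod (y p))^2)" "c * (LINT p|H. snd p * (cmod (y p))^2) \<le> 1"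
    and "integrable H (\<lambda>p. (fst p * Im G + snd p * Im M) * (cmod (y p))^2)"
      "c * (LINT p|H. (fst p * Im G + snd p * Im M) * (cmod (y p))^2) \<le> Im M"
    and "integrable H (\<lambda>p. snd p * (fst p * Im G + snd p * Im M) * (cmod (y p))^2)"
      "c * (LINT p|H. snd p * (fst p * Im G + snd p * Im M) * (cmod (y p))^2) \<le> Im G / (cmod G)^2"
proof -
  have [measurable]: "y \<in> borel_measurable H" unfolding y_def by measurable
  have iy: "integrable H y" and ity: "integrable H (\<lambda>p. of_real (snd p) * y p)"
    and eM: "M = - of_real (1 - c) / w - of_real c * (LINT p|H. y p)" and eG: "- 1 / G = w - of_real c * (LINT p|H. of_real (snd p) * y p)"
    using sol by (auto simp: solves_def y_def)
  have Imy: "- Im (y p) = (Im w + (fst p * Im G + snd p * Im M)) * (cmod (y p))^2" for p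
    unfolding y_def resolvent_def by (subst Im_inverse_norm) (simp add: algebra_simps)
  have Qpos: "0 < Im w + (fst p * Im G + snd p * Im M)" if "0 \<le> fst p" "0 < snd p" for p
    using that w M G by (intro add_nonneg_pos) auto
  show y0: "AE p in H. y p \<noteq> 0"
    using s_nonneg t_pos
  proof eventually_elim
    case (elim p)
    have "w + fst p * G + snd p * M \<noteq> 0" using Qpos[OF elim] by (auto simp: complex_eq_iff)
    then show ?case by (simp add: y_def resolvent_def)
  qed
  define J where "J p = - Im (y p)" for p
  have iJ: "integrable H J" unfolding J_def by (intro Bochner_Integration.integrable_minus integrable_Im iy)
  have itJ: "integrable H (\<lambda>p. snd p * J p)"
    using integrable_Im[OF ity] by (simp add: J_def)
  have "c * (LINT p|H. J p) = Im M - (1 - c) * Im w / (cmod w)^2"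
  proof -
    have "(LINT p|H. J p) = - Im (LINT p|H. y p)" unfolding J_def using integral_Im[OF iy] by simp
    moreover have "Im M = Im (- of_real (1 - c) / w) - c * Im (LINT p|H. y p)" using arg_cong[OF eM, of Im] by simp
    moreover have "Im (- of_real (1 - c) / w) = (1 - c) * Im w / (cmod w)^2"
      by (simp add: Im_divide cmod_power2 minus_divide_left algebra_simps)
    ultimately show ?thesis by simp
  qed
  then have cJ: "c * (LINT p|H. J p) \<le> Im M" using w c_le_1 by simp
  have ctJ: "c * (LINT p|H. snd p * J p) \<le> Im G / (cmod G)^2"
  proof -
    have "(LINT p|H. snd p * J p) = - Im (LINT p|H. snd p * y p)"
      unfolding J_def using integral_Im[OF ity] by simp
    moreover have "Im (- 1 / G) = Im w - c * Im (LINT p|H. snd p * y p)" using arg_cong[OF eG, of Im] by simp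
    moreover have "Im (- 1 / G) = Im G / (cmod G)^2" by (simp add: Im_divide cmod_power2)
    ultimately show ?thesis using w by simp
  qed
  have le: "AE p in H. (fst p * Im G + snd p * Im M) * (cmod (y p))^2 \<le> J p \<and>
      0 \<le> (fst p * Im G + snd p * Im M) * (cmod (y p))^2 \<and> 0 \<le> J p \<and>
      0 \<le> snd p * (cmod (y p))^2 \<and> snd p * (cmod (y p))^2 \<le> J p / Im M \<and> 0 < snd p"
    using s_nonneg t_pos
  proof eventually_elim
    case (elim p)
    have 0: "0 \<le> fst p * Im G" "0 \<le> snd p * Im M" using elim M G by auto
    have "(fst p * Im G + snd p * Im M) * (cmod (y p))^2 \<le> J p"
      unfolding J_def Imy using w by (intro mult_right_mono) auto
    moreover have "snd p * Im M * (cmod (y p))^2 \<le> J p"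
      unfolding J_def Imy using w 0 by (intro mult_right_mono) auto
    then have "snd p * (cmod (y p))^2 \<le> J p / Im M" using M by (simp add: pos_le_divide_eq ac_simps)
    moreover have "0 \<le> (fst p * Im G + snd p * Im M) * (cmod (y p))^2" using 0 by simp
    ultimately show ?case using elim by auto
  qed
  show 1: "integrable H (\<lambda>p. snd p * (cmod (y p))^2)"
  proof (rule Bochner_Integration.integrable_bound)
    show "integrable H (\<lambda>p. J p / Im M)" using iJ by simp
    show "AE p in H. norm (snd p * (cmod (y p))^2) \<le> norm (J p / Im M)"
      using le by eventually_elim (use M in simp)
  qed measurable
  show 2: "integrable H (\<lambda>p. (fst p * Im G + snd p * Im M) * (cmod (y p))^2)"
  proof (rule Bochner_Integration.integrable_bound[OF iJ])
    show "AE p in H. norm ((fst p * Im G + snd p * Im M) * (cmod (y p))^2) \<le> norm (J p)"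
      using le by eventually_elim simp
  qed measurable
  show 3: "integrable H (\<lambda>p. snd p * (fst p * Im G + snd p * Im M) * (cmod (y p))^2)"
  proof (rule Bochner_Integration.integrable_bound[OF itJ])
    show "AE p in H. norm (snd p * (fst p * Im G + snd p * Im M) * (cmod (y p))^2) \<le> norm (snd p * J p)"
      using le
    proof eventually_elim
      case (elim p)
      then have "snd p * ((fst p * Im G + snd p * Im M) * (cmod (y p))^2) \<le> snd p * J p"
        "0 \<le> snd p * ((fst p * Im G + snd p * Im M) * (cmod (y p))^2)"
        by (auto intro: mult_left_mono)
      then show ?case unfolding real_norm_def mult.assoc[of "snd p"] by linarith
    qed
  qed measurable
  have "(LINT p|H. (fst p * Im G + snd p * Im M) * (cmod (y p))^2) \<le> (LINT p|H. J p)"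
    by (rule integral_mono_AE[OF 2 iJ]) (use le in \<open>eventually_elim, simp\<close>)
  from mult_left_mono[OF this, of c] show "c * (LINT p|H. (fst p * Im G + snd p * Im M) * (cmod (y p))^2) \<le> Im M"
    using c_pos cJ by linarith
  have "(LINT p|H. snd p * (fst p * Im G + snd p * Im M) * (cmod (y p))^2) \<le> (LINT p|H. snd p * J p)"
    by (rule integral_mono_AE[OF 3 itJ]) (use le in \<open>eventually_elim, simp add: mult.assoc mult_left_mono\<close>)
  from mult_left_mono[OF this, of c]
  show "c * (LINT p|H. snd p * (fst p * Im G + snd p * Im M) * (cmod (y p))^2) \<le> Im G / (cmod G)^2"
    using c_pos ctJ by linarith
  have "(LINT p|H. snd p * (cmod (y p))^2) \<le> (LINT p|H. J p / Im M)"
    by (rule integral_mono_AE[OF 1]) (use iJ in simp, use le in \<open>eventually_elim, simp\<close>)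
  also have "\<dots> = (LINT p|H. J p) / Im M" by simp
  finally have "c * (LINT p|H. snd p * (cmod (y p))^2) \<le> c * ((LINT p|H. J p) / Im M)"
    using c_pos by (intro mult_left_mono) auto
  also have "\<dots> \<le> 1" using cJ M by simp
  finally show "c * (LINT p|H. snd p * (cmod (y p))^2) \<le> 1" .
qed

lemma admissible_of_solution:
  assumes "solves w M G" "0 \<le> Im w" "0 < Im M" "0 < Im G"
  shows "admissible (resolvent w M G) G"
proof -
  have "G \<noteq> 0" using assms(4) by auto
  then show ?thesis
    unfolding admissible_def
    by (intro conjI exI[of _ "Im G"] exI[of _ "Im M"] solution_energy[where M=M and G=G and w=w] resolvent_measurable)
      (use assms in auto)
qed

text \<open>Both integrals in the equations are controlled by the bound on \<open>t / |Q|^2\<close>, splitting \<open>1 / Q\<close> by AM-GM.\<close>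

lemma solution_bounds:
  assumes sol: "solves w M G" and w: "0 \<le> Im w" and M: "0 < Im M" and G: "0 < Im G"
  shows "cmod M \<le> cmod (1 / w) + c * (LINT p|H. 1 / snd p) + 1"
    and "cmod (1 / G) \<le> cmod w + c * (LINT p|H. snd p) + 1"
proof -
  let ?y = "resolvent w M G"
  note en = solution_energy(2,3)[where M=M and G=G and w=w, OF sol w M G]
  have eM: "M = - of_real (1 - c) / w - of_real c * (LINT p|H. ?y p)" and eG: "- 1 / G = w - of_real c * (LINT p|H. of_real (snd p) * ?y p)"
    and iy: "integrable H ?y" and ity: "integrable H (\<lambda>p. of_real (snd p) * ?y p)"
    using sol by (auto simp: solves_def)
  have amgm: "cmod u \<le> 1 / t + t * (cmod u)^2" if "0 < t" for t :: real and u :: complex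
  proof -
    have "0 \<le> (1 - t * cmod u)^2" by simp
    also have "(1 - t * cmod u)^2 = 1 + t * (t * (cmod u)^2) - 2 * t * cmod u"
      by (simp add: power2_eq_square algebra_simps)
    also have "2 * t * cmod u = 2 * (t * cmod u)" by simp
    finally have "t * cmod u \<le> 1 + t * (t * (cmod u)^2)"
      using mult_nonneg_nonneg[OF less_imp_le[OF that] norm_ge_zero[of u]] by linarith
    then have "t * cmod u \<le> t * (1 / t + t * (cmod u)^2)" using that by (simp add: distrib_left)
    then show ?thesis using that by (simp only: mult_le_cancel_left_pos)
  qed
  have amgm2: "t * cmod u \<le> t + t * (cmod u)^2" if "0 < t" for t :: real and u :: complex
  proof -
    have "0 \<le> (1 - cmod u)^2" by simp
    also have "\<dots> = 1 + (cmod u)^2 - 2 * cmod u" by (simp add: power2_diff)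
    finally have "cmod u \<le> 1 + (cmod u)^2" using norm_ge_zero[of u] by linarith
    from mult_left_mono[OF this, of t] show ?thesis using that by (simp add: distrib_left)
  qed
  have "cmod (LINT p|H. ?y p) \<le> (LINT p|H. cmod (?y p))" by (rule integral_norm_bound)
  also have "\<dots> \<le> (LINT p|H. 1 / snd p + snd p * (cmod (?y p))^2)"
    by (rule integral_mono_AE[OF integrable_norm[OF iy] Bochner_Integration.integrable_add[OF inverse_t_integrable en(1)]])
      (use t_pos in eventually_elim, rule amgm)
  also have "\<dots> = (LINT p|H. 1 / snd p) + (LINT p|H. snd p * (cmod (?y p))^2)"
    by (rule Bochner_Integration.integral_add[OF inverse_t_integrable en(1)])
  finally have "c * cmod (LINT p|H. ?y p) \<le> c * ((LINT p|H. 1 / snd p) + (LINT p|H. snd p * (cmod (?y p))^2))"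
    using c_pos by (intro mult_left_mono) auto
  then have 1: "c * cmod (LINT p|H. ?y p) \<le> c * (LINT p|H. 1 / snd p) + 1"
    using en(2) unfolding distrib_left by linarith
  have "cmod M \<le> cmod (- of_real (1 - c) / w) + cmod (c * (LINT p|H. ?y p))"
    using norm_triangle_ineq4[of "- of_real (1 - c) / w" "of_real c * (LINT p|H. ?y p)"] eM by simp
  moreover have "cmod (- of_real (1 - c) / w) \<le> cmod (1 / w)"
    using c_pos c_le_1 unfolding norm_divide norm_minus_cancel norm_of_real by (simp add: divide_right_mono)
  moreover have "cmod (c * (LINT p|H. ?y p)) = c * cmod (LINT p|H. ?y p)" using c_pos by (simp add: norm_mult)
  ultimately show "cmod M \<le> cmod (1 / w) + c * (LINT p|H. 1 / snd p) + 1" using 1 by linarith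
  have "cmod (LINT p|H. snd p * ?y p) \<le> (LINT p|H. cmod (snd p * ?y p))" by (rule integral_norm_bound)
  also have "\<dots> \<le> (LINT p|H. snd p + snd p * (cmod (?y p))^2)"
  proof (rule integral_mono_AE[OF integrable_norm[OF ity] Bochner_Integration.integrable_add[OF t_integrable en(1)]])
    show "AE p in H. cmod (snd p * ?y p) \<le> snd p + snd p * (cmod (?y p))^2"
      using t_pos
    proof eventually_elim
      case (elim p) then show ?case using amgm2[OF elim, of "?y p"] by (simp only: norm_mult norm_of_real abs_of_pos)
    qed
  qed
  also have "\<dots> = (LINT p|H. snd p) + (LINT p|H. snd p * (cmod (?y p))^2)"
    by (rule Bochner_Integration.integral_add[OF t_integrable en(1)])
  finally have "c * cmod (LINT p|H. snd p * ?y p) \<le> c * ((LINT p|H. snd p) + (LINT p|H. snd p * (cmod (?y p))^2))"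
    using c_pos by (intro mult_left_mono) auto
  then have 2: "c * cmod (LINT p|H. snd p * ?y p) \<le> c * (LINT p|H. snd p) + 1"
    using en(2) unfolding distrib_left by linarith
  have "cmod (1 / G) = cmod (- 1 / G)" by (simp add: norm_divide)
  also have "\<dots> \<le> cmod w + cmod (c * (LINT p|H. snd p * ?y p))" unfolding eG by (rule norm_triangle_ineq4)
  also have "cmod (c * (LINT p|H. snd p * ?y p)) = c * cmod (LINT p|H. snd p * ?y p)" using c_pos by (simp add: norm_mult)
  finally show "cmod (1 / G) \<le> cmod w + c * (LINT p|H. snd p) + 1" using 2 by linarith
qed

end

section \<open>Existence of the boundary limit\<close>

lemma tendsto_within_of_subsequences:
  fixes f :: "'a::metric_space \<Rightarrow> 'b::metric_space"
  assumes x: "x \<notin> S"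
    and sub: "\<And>z. (\<And>n. z n \<in> S) \<Longrightarrow> z \<longlonglongrightarrow> x \<Longrightarrow> \<exists>r. strict_mono r \<and> (\<lambda>n. f (z (r n))) \<longlonglongrightarrow> L"
  shows "(f \<longlongrightarrow> L) (at x within S)"
proof (rule ccontr)
  assume "\<not> (f \<longlongrightarrow> L) (at x within S)"
  then obtain e where e: "e > 0" and "\<And>d. d > 0 \<Longrightarrow> \<exists>z\<in>S. 0 < dist z x \<and> dist z x < d \<and> e \<le> dist (f z) L"
    by (force simp: Lim_within not_less)
  then have "\<exists>z. z \<in> S \<and> dist z x < 1 / Suc n \<and> e \<le> dist (f z) L" for n
    by (metis of_nat_0_less_iff zero_less_Suc zero_less_divide_1_iff)
  then obtain z where z: "\<And>n. z n \<in> S" "\<And>n. dist (z n) x < 1 / Suc n" "\<And>n. e \<le> dist (f (z n)) L"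
    by metis
  have "(\<lambda>n. dist (z n) x) \<longlonglongrightarrow> 0"
    by (rule tendsto_sandwich[OF _ _ tendsto_const LIMSEQ_Suc[OF lim_inverse_n']])
      (use z(2) in \<open>auto intro!: always_eventually less_imp_le\<close>)
  then have "z \<longlonglongrightarrow> x" by (simp add: tendsto_dist_iff[of z x])
  from sub[OF z(1) this] obtain r where "(\<lambda>n. f (z (r n))) \<longlonglongrightarrow> L" by blast
  from tendstoD[OF this e] obtain n where "dist (f (z (r n))) L < e"
    by (auto simp: eventually_sequentially)
  then show False using z(3)[of "r n"] by simp
qed

lemma convergent_subsequence_bounded:
  fixes f :: "nat \<Rightarrow> 'a::euclidean_space"
  assumes "\<forall>\<^sub>F n in sequentially. norm (f n) \<le> K"
  obtains l r where "strict_mono (r :: nat \<Rightarrow> nat)" "(\<lambda>n. f (r n)) \<longlonglongrightarrow> l"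
proof -
  obtain n0 where n0: "\<And>n. n \<ge> n0 \<Longrightarrow> norm (f n) \<le> K" using assms by (auto simp: eventually_sequentially)
  have "bounded (range (\<lambda>n. f (n + n0)))" unfolding bounded_iff using n0 by (intro exI[of _ K]) auto
  from bounded_imp_convergent_subsequence[OF this]
  obtain l r where r: "strict_mono r" and l: "((\<lambda>n. f (n + n0)) \<circ> r) \<longlonglongrightarrow> l" by blast
  show thesis
    by (rule that[of "\<lambda>n. r n + n0" l]) (use r l in \<open>auto simp: strict_mono_def o_def\<close>)
qed

context spectral_law
begin

lemma le_divide_c: "c * u \<le> v \<longleftrightarrow> u \<le> v / c"
  using pos_le_divide_eq[OF c_pos, of u v] by (simp only: mult.commute)

lemma resolvent_alternative:
  assumes "w \<longlonglongrightarrow> w0" "M \<longlonglongrightarrow> M0" "G \<longlonglongrightarrow> G0"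
    and nz: "\<And>n. resolvent (w n) (M n) (G n) p \<noteq> 0"
  shows "(\<lambda>n. resolvent (w n) (M n) (G n) p) \<longlonglongrightarrow> resolvent w0 M0 G0 p \<or>
    filterlim (\<lambda>n. cmod (resolvent (w n) (M n) (G n) p)) at_top sequentially"
    and "resolvent w0 M0 G0 p = 0 \<Longrightarrow>
    filterlim (\<lambda>n. cmod (resolvent (w n) (M n) (G n) p)) at_top sequentially"
proof -
  let ?Q = "\<lambda>n. w n + of_real (fst p) * G n + of_real (snd p) * M n"
  let ?lim = "w0 + of_real (fst p) * G0 + of_real (snd p) * M0"
  have Q: "?Q \<longlonglongrightarrow> ?lim" by (intro tendsto_intros assms)
  have "filterlim (\<lambda>n. cmod (resolvent (w n) (M n) (G n) p)) at_top sequentially" if "?lim = 0"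
  proof -
    have "filterlim ?Q (at 0) sequentially"
      using Q that nz by (auto simp: filterlim_at resolvent_def)
    then have "filterlim (\<lambda>n. inverse (?Q n)) at_infinity sequentially"
      by (rule filterlim_compose[OF filterlim_inverse_at_infinity])
    then show ?thesis unfolding resolvent_def by (rule filterlim_at_infinity_imp_norm_at_top)
  qed
  moreover have "(\<lambda>n. resolvent (w n) (M n) (G n) p) \<longlonglongrightarrow> resolvent w0 M0 G0 p" if "?lim \<noteq> 0"
    unfolding resolvent_def by (intro tendsto_inverse Q that)
  ultimately show "(\<lambda>n. resolvent (w n) (M n) (G n) p) \<longlonglongrightarrow> resolvent w0 M0 G0 p \<or>
    filterlim (\<lambda>n. cmod (resolvent (w n) (M n) (G n) p)) at_top sequentially"
    and "resolvent w0 M0 G0 p = 0 \<Longrightarrow>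
    filterlim (\<lambda>n. cmod (resolvent (w n) (M n) (G n) p)) at_top sequentially"
    by (auto simp: resolvent_def)
qed

text \<open>It suffices that \<open>1 / Q\<close> converges pointwise or blows up, since the energy bound excludes blowing up. The limit \<open>z\<close>
  need not be a reciprocal \<open>1 / Q\<close>: in \<open>no_blowup\<close> it vanishes on \<open>{s > 0}\<close>.\<close>

lemma solutions_converge:
  assumes sol: "\<And>n. solves (w n) (M n) (G n)"
    and pos: "\<And>n. 0 \<le> Im (w n)" "\<And>n. 0 < Im (M n)" "\<And>n. 0 < Im (G n)"
    and [measurable]: "z \<in> borel_measurable H"
    and alt: "\<forall>p. (\<forall>n. resolvent (w n) (M n) (G n) p \<noteq> 0) \<longrightarrow> (\<lambda>n. resolvent (w n) (M n) (G n) p) \<longlonglongrightarrow> z p \<or>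
        filterlim (\<lambda>n. cmod (resolvent (w n) (M n) (G n) p)) at_top sequentially"
    and w: "w \<longlonglongrightarrow> w0" "w0 \<noteq> 0"
  shows "AE p in H. (\<forall>n. resolvent (w n) (M n) (G n) p \<noteq> 0) \<and> (\<lambda>n. resolvent (w n) (M n) (G n) p) \<longlonglongrightarrow> z p"
    and "integrable H z" "integrable H (\<lambda>p. of_real (snd p) * z p)"
    and "integrable H (\<lambda>p. snd p * (cmod (z p))^2)" "c * (LINT p|H. snd p * (cmod (z p))^2) \<le> 1"
    and "M \<longlonglongrightarrow> - of_real (1 - c) / w0 - of_real c * (LINT p|H. z p)"
    and "(\<lambda>n. - 1 / G n) \<longlonglongrightarrow> w0 - of_real c * (LINT p|H. of_real (snd p) * z p)"
proof -
  define y where "y n = resolvent (w n) (M n) (G n)" for n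
  have [measurable]: "y n \<in> borel_measurable H" for n unfolding y_def by measurable
  note en = solution_energy[OF sol pos, folded y_def]
  have y0: "AE p in H. \<forall>n. y n p \<noteq> 0" using en(1) by (simp add: AE_all_countable)
  have alt': "AE p in H. (\<lambda>n. y n p) \<longlonglongrightarrow> z p \<or> filterlim (\<lambda>n. cmod (y n p)) at_top sequentially"
    using y0 by eventually_elim (unfold y_def, use alt in blast)
  note bd = en(3)[unfolded le_divide_c]
  have conv: "AE p in H. (\<lambda>n. y n p) \<longlonglongrightarrow> z p"
    by (rule weighted_L2_limit_finite[OF _ _ t_pos en(2) bd alt']) measurable
  show "AE p in H. (\<forall>n. resolvent (w n) (M n) (G n) p \<noteq> 0) \<and> (\<lambda>n. resolvent (w n) (M n) (G n) p) \<longlonglongrightarrow> z p"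
    unfolding y_def[symmetric] using y0 conv by eventually_elim simp
  have k1: "integrable H (\<lambda>p. (1::real)^2 / snd p)" using inverse_t_integrable by simp
  have kt: "integrable H (\<lambda>p. (snd p)^2 / snd p)"
    by (rule integrable_cong_AE[THEN iffD1, OF _ _ _ t_integrable])
      (measurable, use t_pos in \<open>auto elim!: eventually_mono simp: power2_eq_square\<close>)
  note V1 = weighted_L2_convergence[where y=y and z=z and k="\<lambda>_. 1" and t=snd, OF _ _ _ _ t_pos en(2) bd conv k1, simplified]
  have Vt: "integrable H (\<lambda>p. of_real (snd p) * z p)"
      "(\<lambda>n. \<integral>p. of_real (snd p) * y n p \<partial>H) \<longlonglongrightarrow> (LINT p|H. of_real (snd p) * z p)"
    by (rule weighted_L2_convergence[where y=y and z=z and k=snd and t=snd, OF _ _ _ _ t_pos en(2) bd conv kt]; measurable)+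
  show "integrable H z" "integrable H (\<lambda>p. snd p * (cmod (z p))^2)" by (fact V1(3), fact V1(1))
  show "c * (LINT p|H. snd p * (cmod (z p))^2) \<le> 1" unfolding le_divide_c by (fact V1(2))
  show "integrable H (\<lambda>p. of_real (snd p) * z p)" by (fact Vt(1))
  have M_eq: "M n = - of_real (1 - c) / w n - of_real c * (LINT p|H. y n p)" for n
    using sol[of n, unfolded solves_def, folded y_def] by blast
  have "(\<lambda>n. - of_real (1 - c) / w n - of_real c * (LINT p|H. y n p))
      \<longlonglongrightarrow> - of_real (1 - c) / w0 - of_real c * (LINT p|H. z p)"
    by (intro tendsto_intros w V1(4))
  then show "M \<longlonglongrightarrow> - of_real (1 - c) / w0 - of_real c * (LINT p|H. z p)"
    unfolding M_eq[symmetric] .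
  have G_eq: "- 1 / G n = w n - of_real c * (LINT p|H. of_real (snd p) * y n p)" for n
    using sol[of n, unfolded solves_def, folded y_def] by blast
  show "(\<lambda>n. - 1 / G n) \<longlonglongrightarrow> w0 - of_real c * (LINT p|H. of_real (snd p) * z p)"
    unfolding G_eq by (intro tendsto_intros w(1) Vt(2))
qed

text \<open>Without the rescaling to \<open>Im G + Im M = 1\<close> the inequalities could degenerate to \<open>0 \<le> 0\<close>. The rescaled
  weight \<open>a\<close> of \<open>G\<close> stays positive, since otherwise \<open>t^2 / |Q|^2\<close> would have integral 0.\<close>

lemma solution_limit:
  assumes sol: "\<And>n. solves (w n) (M n) (G n)"
    and pos: "\<And>n. 0 \<le> Im (w n)" "\<And>n. 0 < Im (M n)" "\<And>n. 0 < Im (G n)"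
    and lim: "w \<longlonglongrightarrow> w0" "M \<longlonglongrightarrow> M0" "G \<longlonglongrightarrow> G0" and w0: "w0 \<noteq> 0" and G0: "G0 \<noteq> 0"
  shows "solves w0 M0 G0" and "admissible (resolvent w0 M0 G0) G0"
proof -
  define y where "y n = resolvent (w n) (M n) (G n)" for n
  define z where "z = resolvent w0 M0 G0"
  have [measurable]: "y n \<in> borel_measurable H" "z \<in> borel_measurable H" for n
    unfolding y_def z_def by measurable
  note en = solution_energy[OF sol pos, folded y_def]
  have t0: "AE p in H. 0 \<le> snd p" using t_pos by eventually_elim simp
  have zm: "z \<in> borel_measurable H" by measurable
  have alt: "\<forall>p. (\<forall>n. y n p \<noteq> 0) \<longrightarrow> (\<lambda>n. y n p) \<longlonglongrightarrow> z p \<or> filterlim (\<lambda>n. cmod (y n p)) at_top sequentially"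
    unfolding y_def z_def using resolvent_alternative(1)[OF lim] by blast
  note cv = solutions_converge[OF sol pos zm alt[unfolded y_def] lim(1) w0, folded y_def]
  have conv: "AE p in H. (\<lambda>n. y n p) \<longlonglongrightarrow> z p" and y0: "AE p in H. \<forall>n. y n p \<noteq> 0"
    using cv(1) by (auto elim: eventually_mono)
  have z0: "AE p in H. z p \<noteq> 0"
    using conv y0
  proof eventually_elim
    case (elim p)
    show ?case
    proof
      assume "z p = 0"
      with elim resolvent_alternative(2)[OF lim, of p]
      have "filterlim (\<lambda>n. cmod (y n p)) at_top sequentially" by (simp add: y_def z_def)
      moreover have "(\<lambda>n. cmod (y n p)) \<longlonglongrightarrow> cmod (z p)" using elim by (intro tendsto_norm) auto
      ultimately show False using not_tendsto_and_filterlim_at_infinity[of sequentially "\<lambda>n. cmod (y n p)"]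
        by (auto dest: filterlim_at_top_imp_at_infinity)
    qed
  qed
  have eM: "M0 = - of_real (1 - c) / w0 - of_real c * (LINT p|H. z p)"
    by (rule LIMSEQ_unique[OF lim(2) cv(6)])
  have "(\<lambda>n. - 1 / G n) \<longlonglongrightarrow> - 1 / G0" by (intro tendsto_intros lim G0)
  then have eG: "- 1 / G0 = w0 - of_real c * (LINT p|H. of_real (snd p) * z p)"
    using cv(7) by (rule LIMSEQ_unique)
  show "solves w0 M0 G0"
    unfolding solves_def z_def[symmetric] using cv(2,3) eM eG by blast
  define a where "a n = Im (G n) / (Im (G n) + Im (M n))" for n
  define b where "b n = Im (M n) / (Im (G n) + Im (M n))" for n
  have ab: "0 \<le> a n" "a n \<le> 1" "b n = 1 - a n" for n
  proof -
    have "0 < Im (G n) + Im (M n)" using pos[of n] by auto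
    then show "0 \<le> a n" "a n \<le> 1" "b n = 1 - a n" using pos[of n] by (auto simp: a_def b_def field_simps)
  qed
  have "\<forall>\<^sub>F n in sequentially. norm (a n) \<le> 1" using ab by (intro always_eventually) auto
  then obtain a0 r where r: "strict_mono r" and a0: "(\<lambda>n. a (r n)) \<longlonglongrightarrow> a0" by (rule convergent_subsequence_bounded)
  define b0 where "b0 = 1 - a0"
  have b0: "(\<lambda>n. b (r n)) \<longlonglongrightarrow> b0" unfolding b0_def ab(3) by (intro tendsto_intros a0)
  have ab0: "0 \<le> a0" "0 \<le> b0" using a0 b0 ab by (auto intro!: LIMSEQ_le_const[where a=0])
  have Gr: "(\<lambda>n. G (r n)) \<longlonglongrightarrow> G0" using LIMSEQ_subseq_LIMSEQ[OF lim(3) r] by (simp add: o_def)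
  have yr: "AE p in H. (\<lambda>n. y (r n) p) \<longlonglongrightarrow> z p"
    using conv by eventually_elim (use LIMSEQ_subseq_LIMSEQ[OF _ r] in \<open>force simp: o_def\<close>)
  have sc1: "(fst p * a n + snd p * b n) * (cmod (y n p))^2
      = 1 / (Im (G n) + Im (M n)) * ((fst p * Im (G n) + snd p * Im (M n)) * (cmod (y n p))^2)" for n p
    by (simp add: a_def b_def add_divide_distrib distrib_right)
  have sc2: "snd p * (fst p * a n + snd p * b n) * (cmod (y n p))^2
      = 1 / (Im (G n) + Im (M n)) * (snd p * (fst p * Im (G n) + snd p * Im (M n)) * (cmod (y n p))^2)" for n p
    using arg_cong[OF sc1[of p n], of "\<lambda>v. snd p * v"] by (simp only: ac_simps)
  have i1: "integrable H (\<lambda>p. (fst p * a n + snd p * b n) * (cmod (y n p))^2)" for n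
    unfolding sc1 by (rule integrable_mult_right[OF en(4)])
  have i2: "integrable H (\<lambda>p. snd p * (fst p * a n + snd p * b n) * (cmod (y n p))^2)" for n
    unfolding sc2 by (rule integrable_mult_right[OF en(6)])
  have l1: "(LINT p|H. (fst p * a n + snd p * b n) * (cmod (y n p))^2) \<le> b n / c" for n
  proof -
    have "0 < Im (G n) + Im (M n)" using pos[of n] by auto
    then show ?thesis
      using mult_left_mono[OF en(5)[of n, unfolded le_divide_c], of "1 / (Im (G n) + Im (M n))"]
      unfolding sc1 integral_mult_right_zero by (simp only: b_def) (simp add: ac_simps)
  qed
  have l2: "(LINT p|H. snd p * (fst p * a n + snd p * b n) * (cmod (y n p))^2) \<le> a n / (cmod (G n))^2 / c" for n
  proof -
    have p: "0 < Im (G n) + Im (M n)" using pos[of n] by auto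
    have "(LINT p|H. snd p * (fst p * Im (G n) + snd p * Im (M n)) * (cmod (y n p))^2) \<le> Im (G n) / (cmod (G n))^2 / c"
      using en(7)[of n] unfolding le_divide_c .
    from mult_left_mono[OF this, of "1 / (Im (G n) + Im (M n))"] show ?thesis
      unfolding sc2 integral_mult_right_zero using p by (simp add: a_def ac_simps)
  qed
  have nn1: "AE p in H. 0 \<le> (fst p * a n + snd p * b n) * (cmod (y n p))^2" for n
    using s_nonneg t0 by eventually_elim (use ab[of n] in simp)
  have nn2: "AE p in H. 0 \<le> snd p * (fst p * a n + snd p * b n) * (cmod (y n p))^2" for n
    using s_nonneg t0 by eventually_elim (use ab[of n] in simp)
  have lim1: "AE p in H. (\<lambda>n. (fst p * a (r n) + snd p * b (r n)) * (cmod (y (r n) p))^2) \<longlonglongrightarrow> (fst p * a0 + snd p * b0) * (cmod (z p))^2"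
    using yr by eventually_elim (intro tendsto_intros a0 b0)
  have lim2: "AE p in H. (\<lambda>n. snd p * (fst p * a (r n) + snd p * b (r n)) * (cmod (y (r n) p))^2) \<longlonglongrightarrow> snd p * (fst p * a0 + snd p * b0) * (cmod (z p))^2"
    using yr by eventually_elim (intro tendsto_intros a0 b0)
  have C1: "(\<lambda>n. b (r n) / c) \<longlonglongrightarrow> b0 / c" by (intro tendsto_intros b0) (use c_pos in simp)
  have C2: "(\<lambda>n. a (r n) / (cmod (G (r n)))^2 / c) \<longlonglongrightarrow> a0 / (cmod G0)^2 / c"
    by (intro tendsto_intros a0 Gr) (use c_pos G0 in auto)
  note F1 = integral_Fatou[OF i1 nn1 lim1 _ l1 C1]
  note F2 = integral_Fatou[OF i2 nn2 lim2 _ l2 C2]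
  have f1: "integrable H (\<lambda>p. (fst p * a0 + snd p * b0) * (cmod (z p))^2)" by (rule F1) measurable
  have g1: "(LINT p|H. (fst p * a0 + snd p * b0) * (cmod (z p))^2) \<le> b0 / c" by (rule F1) measurable
  have f2: "integrable H (\<lambda>p. snd p * (fst p * a0 + snd p * b0) * (cmod (z p))^2)" by (rule F2) measurable
  have g2: "(LINT p|H. snd p * (fst p * a0 + snd p * b0) * (cmod (z p))^2) \<le> a0 / (cmod G0)^2 / c" by (rule F2) measurable
  have a0pos: "0 < a0"
  proof (rule ccontr)
    assume "\<not> 0 < a0"
    then have a: "a0 = 0" "b0 = 1" using ab0 by (auto simp: b0_def)
    have nn: "AE p in H. 0 \<le> snd p * (fst p * a0 + snd p * b0) * (cmod (z p))^2"
      using s_nonneg t0 by eventually_elim (use ab0 in simp)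
    have "(LINT p|H. snd p * (fst p * a0 + snd p * b0) * (cmod (z p))^2) = 0"
    proof (rule antisym)
      show "(LINT p|H. snd p * (fst p * a0 + snd p * b0) * (cmod (z p))^2) \<le> 0" using g2 a by simp
    qed (rule integral_nonneg_AE[OF nn])
    then have "AE p in H. snd p * (fst p * a0 + snd p * b0) * (cmod (z p))^2 = 0"
      using integral_nonneg_eq_0_iff_AE[OF f2 nn] by simp
    then have "AE p in H. False" using t_pos z0 by eventually_elim (simp add: a)
    then show False by (simp add: AE_False)
  qed
  show "admissible (resolvent w0 M0 G0) G0"
    unfolding admissible_def z_def[symmetric]
  proof (intro conjI)
    show "\<exists>a b. 0 < a \<and> 0 \<le> b \<and>
       integrable H (\<lambda>p. (fst p * a + snd p * b) * (cmod (z p))^2) \<and>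
       c * (LINT p|H. (fst p * a + snd p * b) * (cmod (z p))^2) \<le> b \<and>
       integrable H (\<lambda>p. snd p * (fst p * a + snd p * b) * (cmod (z p))^2) \<and>
       c * (LINT p|H. snd p * (fst p * a + snd p * b) * (cmod (z p))^2) \<le> a / (cmod G0)^2"
      using f1 f2 a0pos ab0 g1 g2 unfolding le_divide_c by blast
    show "c * (LINT p|H. snd p * (cmod (z p))^2) \<le> 1"
      by (fact cv(5))
  qed (use G0 z0 cv(4) in \<open>simp_all\<close>)
qed

text \<open>If \<open>G\<close> tends to infinity, then \<open>1 / Q\<close> tends to 0 where \<open>s > 0\<close> and to \<open>1 / (w + t M)\<close> where \<open>s = 0\<close>.
  Integrating \<open>(w + t M) / (w + t M) = 1\<close> over \<open>{s = 0}\<close> and inserting both limit equations gives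
  \<open>c H {s = 0} = - (1 - c)\<close>. This leaves \<open>c = 1\<close> and \<open>H {s = 0} = 0\<close>, and then the second equation
  reads \<open>w = 0\<close>.\<close>

lemma no_blowup:
  assumes sol: "\<And>n. solves (w n) (M n) (G n)"
    and pos: "\<And>n. 0 \<le> Im (w n)" "\<And>n. 0 < Im (M n)" "\<And>n. 0 < Im (G n)"
    and lim: "w \<longlonglongrightarrow> w0" "M \<longlonglongrightarrow> M0" "(\<lambda>n. 1 / G n) \<longlonglongrightarrow> 0" and w0: "w0 \<noteq> 0"
  shows False
proof -
  define y where "y n = resolvent (w n) (M n) (G n)" for n
  define z where "z p = (if fst p = 0 then resolvent w0 M0 0 p else 0)" for p
  have [measurable]: "y n \<in> borel_measurable H" "z \<in> borel_measurable H" for n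
    unfolding y_def z_def by measurable
  have nzG: "G n \<noteq> 0" for n using pos(3)[of n] by auto
  have Ginf: "filterlim G at_infinity sequentially"
  proof -
    have "filterlim (\<lambda>n. 1 / G n) (at 0) sequentially" using lim(3) nzG by (auto simp: filterlim_at)
    then have "filterlim (\<lambda>n. inverse (1 / G n)) at_infinity sequentially"
      by (rule filterlim_compose[OF filterlim_inverse_at_infinity])
    then show ?thesis by simp
  qed
  have large: "(\<lambda>n. y n p) \<longlonglongrightarrow> 0" if "fst p \<noteq> 0" for p
  proof -
    have "filterlim (\<lambda>n. of_real (fst p) * G n) at_infinity sequentially"
      by (rule tendsto_mult_filterlim_at_infinity[OF tendsto_const _ Ginf]) (use that in simp)
    moreover have "(\<lambda>n. w n + of_real (snd p) * M n) \<longlonglongrightarrow> w0 + of_real (snd p) * M0"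
      by (intro tendsto_intros lim)
    ultimately have "filterlim (\<lambda>n. (w n + of_real (snd p) * M n) + of_real (fst p) * G n) at_infinity sequentially"
      by (intro tendsto_add_filterlim_at_infinity)
    then have "(\<lambda>n. inverse ((w n + of_real (snd p) * M n) + of_real (fst p) * G n)) \<longlonglongrightarrow> 0"
      by (rule filterlim_compose[OF tendsto_inverse_0])
    then show ?thesis by (simp add: y_def resolvent_def add_ac)
  qed
  have small: "y n p = resolvent (w n) (M n) 0 p" if "fst p = 0" for n p
    using that by (simp add: y_def resolvent_def)
  have zm: "z \<in> borel_measurable H" by measurable
  have alt: "(\<lambda>n. y n p) \<longlonglongrightarrow> z p \<or> filterlim (\<lambda>n. cmod (y n p)) at_top sequentially"
    if "\<forall>n. y n p \<noteq> 0" for p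
  proof (cases "fst p = 0")
    case True
    then show ?thesis
      using resolvent_alternative(1)[OF lim(1,2) tendsto_const[of 0], of p] that by (simp add: small z_def)
  next
    case False
    then show ?thesis using large by (simp add: z_def)
  qed
  then have "\<forall>p. (\<forall>n. y n p \<noteq> 0) \<longrightarrow> (\<lambda>n. y n p) \<longlonglongrightarrow> z p \<or> filterlim (\<lambda>n. cmod (y n p)) at_top sequentially"
    by blast
  note cv = solutions_converge[OF sol pos zm this[unfolded y_def] lim(1) w0, folded y_def]
  have conv: "AE p in H. (\<lambda>n. y n p) \<longlonglongrightarrow> z p" and y0: "AE p in H. \<forall>n. y n p \<noteq> 0"
    using cv(1) by (auto elim: eventually_mono)
  have inv: "AE p in H. w0 * z p + M0 * (of_real (snd p) * z p) = of_real (indicator {p. fst p = 0} p)"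
    using conv y0
  proof eventually_elim
    case (elim p)
    show ?case
    proof (cases "fst p = 0")
      case True
      have "z p \<noteq> 0"
      proof
        assume "z p = 0"
        with True elim resolvent_alternative(2)[OF lim(1,2) tendsto_const[of 0], of p]
        have "filterlim (\<lambda>n. cmod (y n p)) at_top sequentially" by (simp add: small z_def)
        moreover have "(\<lambda>n. cmod (y n p)) \<longlonglongrightarrow> cmod (z p)" using elim by (intro tendsto_norm) auto
        ultimately show False using not_tendsto_and_filterlim_at_infinity[of sequentially "\<lambda>n. cmod (y n p)"]
          by (auto dest: filterlim_at_top_imp_at_infinity)
      qed
      then have "(w0 + M0 * of_real (snd p)) * z p = 1" using True by (simp add: z_def resolvent_def mult.commute[of M0])
      then show ?thesis using True by (simp add: algebra_simps)
    qed (simp add: z_def)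
  qed
  have eM: "M0 = - of_real (1 - c) / w0 - of_real c * (LINT p|H. z p)"
    by (rule LIMSEQ_unique[OF lim(2) cv(6)])
  have "(\<lambda>n. - 1 / G n) \<longlonglongrightarrow> 0" using tendsto_minus[OF lim(3)] by simp
  then have eG: "of_real c * (LINT p|H. of_real (snd p) * z p) = w0"
    using LIMSEQ_unique[OF cv(7)] by fastforce
  define h where "h = measure H {p. fst p = 0}"
  have hm: "{p. fst p = 0} \<in> sets H"
    unfolding sets_H by (rule borel_closed) (intro closed_Collect_eq continuous_on_fst continuous_on_const continuous_on_id)
  have "w0 * (LINT p|H. z p) + M0 * (LINT p|H. of_real (snd p) * z p)
      = (LINT p|H. w0 * z p + M0 * (of_real (snd p) * z p))"
    using cv(2,3) by (subst Bochner_Integration.integral_add) auto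
  also have "\<dots> = (LINT p|H. complex_of_real (indicator {p. fst p = 0} p))"
    by (rule integral_cong_AE[OF _ _ inv]) (use hm in measurable)
  also have "\<dots> = of_real h"
    using hm by (subst integral_complex_of_real) (simp add: h_def sets.sets_into_space Int_absorb2)
  finally have "of_real c * (w0 * (LINT p|H. z p) + M0 * (LINT p|H. of_real (snd p) * z p)) = of_real c * of_real h" by simp
  then have "w0 * (of_real c * (LINT p|H. z p)) + M0 * w0 = of_real (c * h)"
    using eG by (simp add: algebra_simps)
  moreover have "of_real c * (LINT p|H. z p) = - of_real (1 - c) / w0 - M0" using eM by simp
  ultimately have "w0 * (- of_real (1 - c) / w0 - M0) + M0 * w0 = of_real (c * h)" by simp
  moreover have "w0 * (- v / w0 - M0) + M0 * w0 = - v" for v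
    using w0 by (simp add: right_diff_distrib)
  ultimately have "- of_real (1 - c) = complex_of_real (c * h)" by metis
  then have "- (1 - c) = c * h" by (metis of_real_eq_iff of_real_minus)
  moreover have "0 \<le> c * h" using c_pos by (simp add: h_def)
  ultimately have "h = 0" using c_le_1 c_pos by (smt (verit) mult_eq_0_iff)
  then have "AE p in H. fst p \<noteq> 0" using hm unfolding h_def
    by (subst (asm) prob_eq_0) auto
  then have "AE p in H. of_real (snd p) * z p = 0" by eventually_elim (simp add: z_def)
  then have "(LINT p|H. of_real (snd p) * z p) = 0" by (rule integral_eq_zero_AE)
  then show False using eG w0 by simp
qed

text \<open>In the exceptional case \<open>Q' = cnj Q\<close> of \<open>linearization_kernel\<close> the nonnegativity of the imaginary parts makes
  \<open>Q\<close> real, so that \<open>Q = Q'\<close> and both equations return the same values.\<close>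

lemma boundary_solution_unique:
  assumes sol: "solves (of_real w) M G" "solves (of_real w) M' G'"
    and adm: "admissible (resolvent (of_real w) M G) G" "admissible (resolvent (of_real w) M' G') G'"
    and Im: "0 \<le> Im M" "0 \<le> Im M'" "0 \<le> Im G" "0 \<le> Im G'"
  shows "M = M' \<and> G = G'"
proof -
  define y where "y = resolvent (of_real w) M G"
  define y' where "y' = resolvent (of_real w) M' G'"
  have [measurable]: "y \<in> borel_measurable H" "y' \<in> borel_measurable H" unfolding y_def y'_def by measurable
  have y0: "AE p in H. y p \<noteq> 0" "AE p in H. y' p \<noteq> 0" and G: "G \<noteq> 0" "G' \<noteq> 0"
    using adm by (auto simp: admissible_def y_def y'_def)
  have iy: "integrable H y" "integrable H y'" "integrable H (\<lambda>p. of_real (snd p) * y p)" "integrable H (\<lambda>p. of_real (snd p) * y' p)"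
    and M: "M = - of_real (1 - c) / of_real w - of_real c * (LINT p|H. y p)"
      "M' = - of_real (1 - c) / of_real w - of_real c * (LINT p|H. y' p)"
    and iG: "- 1 / G = of_real w - of_real c * (LINT p|H. of_real (snd p) * y p)"
      "- 1 / G' = of_real w - of_real c * (LINT p|H. of_real (snd p) * y' p)"
    using sol[unfolded solves_def, folded y_def y'_def] by blast+
  have diff: "AE p in H. (of_real (fst p) * (G' - G) + of_real (snd p) * (M' - M)) * (y p * y' p) = y p - y' p"
    using y0
  proof eventually_elim
    case (elim p)
    define Q where "Q = of_real w + of_real (fst p) * G + of_real (snd p) * M"
    define Q' where "Q' = of_real w + of_real (fst p) * G' + of_real (snd p) * M'"
    have Q: "y p = inverse Q" "y' p = inverse Q'" by (simp_all only: y_def y'_def resolvent_def Q_def Q'_def)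
    then have "Q \<noteq> 0" "Q' \<noteq> 0" using elim by auto
    then have "(Q' - Q) * (y p * y' p) = y p - y' p" unfolding Q by (simp add: field_simps)
    moreover have "Q' - Q = of_real (fst p) * (G' - G) + of_real (snd p) * (M' - M)"
      by (simp add: Q_def Q'_def algebra_simps)
    ultimately show ?case by simp
  qed
  have "M' - M = of_real c * ((LINT p|H. y p) - (LINT p|H. y' p))"
    by (subst M(1), subst M(2)) (simp add: algebra_simps)
  also have "(LINT p|H. y p) - (LINT p|H. y' p) = (LINT p|H. y p - y' p)" using iy by simp
  also have "\<dots> = (LINT p|H. (of_real (fst p) * (G' - G) + of_real (snd p) * (M' - M)) * (y p * y' p))"
  proof (rule integral_cong_AE)
    show "AE p in H. y p - y' p = (of_real (fst p) * (G' - G) + of_real (snd p) * (M' - M)) * (y p * y' p)"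
      using diff by eventually_elim simp
  qed measurable
  finally have e1: "M' - M = of_real c * (LINT p|H. (of_real (fst p) * (G' - G) + of_real (snd p) * (M' - M)) * (y p * y' p))" .
  have "(G' - G) / (G * G') = - 1 / G' - - 1 / G" using G by (simp add: field_simps)
  also have "\<dots> = of_real c * ((LINT p|H. of_real (snd p) * y p) - (LINT p|H. of_real (snd p) * y' p))"
    unfolding iG by (simp add: algebra_simps)
  also have "(LINT p|H. of_real (snd p) * y p) - (LINT p|H. of_real (snd p) * y' p)
      = (LINT p|H. of_real (snd p) * y p - of_real (snd p) * y' p)" using iy by simp
  also have "\<dots> = (LINT p|H. of_real (snd p) * (of_real (fst p) * (G' - G) + of_real (snd p) * (M' - M)) * (y p * y' p))"
  proof (rule integral_cong_AE)
    show "AE p in H. of_real (snd p) * y p - of_real (snd p) * y' p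
        = of_real (snd p) * (of_real (fst p) * (G' - G) + of_real (snd p) * (M' - M)) * (y p * y' p)"
      using diff by eventually_elim (simp only: mult.assoc right_diff_distrib[symmetric])
  qed measurable
  finally have e2: "(G' - G) / (G * G')
      = of_real c * (LINT p|H. of_real (snd p) * (of_real (fst p) * (G' - G) + of_real (snd p) * (M' - M)) * (y p * y' p))" .
  from linearization_kernel[OF adm[folded y_def y'_def] e1 e2]
  show ?thesis
  proof
    assume "AE p in H. y' p = cnj (y p)"
    then have "AE p in H. y' p = y p"
      using s_nonneg t_pos
    proof eventually_elim
      case (elim p)
      define Q where "Q = of_real w + of_real (fst p) * G + of_real (snd p) * M"
      define Q' where "Q' = of_real w + of_real (fst p) * G' + of_real (snd p) * M'"
      have "inverse Q' = inverse (cnj Q)" using elim by (simp add: y_def y'_def resolvent_def Q_def Q'_def)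
      then have QQ: "Q' = cnj Q" by simp
      have "Im Q' = - Im Q" using QQ by simp
      moreover have "0 \<le> Im Q" "0 \<le> Im Q'" using elim Im by (auto simp: Q_def Q'_def)
      ultimately have "Im Q = 0" by simp
      then have "Q' = Q" using QQ by (simp add: complex_eq_iff)
      then show ?case by (simp add: y_def y'_def resolvent_def Q_def Q'_def)
    qed
    then have "(LINT p|H. y' p) = (LINT p|H. y p)" "(LINT p|H. of_real (snd p) * y' p) = (LINT p|H. of_real (snd p) * y p)"
      by (intro integral_cong_AE; auto elim!: eventually_mono)+
    then have "M = M'" "- 1 / G = - 1 / G'" using M iG by metis+
    then show ?thesis using G by (simp add: field_simps)
  qed simp
qed

lemma boundary_limit:
  fixes M G :: "complex \<Rightarrow> complex"
  assumes sol: "\<And>z. 0 < Im z \<Longrightarrow> solves (csqrt z) (M z) (G z)"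
    and pos: "\<And>z. 0 < Im z \<Longrightarrow> 0 < Im (M z)" "\<And>z. 0 < Im z \<Longrightarrow> 0 < Im (G z)"
    and x: "0 < x"
  obtains M0 G0 where "(M \<longlongrightarrow> M0) (at (of_real x) within \<complex>\<^sup>+)" "(G \<longlongrightarrow> G0) (at (of_real x) within \<complex>\<^sup>+)"
    "solves (of_real (sqrt x)) M0 G0" "G0 \<noteq> 0" "0 \<le> Im G0"
proof -
  define good where "good M0 G0 \<longleftrightarrow> solves (of_real (sqrt x)) M0 G0 \<and>
    admissible (resolvent (of_real (sqrt x)) M0 G0) G0 \<and> 0 \<le> Im M0 \<and> 0 \<le> Im G0" for M0 G0
  \<comment> \<open>Boundedness of \<open>(M, 1 / G)\<close> yields limit points; \<open>no_blowup\<close> turns a limit of \<open>1 / G\<close> into one of \<open>G\<close>.\<close>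
  have sub: "\<exists>r M0 G0. strict_mono r \<and> (\<lambda>n. M (z (r n))) \<longlonglongrightarrow> M0 \<and> (\<lambda>n. G (z (r n))) \<longlonglongrightarrow> G0 \<and> good M0 G0"
    if z: "\<And>n. z n \<in> \<complex>\<^sup>+" and zx: "z \<longlonglongrightarrow> of_real x" for z
  proof -
    have z': "0 < Im (z n)" for n using z by simp
    define w where "w n = csqrt (z n)" for n
    have w0: "complex_of_real (sqrt x) \<noteq> 0" using x by simp
    have Imw: "0 \<le> Im (w n)" for n
      using z'[of n] complex_Re_le_cmod[of "z n"] by (simp add: w_def)
    have "isCont csqrt (of_real x)" using x by (intro continuous_at_csqrt) (auto simp: complex_nonpos_Reals_iff)
    from isCont_tendsto_compose[OF this zx] have w: "w \<longlonglongrightarrow> of_real (sqrt x)"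
      using x unfolding w_def by (simp only: of_real_sqrt less_imp_le)
    have sol': "solves (w n) (M (z n)) (G (z n))" for n using sol[OF z'] by (simp add: w_def)
    define K where "K n = cmod (1 / w n) + c * (LINT p|H. 1 / snd p) + 1 + (cmod (w n) + c * (LINT p|H. snd p) + 1)" for n
    define L where "L = cmod (1 / complex_of_real (sqrt x)) + c * (LINT p|H. 1 / snd p) + 1
        + (cmod (complex_of_real (sqrt x)) + c * (LINT p|H. snd p) + 1)"
    have "K \<longlonglongrightarrow> L" unfolding K_def L_def by (intro tendsto_intros w w0)
    then have "\<forall>\<^sub>F n in sequentially. K n < L + 1" by (rule order_tendstoD) simp
    then have "\<forall>\<^sub>F n in sequentially. norm (M (z n), 1 / G (z n)) \<le> L + 1"
    proof eventually_elim
      case (elim n)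
      have "norm (M (z n), 1 / G (z n)) \<le> norm (M (z n)) + norm (1 / G (z n))"
        by (rule norm_Pair_le)
      also have "\<dots> \<le> K n"
        using solution_bounds[OF sol' Imw pos(1)[OF z'] pos(2)[OF z'], of n] by (simp add: K_def)
      finally show ?case using elim by simp
    qed
    then obtain l r where r: "strict_mono r" and l: "(\<lambda>n. (M (z (r n)), 1 / G (z (r n)))) \<longlonglongrightarrow> l"
      by (rule convergent_subsequence_bounded)
    obtain M0 g0 where l2: "(\<lambda>n. M (z (r n))) \<longlonglongrightarrow> M0" "(\<lambda>n. 1 / G (z (r n))) \<longlonglongrightarrow> g0"
      using tendsto_fst[OF l] tendsto_snd[OF l] by auto
    have wr: "(\<lambda>n. w (r n)) \<longlonglongrightarrow> of_real (sqrt x)" using LIMSEQ_subseq_LIMSEQ[OF w r] by (simp add: o_def)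
    have g0: "g0 \<noteq> 0"
      using no_blowup[where w="\<lambda>n. w (r n)" and M="\<lambda>n. M (z (r n))" and G="\<lambda>n. G (z (r n))", OF sol' Imw pos(1)[OF z'] pos(2)[OF z'] wr l2(1) _ w0] l2(2) by auto
    have G0: "(\<lambda>n. G (z (r n))) \<longlonglongrightarrow> inverse g0" using tendsto_inverse[OF l2(2) g0] by simp
    have "good M0 (inverse g0)"
      unfolding good_def
    proof (intro conjI)
      show "solves (of_real (sqrt x)) M0 (inverse g0)" "admissible (resolvent (of_real (sqrt x)) M0 (inverse g0)) (inverse g0)"
        using solution_limit[where w="\<lambda>n. w (r n)" and M="\<lambda>n. M (z (r n))" and G="\<lambda>n. G (z (r n))", OF sol' Imw pos(1)[OF z'] pos(2)[OF z'] wr l2(1) G0 w0] g0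
        by auto
      show "0 \<le> Im M0" using tendsto_Im[OF l2(1)] by (rule LIMSEQ_le_const) (use pos(1)[OF z'] in \<open>auto intro: less_imp_le\<close>)
      show "0 \<le> Im (inverse g0)" using tendsto_Im[OF G0] by (rule LIMSEQ_le_const) (use pos(2)[OF z'] in \<open>auto intro: less_imp_le\<close>)
    qed
    then show ?thesis using r l2(1) G0 by blast
  qed
  have "(\<lambda>n. Complex x (1 / Suc n)) \<longlonglongrightarrow> Complex x 0"
    by (intro tendsto_Complex tendsto_const LIMSEQ_Suc[OF lim_inverse_n'])
  then have "(\<lambda>n. Complex x (1 / Suc n)) \<longlonglongrightarrow> of_real x" by (simp add: complex_of_real_def)
  from sub[OF _ this] obtain M0 G0 where good: "good M0 G0" by auto
  have uniq: "M1 = M0 \<and> G1 = G0" if "good M1 G1" for M1 G1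
    using boundary_solution_unique[of "sqrt x" M1 G1 M0 G0] that good by (auto simp: good_def)
  have "((\<lambda>z. (M z, G z)) \<longlongrightarrow> (M0, G0)) (at (of_real x) within \<complex>\<^sup>+)"
  proof (rule tendsto_within_of_subsequences)
    fix z :: "nat \<Rightarrow> complex" assume "\<And>n. z n \<in> \<complex>\<^sup>+" "z \<longlonglongrightarrow> of_real x"
    from sub[OF this] obtain r M1 G1 where "strict_mono r" "(\<lambda>n. M (z (r n))) \<longlonglongrightarrow> M1" "(\<lambda>n. G (z (r n))) \<longlonglongrightarrow> G1" "good M1 G1"
      by blast
    then show "\<exists>r. strict_mono r \<and> (\<lambda>n. (M (z (r n)), G (z (r n)))) \<longlonglongrightarrow> (M0, G0)"
      using uniq[of M1 G1] by (auto intro!: exI[of _ r] tendsto_Pair)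
  qed simp
  from tendsto_fst[OF this] tendsto_snd[OF this] show thesis
    using good by (intro that[of M0 G0]) (auto simp: good_def admissible_def)
qed

end

section \<open>An implicit function theorem with divided differences\<close>

lemma norm_fst_snd_le:
  fixes v :: "complex \<times> complex"
  shows "norm (fst v) + norm (snd v) \<le> 2 * norm v" "norm v \<le> norm (fst v) + norm (snd v)"
  using norm_fst_le[of "fst v" "snd v"] norm_snd_le[of "snd v" "fst v"] norm_Pair_le[of "fst v" "snd v"]
  by simp_all

text \<open>Integral equations with kernel \<open>1 / Q\<close> have explicit divided differences, because
  \<open>1 / Q - 1 / Q' = (Q' - Q) / (Q Q')\<close>. Phrasing the theorem with continuous slopes instead of derivatives
  avoids differentiation under the integral. For fixed \<open>w\<close> the simplified Newton map \<open>T w\<close>, with the Jacobian frozen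
  at the base point, is a contraction, and the slopes give the complex derivative of its fixed point.\<close>

lemma implicit_function_slopes:
  fixes \<Phi> \<Psi> :: "complex \<times> complex \<times> complex \<Rightarrow> complex"
    and a b k a' b' k' :: "(complex \<times> complex \<times> complex) \<times> (complex \<times> complex \<times> complex) \<Rightarrow> complex"
  assumes U: "open U" "(w0, u0) \<in> U"
    and \<Phi>: "\<And>w v w' v'. (w, v) \<in> U \<Longrightarrow> (w', v') \<in> U \<Longrightarrow> \<Phi> (w', v') - \<Phi> (w, v) =
        a ((w, v), (w', v')) * (fst v' - fst v) + b ((w, v), (w', v')) * (snd v' - snd v) + k ((w, v), (w', v')) * (w' - w)"
    and \<Psi>: "\<And>w v w' v'. (w, v) \<in> U \<Longrightarrow> (w', v') \<in> U \<Longrightarrow> \<Psi> (w', v') - \<Psi> (w, v) =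
        a' ((w, v), (w', v')) * (fst v' - fst v) + b' ((w, v), (w', v')) * (snd v' - snd v) + k' ((w, v), (w', v')) * (w' - w)"
    and cont: "continuous_on (U \<times> U) a" "continuous_on (U \<times> U) b" "continuous_on (U \<times> U) k"
      "continuous_on (U \<times> U) a'" "continuous_on (U \<times> U) b'" "continuous_on (U \<times> U) k'"
    and zero: "\<Phi> (w0, u0) = 0" "\<Psi> (w0, u0) = 0"
    and det: "a ((w0, u0), (w0, u0)) * b' ((w0, u0), (w0, u0)) - b ((w0, u0), (w0, u0)) * a' ((w0, u0), (w0, u0)) \<noteq> 0"
  shows "\<exists>r \<rho> u. 0 < r \<and> 0 < \<rho> \<and> (\<lambda>w. fst (u w)) holomorphic_on ball w0 r \<and> (\<lambda>w. snd (u w)) holomorphic_on ball w0 r \<and>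
    (\<forall>w\<in>ball w0 r. \<forall>v\<in>ball u0 \<rho>. \<Phi> (w, v) = 0 \<longrightarrow> \<Psi> (w, v) = 0 \<longrightarrow> v = u w)"
proof -
  define P0 where "P0 = (w0, u0)"
  define Z0 where "Z0 = (P0, P0)"
  define \<delta> where "\<delta> = a Z0 * b' Z0 - b Z0 * a' Z0"
  have \<delta>: "\<delta> \<noteq> 0" using det by (simp add: \<delta>_def Z0_def P0_def)
  \<comment> \<open>\<open>e11\<close> to \<open>e22\<close> are the entries of \<open>1 - J0^(-1) J\<close>, and \<open>(f1, f2)\<close> is \<open>J0^(-1) (k, k')\<close>.\<close>
  define e11 where "e11 Z = 1 - (b' Z0 * a Z - b Z0 * a' Z) / \<delta>" for Z
  define e12 where "e12 Z = - (b' Z0 * b Z - b Z0 * b' Z) / \<delta>" for Z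
  define e21 where "e21 Z = - (a Z0 * a' Z - a' Z0 * a Z) / \<delta>" for Z
  define e22 where "e22 Z = 1 - (a Z0 * b' Z - a' Z0 * b Z) / \<delta>" for Z
  define f1 where "f1 Z = (b' Z0 * k Z - b Z0 * k' Z) / \<delta>" for Z
  define f2 where "f2 Z = (a Z0 * k' Z - a' Z0 * k Z) / \<delta>" for Z
  define T where "T w v = (fst v - (b' Z0 * \<Phi> (w, v) - b Z0 * \<Psi> (w, v)) / \<delta>,
      snd v - (a Z0 * \<Psi> (w, v) - a' Z0 * \<Phi> (w, v)) / \<delta>)" for w v
  have T_diff: "T w' v' - T w v =
      (e11 ((w, v), (w', v')) * (fst v' - fst v) + e12 ((w, v), (w', v')) * (snd v' - snd v) - f1 ((w, v), (w', v')) * (w' - w),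
       e21 ((w, v), (w', v')) * (fst v' - fst v) + e22 ((w, v), (w', v')) * (snd v' - snd v) - f2 ((w, v), (w', v')) * (w' - w))"
    if "(w, v) \<in> U" "(w', v') \<in> U" for w v w' v'
  proof -
    note p = \<Phi>[OF that] \<Psi>[OF that]
    have "fst (T w' v' - T w v) = (fst v' - fst v) - (b' Z0 * (\<Phi> (w', v') - \<Phi> (w, v)) - b Z0 * (\<Psi> (w', v') - \<Psi> (w, v))) / \<delta>"
      by (simp add: T_def algebra_simps diff_divide_distrib add_divide_distrib)
    also have "\<dots> = e11 ((w, v), (w', v')) * (fst v' - fst v) + e12 ((w, v), (w', v')) * (snd v' - snd v) - f1 ((w, v), (w', v')) * (w' - w)"
      unfolding p e11_def e12_def f1_def using \<delta> by (simp add: divide_simps) (simp add: algebra_simps)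
    finally have 1: "fst (T w' v' - T w v) = \<dots>" .
    have "snd (T w' v' - T w v) = (snd v' - snd v) - (a Z0 * (\<Psi> (w', v') - \<Psi> (w, v)) - a' Z0 * (\<Phi> (w', v') - \<Phi> (w, v))) / \<delta>"
      by (simp add: T_def algebra_simps diff_divide_distrib add_divide_distrib)
    also have "\<dots> = e21 ((w, v), (w', v')) * (fst v' - fst v) + e22 ((w, v), (w', v')) * (snd v' - snd v) - f2 ((w, v), (w', v')) * (w' - w)"
      unfolding p e21_def e22_def f2_def using \<delta> by (simp add: divide_simps) (simp add: algebra_simps)
    finally have 2: "snd (T w' v' - T w v) = \<dots>" .
    show ?thesis using 1 2 by (simp add: prod_eq_iff)
  qed
  have ec: "continuous_on (U \<times> U) e11" "continuous_on (U \<times> U) e12" "continuous_on (U \<times> U) e21" "continuous_on (U \<times> U) e22"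
    "continuous_on (U \<times> U) f1" "continuous_on (U \<times> U) f2"
    unfolding e11_def e12_def e21_def e22_def f1_def f2_def
    by (auto intro!: continuous_intros cont \<delta>)
  have UU: "open (U \<times> U)" "Z0 \<in> U \<times> U" using U by (auto simp: open_Times Z0_def P0_def)
  have e0: "e11 Z0 = 0" "e12 Z0 = 0" "e21 Z0 = 0" "e22 Z0 = 0"
    using \<delta> by (simp_all add: e11_def e12_def e21_def e22_def \<delta>_def mult.commute)
  have small: "\<forall>\<^sub>F Z in nhds Z0. norm (e Z) < m" if "continuous_on (U \<times> U) e" "norm (e Z0) < m"
    for e :: "(complex \<times> complex \<times> complex) \<times> (complex \<times> complex \<times> complex) \<Rightarrow> complex" and m
  proof -
    have "isCont (\<lambda>Z. norm (e Z)) Z0"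
      using that(1) UU by (intro continuous_norm) (metis continuous_on_eq_continuous_at)
    then have "((\<lambda>Z. norm (e Z)) \<longlongrightarrow> norm (e Z0)) (nhds Z0)"
      by (simp add: continuous_at tendsto_nhds_iff)
    then show ?thesis using that(2) by (rule order_tendstoD)
  qed
  define K where "K = norm (f1 Z0) + norm (f2 Z0) + 1"
  have K: "1 \<le> K" "norm (f1 Z0) < K" "norm (f2 Z0) < K" by (simp_all add: K_def add_nonneg_pos add_pos_nonneg)
  have "\<forall>\<^sub>F Z in nhds Z0. Z \<in> U \<times> U \<and> norm (e11 Z) < 1/8 \<and> norm (e12 Z) < 1/8 \<and> norm (e21 Z) < 1/8 \<and> norm (e22 Z) < 1/8
      \<and> norm (f1 Z) < K \<and> norm (f2 Z) < K"
    by (intro eventually_conj small ec eventually_nhds_in_open UU) (simp_all add: e0 K)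
  then obtain \<eta> where \<eta>: "\<eta> > 0" and nbhd: "\<And>Z. dist Z Z0 < \<eta> \<Longrightarrow> Z \<in> U \<times> U \<and> norm (e11 Z) < 1/8 \<and> norm (e12 Z) < 1/8 \<and> norm (e21 Z) < 1/8 \<and> norm (e22 Z) < 1/8
      \<and> norm (f1 Z) < K \<and> norm (f2 Z) < K"
    unfolding eventually_nhds_metric by blast
  define \<rho> where "\<rho> = \<eta> / 8"
  define r where "r = min (\<eta> / 8) (\<rho> / (4 * K))"
  have r\<rho>: "0 < \<rho>" "0 < r" "r \<le> \<eta> / 8" "2 * K * r \<le> \<rho> / 2"
  proof -
    show "0 < \<rho>" "r \<le> \<eta> / 8" using \<eta> by (auto simp: \<rho>_def r_def)
    then show "0 < r" using \<eta> K by (auto simp: r_def)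
    have "r \<le> \<rho> / (4 * K)" by (simp add: r_def)
    then have "r * (4 * K) \<le> \<rho>" using K by (simp add: pos_le_divide_eq)
    then show "2 * K * r \<le> \<rho> / 2" by (simp add: algebra_simps)
  qed
  define ok where "ok w v \<longleftrightarrow> w \<in> ball w0 r \<and> v \<in> cball u0 \<rho>" for w v
  have near: "dist ((w, v), (w', v')) Z0 < \<eta>" if "ok w v" "ok w' v'" for w v w' v'
  proof -
    have d: "dist (x, y) (x', y') \<le> dist x x' + dist y y'" for x x' :: "'m::metric_space" and y y' :: "'n::metric_space"
      unfolding dist_Pair_Pair by (rule order_trans[OF sqrt_sum_squares_le_sum_abs]) simp
    have "dist ((w, v), (w', v')) Z0 \<le> dist w w0 + dist v u0 + (dist w' w0 + dist v' u0)"
      unfolding Z0_def P0_def using d[of "(w,v)" "(w',v')" "(w0,u0)" "(w0,u0)"] d[of w v w0 u0] d[of w' v' w0 u0] by linarith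
    also have "\<dots> < \<eta>"
      using that r\<rho>(3) \<eta> unfolding ok_def by (simp add: \<rho>_def dist_commute)
    finally show ?thesis .
  qed
  note nb = nbhd[OF near]
  have inU: "(w, v) \<in> U" if "ok w v" for w v using nb[OF that that] by simp
  have lip: "dist (T w' v') (T w v) \<le> dist v' v / 2 + 2 * K * dist w' w" if "ok w v" "ok w' v'" for w v w' v'
  proof -
    let ?Z = "((w, v), (w', v'))"
    define m n where "m = norm (fst v' - fst v)" and "n = norm (snd v' - snd v)"
    have N: "norm (e11 ?Z) \<le> 1/8" "norm (e12 ?Z) \<le> 1/8" "norm (e21 ?Z) \<le> 1/8" "norm (e22 ?Z) \<le> 1/8"
      "norm (f1 ?Z) \<le> K" "norm (f2 ?Z) \<le> K" using nb[OF that] by (auto intro: less_imp_le)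
    have tri: "norm (p * x + q * y - f * d) \<le> 1/8 * norm x + 1/8 * norm y + K * norm d"
      if "norm p \<le> 1/8" "norm q \<le> 1/8" "norm f \<le> K" for p q f x y d :: complex
    proof -
      have "norm (p * x + q * y - f * d) \<le> norm p * norm x + norm q * norm y + norm f * norm d"
        unfolding norm_mult[symmetric] by (intro norm_triangle_le_diff add_mono norm_triangle_ineq order_refl)
      also have "\<dots> \<le> 1/8 * norm x + 1/8 * norm y + K * norm d"
        using that by (intro add_mono mult_right_mono) auto
      finally show ?thesis .
    qed
    have "dist (T w' v') (T w v) = norm (T w' v' - T w v)" by (rule dist_norm)
    also have "\<dots> \<le> (1/8 * m + 1/8 * n + K * norm (w' - w)) + (1/8 * m + 1/8 * n + K * norm (w' - w))"
      unfolding T_diff[OF inU[OF that(1)] inU[OF that(2)]] m_def n_def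
      by (rule order_trans[OF norm_Pair_le]) (intro add_mono tri N)
    also have "\<dots> = (m + n) / 4 + 2 * K * dist w' w" by (simp add: dist_norm)
    also have "m + n \<le> 2 * dist v' v"
      using norm_fst_snd_le(1)[of "v' - v"] by (simp add: m_def n_def dist_norm)
    finally show ?thesis by simp
  qed
  have ok0: "ok w u0" if "w \<in> ball w0 r" for w using that r\<rho> by (simp add: ok_def)
  have T0: "T w0 u0 = u0" by (simp add: T_def zero)
  have "\<exists>!v. v \<in> cball u0 \<rho> \<and> T w v = v" if w: "w \<in> ball w0 r" for w
  proof (rule Banach_fix[where c="1/2"])
    show "uniform_space_class.complete (cball u0 \<rho>)" "cball u0 \<rho> \<noteq> {}" using r\<rho> by (auto simp: complete_eq_closed)
    show "T w ` cball u0 \<rho> \<subseteq> cball u0 \<rho>"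
    proof (rule image_subsetI)
      fix v assume v: "v \<in> cball u0 \<rho>"
      have okv: "ok w v" using w v by (simp add: ok_def)
      have "dist (T w v) (T w0 u0) \<le> dist v u0 / 2 + 2 * K * dist w w0"
        by (rule lip[OF ok0 okv]) (use r\<rho> in simp)
      also have "\<dots> \<le> \<rho> / 2 + 2 * K * r"
        using v w K by (intro add_mono mult_left_mono) (auto simp: dist_commute)
      also have "\<dots> \<le> \<rho>" using r\<rho>(4) by linarith
      finally show "T w v \<in> cball u0 \<rho>" by (simp add: T0 dist_commute)
    qed
    show "dist (T w x) (T w y) \<le> 1/2 * dist x y" if "x \<in> cball u0 \<rho>" "y \<in> cball u0 \<rho>" for x y
      using lip[of w y w x] that w by (simp add: ok_def)
  qed auto
  then obtain u where u: "\<And>w. w \<in> ball w0 r \<Longrightarrow> u w \<in> cball u0 \<rho> \<and> T w (u w) = u w"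
    and uniq: "\<And>w v. w \<in> ball w0 r \<Longrightarrow> v \<in> cball u0 \<rho> \<Longrightarrow> T w v = v \<Longrightarrow> v = u w"
    by (metis (no_types, lifting))
  have oku: "ok w (u w)" if "w \<in> ball w0 r" for w using u[OF that] that by (simp add: ok_def)
  have u_lip: "dist (u w') (u w) \<le> 4 * K * dist w' w" if "w \<in> ball w0 r" "w' \<in> ball w0 r" for w w'
    using lip[OF oku oku, OF that] u[OF that(1)] u[OF that(2)] by simp
  have hol: "(\<lambda>w. fst (u w)) holomorphic_on ball w0 r" "(\<lambda>w. snd (u w)) holomorphic_on ball w0 r"
  proof -
    define D where "D Z = (1 - e11 Z) * (1 - e22 Z) - e12 Z * e21 Z" for Z
    define q1 where "q1 Z = - (f1 Z * (1 - e22 Z) + e12 Z * f2 Z) / D Z" for Z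
    define q2 where "q2 Z = - (f2 Z * (1 - e11 Z) + e21 Z * f1 Z) / D Z" for Z
    have D: "D ((w, v), (w', v')) \<noteq> 0" if "ok w v" "ok w' v'" for w v w' v'
    proof
      let ?Z = "((w, v), (w', v'))"
      assume "D ?Z = 0"
      then have eq: "norm (1 - e11 ?Z) * norm (1 - e22 ?Z) = norm (e12 ?Z) * norm (e21 ?Z)"
        unfolding norm_mult[symmetric] by (simp add: D_def)
      have N: "norm (e11 ?Z) < 1/8" "norm (e12 ?Z) < 1/8" "norm (e21 ?Z) < 1/8" "norm (e22 ?Z) < 1/8"
        using nb[OF that] by auto
      have "7/8 \<le> norm (1 - e11 ?Z)" "7/8 \<le> norm (1 - e22 ?Z)"
        using norm_triangle_ineq2[of 1 "e11 ?Z"] norm_triangle_ineq2[of 1 "e22 ?Z"] N by auto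
      then have "7/8 * (7/8) \<le> norm (1 - e11 ?Z) * norm (1 - e22 ?Z)" by (intro mult_mono) auto
      moreover have "norm (e12 ?Z) * norm (e21 ?Z) \<le> 1/8 * (1/8)" using N by (intro mult_mono) auto
      ultimately show False using eq by simp
    qed
    have u_cont: "isCont u w" if w: "w \<in> ball w0 r" for w
    proof -
      have "continuous_on (ball w0 r) u"
        by (rule lipschitz_on_continuous_on[where L="4 * K"], rule lipschitz_onI) (use u_lip K in auto)
      then show ?thesis using w by (simp add: continuous_on_eq_continuous_at)
    qed
    \<comment> \<open>Cramer's rule for the fixed-point identity \<open>u w' - u w = T w' (u w') - T w (u w)\<close>.\<close>
    have slope: "(fst (u w') - fst (u w)) = q1 ((w, u w), (w', u w')) * (w' - w)"
        "(snd (u w') - snd (u w)) = q2 ((w, u w), (w', u w')) * (w' - w)"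
      if w: "w \<in> ball w0 r" "w' \<in> ball w0 r" for w w'
    proof -
      let ?Z = "((w, u w), (w', u w'))"
      define x y d where "x = fst (u w') - fst (u w)" and "y = snd (u w') - snd (u w)" and "d = w' - w"
      have "T w' (u w') - T w (u w) = u w' - u w" using u w by simp
      then have eqs: "x = e11 ?Z * x + e12 ?Z * y - f1 ?Z * d" "y = e21 ?Z * x + e22 ?Z * y - f2 ?Z * d"
        using T_diff[OF inU[OF oku[OF w(1)]] inU[OF oku[OF w(2)]]] by (simp_all add: prod_eq_iff x_def y_def d_def)
      have eqs': "(1 - e11 ?Z) * x - e12 ?Z * y = - f1 ?Z * d" "(1 - e22 ?Z) * y - e21 ?Z * x = - f2 ?Z * d"
        using eqs by (simp_all add: left_diff_distrib) (simp_all add: algebra_simps)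
      have D0: "D ?Z \<noteq> 0" by (rule D[OF oku oku]) fact+
      have "D ?Z * x = (1 - e22 ?Z) * ((1 - e11 ?Z) * x - e12 ?Z * y) + e12 ?Z * ((1 - e22 ?Z) * y - e21 ?Z * x)"
        by (simp add: D_def algebra_simps)
      also have "\<dots> = - (f1 ?Z * (1 - e22 ?Z) + e12 ?Z * f2 ?Z) * d" unfolding eqs' by (simp add: algebra_simps)
      finally show "(fst (u w') - fst (u w)) = q1 ?Z * (w' - w)"
        unfolding x_def[symmetric] d_def[symmetric] q1_def using D0 by (simp add: field_simps)
      have "D ?Z * y = (1 - e11 ?Z) * ((1 - e22 ?Z) * y - e21 ?Z * x) + e21 ?Z * ((1 - e11 ?Z) * x - e12 ?Z * y)"
        by (simp add: D_def algebra_simps)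
      also have "\<dots> = - (f2 ?Z * (1 - e11 ?Z) + e21 ?Z * f1 ?Z) * d" unfolding eqs' by (simp add: algebra_simps)
      finally show "(snd (u w') - snd (u w)) = q2 ?Z * (w' - w)"
        unfolding y_def[symmetric] d_def[symmetric] q2_def using D0 by (simp add: field_simps)
    qed
    have lim: "((\<lambda>w'. q ((w, u w), (w', u w'))) \<longlongrightarrow> q ((w, u w), (w, u w))) (at w)"
      if w: "w \<in> ball w0 r" and q: "q = q1 \<or> q = q2" for w q
    proof -
      have Z: "((w, u w), (w, u w)) \<in> U \<times> U" using inU[OF oku[OF w]] by simp
      have "isCont e ((w, u w), (w, u w))" if "continuous_on (U \<times> U) e"
        for e :: "(complex \<times> complex \<times> complex) \<times> (complex \<times> complex \<times> complex) \<Rightarrow> complex"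
        using that Z UU by (simp add: continuous_on_eq_continuous_at)
      note ic = ec[THEN this]
      have "isCont q ((w, u w), (w, u w))"
        using q D[OF oku[OF w] oku[OF w]] ic unfolding q1_def[abs_def] q2_def[abs_def] D_def[abs_def]
        by (auto intro!: continuous_intros)
      moreover have "isCont (\<lambda>w'. ((w, u w), (w', u w'))) w"
        by (intro continuous_intros u_cont w)
      ultimately have "isCont (\<lambda>w'. q ((w, u w), (w', u w'))) w"
        by (rule isCont_o2[rotated])
      then show ?thesis by (simp add: isCont_def)
    qed
    have der: "((\<lambda>w. h (u w)) has_field_derivative q ((w, u w), (w, u w))) (at w)"
      if w: "w \<in> ball w0 r" and hq: "h = fst \<and> q = q1 \<or> h = snd \<and> q = q2" for w h q
      unfolding has_field_derivative_iff
    proof (rule Lim_transform_eventually)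
      show "((\<lambda>w'. q ((w, u w), (w', u w'))) \<longlongrightarrow> q ((w, u w), (w, u w))) (at w)"
        by (rule lim[OF w]) (use hq in auto)
      have "\<forall>\<^sub>F w' in at w. w' \<in> ball w0 r \<and> w' \<noteq> w"
        using eventually_at_in_open[OF open_ball w] by (simp add: eventually_at_filter)
      then show "\<forall>\<^sub>F w' in at w. q ((w, u w), (w', u w')) = (h (u w') - h (u w)) / (w' - w)"
        by eventually_elim (use slope[OF w] hq in auto)
    qed
    show "(\<lambda>w. fst (u w)) holomorphic_on ball w0 r" "(\<lambda>w. snd (u w)) holomorphic_on ball w0 r"
      unfolding holomorphic_on_open[OF open_ball] using der by blast+
  qed
  have "v = u w" if "w \<in> ball w0 r" "v \<in> ball u0 \<rho>" "\<Phi> (w, v) = 0" "\<Psi> (w, v) = 0" for w v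
    by (rule uniq[OF that(1)]) (use that in \<open>auto simp: T_def\<close>)
  then show ?thesis using r\<rho>(1,2) hol by blast
qed

context spectral_law
begin

section \<open>Analytic continuation where the imaginary part is positive\<close>

lemma boundary_Im_G_pos:
  assumes sol: "solves (of_real w) M G" and M: "0 < Im M" and G: "G \<noteq> 0" "0 \<le> Im G"
  shows "0 < Im G"
proof (rule ccontr)
  assume "\<not> 0 < Im G"
  then have G0: "Im G = 0" using G by simp
  define y where "y = resolvent (of_real w) M G"
  have [measurable]: "y \<in> borel_measurable H" unfolding y_def by measurable
  have ity: "integrable H (\<lambda>p. of_real (snd p) * y p)"
    and eG: "- 1 / G = of_real w - of_real c * (LINT p|H. of_real (snd p) * y p)"
    using sol[unfolded solves_def, folded y_def] by blast+
  have Imy: "- Im (of_real (snd p) * y p) = snd p * (snd p * Im M) * (cmod (y p))^2" for p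
  proof -
    have "Im (y p) = - (snd p * Im M) * (cmod (y p))^2"
      unfolding y_def resolvent_def by (subst Im_inverse_norm) (simp add: G0)
    then show ?thesis by simp
  qed
  have i: "integrable H (\<lambda>p. - Im (of_real (snd p) * y p))"
    by (intro Bochner_Integration.integrable_minus integrable_Im ity)
  have nn: "AE p in H. 0 \<le> - Im (of_real (snd p) * y p)"
    using t_pos by eventually_elim (simp only: Imy, use M in simp)
  have "Im (- 1 / G) = 0" using G0 by (simp add: Im_divide)
  then have "c * Im (LINT p|H. of_real (snd p) * y p) = 0" using arg_cong[OF eG, of Im] by simp
  then have "Im (LINT p|H. of_real (snd p) * y p) = 0" using c_pos by simp
  then have "(LINT p|H. - Im (of_real (snd p) * y p)) = 0"
    using integral_Im[OF ity] by simp
  then have "AE p in H. - Im (of_real (snd p) * y p) = 0"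
    using integral_nonneg_eq_0_iff_AE[OF i nn] by simp
  then have "AE p in H. False"
    using t_pos
  proof eventually_elim
    case (elim p)
    then have "y p = 0" using M unfolding Imy by simp
    then have "of_real w + of_real (fst p) * G + of_real (snd p) * M = 0" by (simp add: y_def resolvent_def)
    from arg_cong[OF this, of Im] show False using elim M G0 by simp
  qed
  then show False by (simp add: AE_False)
qed

definition res :: "complex \<times> complex \<times> complex \<Rightarrow> real \<times> real \<Rightarrow> complex" where
  "res P = resolvent (fst P) (fst (snd P)) (snd (snd P))"

lemma res_measurable[measurable]: "res P \<in> borel_measurable H"
  unfolding res_def by measurable

text \<open>The slopes of the system are affine functions of these integrals.\<close>

definition pairing :: "(real \<times> real \<Rightarrow> real) \<Rightarrow> (complex \<times> complex \<times> complex) \<times> (complex \<times> complex \<times> complex) \<Rightarrow> complex" where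
  "pairing k Z = (LINT p|H. of_real (k p) * (res (fst Z) p * res (snd Z) p))"

context
  fixes U :: "(complex \<times> complex \<times> complex) set" and \<kappa> :: real
  assumes bound: "\<forall>P\<in>U. AE p in H. res P p \<noteq> 0 \<and> cmod (res P p) \<le> \<kappa> / (1 + fst p + snd p)"
begin

lemma pairing_bound:
  assumes k: "AE p in H. \<bar>k p\<bar> \<le> (1 + fst p + snd p)^2" and P: "P \<in> U" "P' \<in> U"
  shows "AE p in H. cmod (of_real (k p) * (res P p * res P' p)) \<le> \<kappa>^2"
  using bspec[OF bound P(1)] bspec[OF bound P(2)] k s_nonneg t_pos
proof eventually_elim
  case (elim p)
  define d where "d = 1 + fst p + snd p"
  have d: "0 < d" using elim by (simp add: d_def)
  have "cmod (of_real (k p) * (res P p * res P' p)) = \<bar>k p\<bar> * (cmod (res P p) * cmod (res P' p))"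
    by (simp only: norm_mult norm_of_real)
  also have "\<dots> \<le> d^2 * (\<kappa> / d * (\<kappa> / d))"
  proof (intro mult_mono)
    show "0 \<le> \<kappa> / d" using elim by (auto simp: d_def intro: order_trans[OF norm_ge_zero])
  qed (use elim in \<open>auto simp: d_def\<close>)
  also have "\<dots> = \<kappa>^2" using d by (simp add: power2_eq_square)
  finally show ?case .
qed

lemma pairing_integrable:
  assumes [measurable]: "k \<in> borel_measurable H" and "AE p in H. \<bar>k p\<bar> \<le> (1 + fst p + snd p)^2" "P \<in> U" "P' \<in> U"
  shows "integrable H (\<lambda>p. of_real (k p) * (res P p * res P' p))"
  by (rule integrable_const_bound[OF pairing_bound[OF assms(2-4)]]) measurable

lemma pairing_continuous:
  assumes [measurable]: "k \<in> borel_measurable H" and k: "AE p in H. \<bar>k p\<bar> \<le> (1 + fst p + snd p)^2"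
  shows "continuous_on (U \<times> U) (pairing k)"
proof -
  have yc: "(\<lambda>n. res (P n) p) \<longlonglongrightarrow> res P0 p" if "P \<longlonglongrightarrow> P0" "res P0 p \<noteq> 0" for P P0 p
    using that(2) unfolding res_def resolvent_def
    by (intro tendsto_inverse tendsto_add tendsto_mult tendsto_const tendsto_fst tendsto_snd that(1)) auto
  show ?thesis
  proof (unfold continuous_on_sequentially, intro ballI allI impI, elim conjE)
    fix Z Z0 assume Z0: "Z0 \<in> U \<times> U" and Z: "\<forall>n::nat. Z n \<in> U \<times> U" and lim: "Z \<longlonglongrightarrow> Z0"
    have lim2: "(\<lambda>n. fst (Z n)) \<longlonglongrightarrow> fst Z0" "(\<lambda>n. snd (Z n)) \<longlonglongrightarrow> snd Z0" using lim by (auto intro: tendsto_intros)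
    have Z0': "fst Z0 \<in> U" "snd Z0 \<in> U" using Z0 by auto
    have Z': "fst (Z n) \<in> U" "snd (Z n) \<in> U" for n using Z by (auto simp: mem_Times_iff)
    show "(pairing k \<circ> Z) \<longlonglongrightarrow> pairing k Z0"
      unfolding o_def pairing_def
    proof (rule integral_dominated_convergence[where w="\<lambda>_. \<kappa>^2"])
      show "AE p in H. (\<lambda>n. of_real (k p) * (res (fst (Z n)) p * res (snd (Z n)) p))
          \<longlonglongrightarrow> of_real (k p) * (res (fst Z0) p * res (snd Z0) p)"
        using bspec[OF bound Z0'(1)] bspec[OF bound Z0'(2)]
        by eventually_elim (intro tendsto_mult tendsto_const yc lim2; simp)
      show "AE p in H. norm (of_real (k p) * (res (fst (Z n)) p * res (snd (Z n)) p)) \<le> \<kappa>^2" for n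
        by (rule pairing_bound[OF k Z'])
      show "integrable H (\<lambda>_. \<kappa>^2)" by simp
    qed measurable
  qed
qed

text \<open>This integrates \<open>1 / Q' - 1 / Q = - (Q' - Q) / (Q * Q')\<close>, where \<open>Q' - Q\<close> is linear in the increments.\<close>

lemma resolvent_integral_difference:
  assumes [measurable]: "k \<in> borel_measurable H" and k: "AE p in H. \<bar>k p\<bar> \<le> 1 + fst p + snd p"
    and P: "P \<in> U" "P' \<in> U"
  shows "(LINT p|H. of_real (k p) * res P' p) - (LINT p|H. of_real (k p) * res P p) =
    - (pairing (\<lambda>p. k p * snd p) (P, P') * (fst (snd P') - fst (snd P)) +
       pairing (\<lambda>p. k p * fst p) (P, P') * (snd (snd P') - snd (snd P)) + pairing k (P, P') * (fst P' - fst P))"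
proof -
  have kd: "AE p in H. \<bar>k p\<bar> \<le> (1 + fst p + snd p)^2 \<and> \<bar>k p * fst p\<bar> \<le> (1 + fst p + snd p)^2 \<and>
      \<bar>k p * snd p\<bar> \<le> (1 + fst p + snd p)^2"
    using k s_nonneg t_pos
  proof eventually_elim
    case (elim p)
    have "\<bar>k p\<bar> * 1 \<le> (1 + fst p + snd p) * (1 + fst p + snd p)" "\<bar>k p\<bar> * fst p \<le> (1 + fst p + snd p) * (1 + fst p + snd p)"
      "\<bar>k p\<bar> * snd p \<le> (1 + fst p + snd p) * (1 + fst p + snd p)"
      by (intro mult_mono; use elim in simp)+
    then show ?case using elim by (simp add: power2_eq_square abs_mult)
  qed
  note i = pairing_integrable[OF _ _ P]
  have i0: "integrable H (\<lambda>p. of_real (k p) * (res P p * res P' p))"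
    and i1: "integrable H (\<lambda>p. of_real (k p * fst p) * (res P p * res P' p))"
    and i2: "integrable H (\<lambda>p. of_real (k p * snd p) * (res P p * res P' p))"
    by (rule i; measurable; use kd in \<open>auto elim: eventually_mono\<close>)+
  have ik: "integrable H (\<lambda>p. of_real (k p) * res P p)" if "P \<in> U" for P
  proof (rule integrable_const_bound[where B=\<kappa>])
    show "AE p in H. cmod (of_real (k p) * res P p) \<le> \<kappa>"
      using bspec[OF bound that] k s_nonneg t_pos
    proof eventually_elim
      case (elim p)
      have "\<bar>k p\<bar> * cmod (res P p) \<le> (1 + fst p + snd p) * (\<kappa> / (1 + fst p + snd p))"
        using elim by (intro mult_mono) auto
      then show ?case using elim by (simp add: norm_mult)
    qed
  qed measurable
  have "(LINT p|H. of_real (k p) * res P' p) - (LINT p|H. of_real (k p) * res P p)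
      = (LINT p|H. of_real (k p) * res P' p - of_real (k p) * res P p)" using ik P by simp
  also have "\<dots> = (LINT p|H. - ((fst (snd P') - fst (snd P)) * (of_real (k p * snd p) * (res P p * res P' p)) +
      ((snd (snd P') - snd (snd P)) * (of_real (k p * fst p) * (res P p * res P' p)) +
       (fst P' - fst P) * (of_real (k p) * (res P p * res P' p)))))"
  proof (rule integral_cong_AE)
    show "AE p in H. of_real (k p) * res P' p - of_real (k p) * res P p =
      - ((fst (snd P') - fst (snd P)) * (of_real (k p * snd p) * (res P p * res P' p)) +
      ((snd (snd P') - snd (snd P)) * (of_real (k p * fst p) * (res P p * res P' p)) +
       (fst P' - fst P) * (of_real (k p) * (res P p * res P' p))))"
      using bspec[OF bound P(1)] bspec[OF bound P(2)]
    proof eventually_elim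
      case (elim p)
      define Q where "Q = fst P + of_real (fst p) * snd (snd P) + of_real (snd p) * fst (snd P)"
      define Q' where "Q' = fst P' + of_real (fst p) * snd (snd P') + of_real (snd p) * fst (snd P')"
      have Q: "res P p = inverse Q" "res P' p = inverse Q'" by (simp_all only: res_def resolvent_def Q_def Q'_def)
      then have "Q \<noteq> 0" "Q' \<noteq> 0" using elim by auto
      then have "res P' p - res P p = - (Q' - Q) * (res P p * res P' p)" unfolding Q by (simp add: field_simps)
      then have "of_real (k p) * res P' p - of_real (k p) * res P p = of_real (k p) * (- (Q' - Q) * (res P p * res P' p))"
        by (simp only: right_diff_distrib[symmetric])
      then show ?case by (simp add: Q_def Q'_def algebra_simps)
    qed
  qed measurable
  also have "\<dots> = - ((fst (snd P') - fst (snd P)) * pairing (\<lambda>p. k p * snd p) (P, P') +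
      ((snd (snd P') - snd (snd P)) * pairing (\<lambda>p. k p * fst p) (P, P') + (fst P' - fst P) * pairing k (P, P')))"
    unfolding pairing_def fst_conv snd_conv
    by (simp only: Bochner_Integration.integral_minus Bochner_Integration.integral_add
        Bochner_Integration.integrable_add integrable_mult_right integral_mult_right_zero i0 i1 i2)
  finally show ?thesis by (simp only: ac_simps)
qed

end

text \<open>The three numbers lie in an open half-plane \<open>{Im z + \<epsilon> * Re z > 0}\<close>. So does their neighbourhood, and on it \<open>|Q|\<close>,
  being a combination with coefficients \<open>1\<close>, \<open>s\<close>, \<open>t\<close>, is at least a constant times \<open>1 + s + t\<close>.\<close>

lemma half_plane_neighbourhood:
  assumes w0: "Im w0 = 0" "0 < Re w0" and pos: "0 < Im M0" "0 < Im G0"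
  obtains U \<kappa> where "open U" "(w0, M0, G0) \<in> U" "\<forall>P\<in>U. fst P \<noteq> 0" "\<forall>P\<in>U. snd (snd P) \<noteq> 0"
    "\<forall>P\<in>U. AE p in H. res P p \<noteq> 0 \<and> cmod (res P p) \<le> \<kappa> / (1 + fst p + snd p)"
proof -
  define \<epsilon> where "\<epsilon> = min (Im G0 / (2 * (\<bar>Re G0\<bar> + 1))) (Im M0 / (2 * (\<bar>Re M0\<bar> + 1)))"
  have \<epsilon>: "0 < \<epsilon>" using pos by (auto simp: \<epsilon>_def add_nonneg_pos)
  define l where "l z = Im z + \<epsilon> * Re z" for z
  have lpos: "0 < l z" if "\<epsilon> \<le> Im z / (2 * (\<bar>Re z\<bar> + 1))" "0 < Im z" for z
  proof -
    have "\<epsilon> * (2 * (\<bar>Re z\<bar> + 1)) \<le> Im z"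
      by (rule pos_le_divide_eq[THEN iffD1, OF _ that(1)]) simp
    then have "\<epsilon> * (\<bar>Re z\<bar> + 1) \<le> Im z / 2" by linarith
    moreover have "\<epsilon> * (\<bar>Re z\<bar> + 1) = \<epsilon> * \<bar>Re z\<bar> + \<epsilon>" by (simp add: distrib_left)
    moreover have "- (\<epsilon> * \<bar>Re z\<bar>) \<le> \<epsilon> * Re z" using \<epsilon> abs_ge_minus_self[of "Re z"]
      by (metis minus_le_iff mult_le_cancel_left_pos mult_minus_right)
    ultimately show ?thesis using that(2) \<epsilon> by (simp add: l_def)
  qed
  have l0: "0 < l w0" "0 < l M0" "0 < l G0"
    using w0 \<epsilon> pos by (auto simp: l_def[of w0] intro!: lpos simp: \<epsilon>_def)
  define \<delta> where "\<delta> = min (l w0) (min (l M0) (l G0)) / 2"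
  have \<delta>: "0 < \<delta>" "\<delta> < l w0" "\<delta> < l M0" "\<delta> < l G0" using l0 by (auto simp: \<delta>_def)
  define U where "U = {P. \<delta> < l (fst P) \<and> \<delta> < l (fst (snd P)) \<and> \<delta> < l (snd (snd P))}"
  have U: "open U"
    unfolding U_def l_def by (intro open_Collect_conj open_Collect_less continuous_intros)
  have l_norm: "l z \<le> (1 + \<epsilon>) * cmod z" for z
  proof -
    have "Im z \<le> cmod z" "\<epsilon> * Re z \<le> \<epsilon> * cmod z"
      using abs_Im_le_cmod[of z] complex_Re_le_cmod[of z] \<epsilon> by (auto intro: mult_left_mono)
    then show ?thesis by (simp add: l_def algebra_simps)
  qed
  define \<kappa> where "\<kappa> = (1 + \<epsilon>) / \<delta>"
  have bound: "AE p in H. res P p \<noteq> 0 \<and> cmod (res P p) \<le> \<kappa> / (1 + fst p + snd p)" if P: "P \<in> U" for P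
    using s_nonneg t_pos
  proof eventually_elim
    case (elim p)
    let ?Q = "fst P + of_real (fst p) * snd (snd P) + of_real (snd p) * fst (snd P)"
    have "l ?Q = l (fst P) + fst p * l (snd (snd P)) + snd p * l (fst (snd P))" by (simp add: l_def algebra_simps)
    moreover have "\<delta> \<le> l (fst P)" "fst p * \<delta> \<le> fst p * l (snd (snd P))" "snd p * \<delta> \<le> snd p * l (fst (snd P))"
      using P elim by (auto simp: U_def intro!: mult_left_mono)
    ultimately have 1: "\<delta> * (1 + fst p + snd p) \<le> (1 + \<epsilon>) * cmod ?Q"
      using l_norm[of ?Q] by (simp add: algebra_simps)
    have d: "0 < 1 + fst p + snd p" using elim by simp
    then have Q: "0 < cmod ?Q" using 1 \<delta> \<epsilon> by (smt (verit) mult_pos_pos mult_nonneg_nonpos norm_ge_zero)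
    then have "?Q \<noteq> 0" by auto
    moreover have "inverse (cmod ?Q) \<le> \<kappa> / (1 + fst p + snd p)"
    proof -
      have "\<delta> * (1 + fst p + snd p) * inverse (cmod ?Q) \<le> (1 + \<epsilon>) * cmod ?Q * inverse (cmod ?Q)"
        using 1 by (intro mult_right_mono) auto
      also have "\<dots> = 1 + \<epsilon>" using Q by simp
      finally have "inverse (cmod ?Q) * (\<delta> * (1 + fst p + snd p)) \<le> 1 + \<epsilon>" by (simp only: mult.commute)
      then have "inverse (cmod ?Q) \<le> (1 + \<epsilon>) / (\<delta> * (1 + fst p + snd p))"
        using d \<delta> by (subst pos_le_divide_eq) auto
      then show ?thesis by (simp add: \<kappa>_def)
    qed
    ultimately show ?case by (simp add: res_def resolvent_def norm_inverse)
  qed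
  show thesis
    by (rule that[OF U _ _ _ ballI[OF bound]]) (use \<delta> in \<open>auto simp: U_def l_def\<close>)
qed

text \<open>A kernel vector would force \<open>Q = cnj Q\<close> by \<open>linearization_kernel\<close>, but \<open>Im Q > 0\<close>.\<close>

lemma jacobian_nonzero:
  assumes sol0: "solves w0 M0 G0" and w0: "Im w0 = 0" and M0: "0 < Im M0" and G0: "0 < Im G0"
    and U: "(w0, M0, G0) \<in> U"
    and bound: "\<forall>P\<in>U. AE p in H. res P p \<noteq> 0 \<and> cmod (res P p) \<le> \<kappa> / (1 + fst p + snd p)"
  defines "Z \<equiv> ((w0, M0, G0), (w0, M0, G0))"
  shows "(1 - of_real c * pairing snd Z) * (1 / (G0 * G0) - of_real c * pairing (\<lambda>p. snd p * fst p) Z)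
      - (- of_real c * pairing fst Z) * (- of_real c * pairing (\<lambda>p. snd p * snd p) Z) \<noteq> 0"
proof
  define \<alpha> \<beta> \<sigma> \<tau> where "\<alpha> = 1 / (G0 * G0) - of_real c * pairing (\<lambda>p. snd p * fst p) Z" and "\<beta> = 1 - of_real c * pairing snd Z"
    and "\<sigma> = of_real c * pairing fst Z" and "\<tau> = of_real c * pairing (\<lambda>p. snd p * snd p) Z"
  assume "(1 - of_real c * pairing snd Z) * (1 / (G0 * G0) - of_real c * pairing (\<lambda>p. snd p * fst p) Z)
    - (- of_real c * pairing fst Z) * (- of_real c * pairing (\<lambda>p. snd p * snd p) Z) = 0"
  then have sing: "\<beta> * \<alpha> = \<sigma> * \<tau>" by (simp add: \<alpha>_def \<beta>_def \<sigma>_def \<tau>_def)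
  \<comment> \<open>A singular matrix has one of the vectors \<open>(\<sigma>, \<beta>)\<close>, \<open>(\<alpha>, \<tau>)\<close>, \<open>(1, 0)\<close> as a nonzero kernel vector.\<close>
  obtain dM dG where d: "dM \<noteq> 0 \<or> dG \<noteq> 0" "\<beta> * dM = \<sigma> * dG" "\<alpha> * dG = \<tau> * dM"
  proof (cases "\<beta> = 0 \<and> \<sigma> = 0")
    case False
    then show ?thesis using sing by (intro that[of \<sigma> \<beta>]) (auto simp: mult.commute)
  next
    case True
    show ?thesis
    proof (cases "\<alpha> = 0 \<and> \<tau> = 0")
      case False
      then show ?thesis using \<open>\<beta> = 0 \<and> \<sigma> = 0\<close> by (intro that[of \<alpha> \<tau>]) (auto simp: mult.commute)
    next
      case True
      then show ?thesis using \<open>\<beta> = 0 \<and> \<sigma> = 0\<close> by (intro that[of 1 0]) auto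
    qed
  qed
  define y0 where "y0 = res (w0, M0, G0)"
  have le: "AE p in H. \<bar>fst p\<bar> \<le> (1 + fst p + snd p)^2 \<and> \<bar>snd p\<bar> \<le> (1 + fst p + snd p)^2 \<and>
      \<bar>snd p * fst p\<bar> \<le> (1 + fst p + snd p)^2 \<and> \<bar>snd p * snd p\<bar> \<le> (1 + fst p + snd p)^2"
    using s_nonneg t_pos
  proof eventually_elim
    case (elim p)
    then have "0 \<le> fst p * fst p" "0 \<le> fst p * snd p" "0 \<le> snd p * snd p" by auto
    then show ?case using elim unfolding power2_eq_square by (auto simp: abs_mult algebra_simps)
  qed
  note Ii0 = pairing_integrable[OF bound _ _ U U, folded y0_def]
  have Ii: "integrable H (\<lambda>p. of_real (fst p) * (y0 p * y0 p))" "integrable H (\<lambda>p. of_real (snd p) * (y0 p * y0 p))"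
    "integrable H (\<lambda>p. of_real (snd p * fst p) * (y0 p * y0 p))" "integrable H (\<lambda>p. of_real (snd p * snd p) * (y0 p * y0 p))"
    by (rule Ii0; measurable; use le in \<open>auto elim: eventually_mono\<close>)+
  have I0: "pairing k Z = (LINT p|H. of_real (k p) * (y0 p * y0 p))" for k by (simp add: pairing_def Z_def y0_def)
  have adm: "admissible y0 G0"
    unfolding y0_def res_def fst_conv snd_conv
    by (rule admissible_of_solution) (use sol0 w0 M0 G0 in auto)
  have "(LINT p|H. (of_real (fst p) * dG + of_real (snd p) * dM) * (y0 p * y0 p))
      = (LINT p|H. dG * (of_real (fst p) * (y0 p * y0 p)) + dM * (of_real (snd p) * (y0 p * y0 p)))"
    by (rule Bochner_Integration.integral_cong) (simp_all add: algebra_simps)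
  also have "\<dots> = dG * pairing fst Z + dM * pairing snd Z"
    unfolding I0
    by (simp only: Bochner_Integration.integral_add integrable_mult_right integral_mult_right_zero Ii)
  finally have i1: "(LINT p|H. (of_real (fst p) * dG + of_real (snd p) * dM) * (y0 p * y0 p)) = dG * pairing fst Z + dM * pairing snd Z" .
  have e1: "dM = of_real c * (LINT p|H. (of_real (fst p) * dG + of_real (snd p) * dM) * (y0 p * y0 p))"
  proof -
    have "dM = \<beta> * dM + of_real c * pairing snd Z * dM" by (simp add: \<beta>_def algebra_simps)
    also have "\<dots> = of_real c * (dG * pairing fst Z + dM * pairing snd Z)" unfolding d(2) \<sigma>_def by (simp add: algebra_simps)
    finally show ?thesis unfolding i1 .
  qed
  have "(LINT p|H. of_real (snd p) * (of_real (fst p) * dG + of_real (snd p) * dM) * (y0 p * y0 p))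
      = (LINT p|H. dG * (of_real (snd p * fst p) * (y0 p * y0 p)) + dM * (of_real (snd p * snd p) * (y0 p * y0 p)))"
    by (rule Bochner_Integration.integral_cong) (simp_all add: algebra_simps)
  also have "\<dots> = dG * pairing (\<lambda>p. snd p * fst p) Z + dM * pairing (\<lambda>p. snd p * snd p) Z"
    unfolding I0
    by (simp only: Bochner_Integration.integral_add integrable_mult_right integral_mult_right_zero Ii)
  finally have i2: "(LINT p|H. of_real (snd p) * (of_real (fst p) * dG + of_real (snd p) * dM) * (y0 p * y0 p))
      = dG * pairing (\<lambda>p. snd p * fst p) Z + dM * pairing (\<lambda>p. snd p * snd p) Z" .
  define g0 where "g0 = 1 / (G0 * G0)"
  have "dG * g0 = \<alpha> * dG + of_real c * pairing (\<lambda>p. snd p * fst p) Z * dG"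
    unfolding \<alpha>_def g0_def[symmetric] by (simp add: algebra_simps)
  also have "\<dots> = of_real c * (dG * pairing (\<lambda>p. snd p * fst p) Z + dM * pairing (\<lambda>p. snd p * snd p) Z)"
    unfolding d(3) \<tau>_def by (simp add: algebra_simps)
  finally have e2: "dG / (G0 * G0) = of_real c * (LINT p|H. of_real (snd p) * (of_real (fst p) * dG + of_real (snd p) * dM) * (y0 p * y0 p))"
    unfolding i2 g0_def by simp
  from linearization_kernel[OF adm adm e1 e2] d(1) have "AE p in H. y0 p = cnj (y0 p)" by blast
  then have "AE p in H. False"
    using s_nonneg t_pos
  proof eventually_elim
    case (elim p)
    define Q where "Q = w0 + of_real (fst p) * G0 + of_real (snd p) * M0"
    have "inverse Q = inverse (cnj Q)" using elim by (simp add: y0_def res_def resolvent_def Q_def)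
    then have "Q = cnj Q" by simp
    then have "Im Q = 0" by (metis Im_complex_of_real Reals_cnj_iff complex_is_Real_iff)
    moreover have "0 < Im Q" using elim M0 G0 w0 by (simp add: Q_def add_nonneg_pos)
    ultimately show False by simp
  qed
  then show False by (simp add: AE_False)
qed

text \<open>The implicit function theorem solves the system in a full disc around the boundary point. In the upper half of the
  disc its solution is the given one, since that one is close to the boundary value.\<close>

lemma boundary_analytic:
  fixes M G :: "complex \<Rightarrow> complex"
  assumes sol: "\<And>z. 0 < Im z \<Longrightarrow> solves (csqrt z) (M z) (G z)"
    and x: "0 < x"
    and lim: "(M \<longlongrightarrow> M0) (at (of_real x) within \<complex>\<^sup>+)" "(G \<longlongrightarrow> G0) (at (of_real x) within \<complex>\<^sup>+)"
    and sol0: "solves (of_real (sqrt x)) M0 G0" and G0: "G0 \<noteq> 0" "0 \<le> Im G0" and M0: "0 < Im M0"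
  shows "\<exists>r \<mu>. 0 < r \<and> \<mu> holomorphic_on ball (of_real x) r \<and>
    (\<forall>z\<in>ball (of_real x) r. 0 < Im z \<longrightarrow> M z = \<mu> z)"
proof -
  define w0 where "w0 = complex_of_real (sqrt x)"
  have w0: "Im w0 = 0" "0 < Re w0" using x by (auto simp: w0_def)
  have G0pos: "0 < Im G0" by (rule boundary_Im_G_pos[OF sol0 M0 G0])
  obtain U \<kappa> where U: "open U" "(w0, M0, G0) \<in> U" and nz: "\<forall>P\<in>U. fst P \<noteq> 0" "\<forall>P\<in>U. snd (snd P) \<noteq> 0"
    and bound: "\<forall>P\<in>U. AE p in H. res P p \<noteq> 0 \<and> cmod (res P p) \<le> \<kappa> / (1 + fst p + snd p)"
    by (rule half_plane_neighbourhood[OF w0 M0 G0pos])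
  define \<Phi> where "\<Phi> P = fst (snd P) + of_real (1 - c) / fst P + of_real c * (LINT p|H. of_real 1 * res P p)" for P
  define \<Psi> where "\<Psi> P = - 1 / snd (snd P) - fst P + of_real c * (LINT p|H. of_real (snd p) * res P p)" for P
  have one: "AE p in H. \<bar>1\<bar> \<le> 1 + fst p + snd p" and sn: "AE p in H. \<bar>snd p\<bar> \<le> 1 + fst p + snd p"
    using s_nonneg t_pos by (auto elim: eventually_elim2)
  have slope1: "\<Phi> (w', v') - \<Phi> (w, v) =
      (1 - of_real c * pairing snd ((w, v), (w', v'))) * (fst v' - fst v)
      + (- of_real c * pairing fst ((w, v), (w', v'))) * (snd v' - snd v)
      + (- of_real (1 - c) / (w * w') - of_real c * pairing (\<lambda>_. 1) ((w, v), (w', v'))) * (w' - w)"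
    if P: "(w, v) \<in> U" "(w', v') \<in> U" for w v w' v'
  proof -
    note D = resolvent_integral_difference[OF bound borel_measurable_const one P, unfolded fst_conv snd_conv mult_1_left]
    have nzw: "w \<noteq> 0" "w' \<noteq> 0" using bspec[OF nz(1) P(1)] bspec[OF nz(1) P(2)] by auto
    have "of_real (1 - c) / w' - of_real (1 - c) / w = - of_real (1 - c) / (w * w') * (w' - w)"
      using nzw by (simp add: field_simps)
    then have "\<Phi> (w', v') - \<Phi> (w, v) = (fst v' - fst v) + - of_real (1 - c) / (w * w') * (w' - w)
        + of_real c * ((LINT p|H. of_real 1 * res (w', v') p) - (LINT p|H. of_real 1 * res (w, v) p))"
      unfolding \<Phi>_def fst_conv snd_conv by (simp only: right_diff_distrib) (simp add: algebra_simps)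
    then show ?thesis unfolding D by (simp add: algebra_simps)
  qed
  have slope2: "\<Psi> (w', v') - \<Psi> (w, v) =
      (- of_real c * pairing (\<lambda>p. snd p * snd p) ((w, v), (w', v'))) * (fst v' - fst v)
      + (1 / (snd v * snd v') - of_real c * pairing (\<lambda>p. snd p * fst p) ((w, v), (w', v'))) * (snd v' - snd v)
      + (- 1 - of_real c * pairing snd ((w, v), (w', v'))) * (w' - w)"
    if P: "(w, v) \<in> U" "(w', v') \<in> U" for w v w' v'
  proof -
    note D = resolvent_integral_difference[OF bound snd_measurable sn P, unfolded fst_conv snd_conv]
    have nzG: "snd v \<noteq> 0" "snd v' \<noteq> 0" using bspec[OF nz(2) P(1)] bspec[OF nz(2) P(2)] by auto
    have "- 1 / snd v' - - 1 / snd v = 1 / (snd v * snd v') * (snd v' - snd v)"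
      using nzG by (simp add: field_simps)
    then have "\<Psi> (w', v') - \<Psi> (w, v) = 1 / (snd v * snd v') * (snd v' - snd v) - (w' - w)
        + of_real c * ((LINT p|H. of_real (snd p) * res (w', v') p) - (LINT p|H. of_real (snd p) * res (w, v) p))"
      unfolding \<Psi>_def fst_conv snd_conv by (simp only: right_diff_distrib) (simp add: algebra_simps)
    then show ?thesis unfolding D by (simp add: algebra_simps)
  qed
  have zero_iff: "\<Phi> (w, (M, G)) = 0 \<and> \<Psi> (w, (M, G)) = 0" if "solves w M G" for w M G
  proof -
    define J1 J2 where "J1 = of_real c * (LINT p|H. of_real 1 * res (w, (M, G)) p)"
      and "J2 = of_real c * (LINT p|H. of_real (snd p) * res (w, (M, G)) p)"
    have e: "M = - of_real (1 - c) / w - J1" "- 1 / G = w - J2"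
      using that unfolding solves_def res_def fst_conv snd_conv J1_def J2_def of_real_1 mult_1_left by blast+
    have "\<Phi> (w, (M, G)) = M + of_real (1 - c) / w + J1" by (simp add: \<Phi>_def J1_def)
    also have "\<dots> = (- of_real (1 - c) / w - J1) + of_real (1 - c) / w + J1" by (simp only: e(1)[symmetric])
    also have "\<dots> = 0" by (simp only: minus_divide_left[symmetric]) simp
    finally have "\<Phi> (w, (M, G)) = 0" .
    moreover have "\<Psi> (w, (M, G)) = - 1 / G - w + J2" by (simp add: \<Psi>_def J2_def)
    then have "\<Psi> (w, (M, G)) = 0" unfolding e(2) by simp
    ultimately show ?thesis by simp
  qed
  note det = jacobian_nonzero[OF sol0[folded w0_def] w0(1) M0 G0pos U(2) bound]
  have Ic: "continuous_on (U \<times> U) (pairing k)"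
    if "k \<in> {\<lambda>_. 1, fst, snd, \<lambda>p. snd p * fst p, \<lambda>p. snd p * snd p}" for k
  proof (rule pairing_continuous[OF bound])
    show "k \<in> borel_measurable H" using that by auto
    show "AE p in H. \<bar>k p\<bar> \<le> (1 + fst p + snd p)^2"
      using s_nonneg t_pos
    proof eventually_elim
      case (elim p)
      then have "0 \<le> fst p * fst p" "0 \<le> fst p * snd p" "0 \<le> snd p * snd p" by auto
      then show ?case using elim that unfolding power2_eq_square by (auto simp: abs_mult algebra_simps)
    qed
  qed
  have nzZ: "\<forall>Z\<in>U \<times> U. fst (fst Z) * fst (snd Z) \<noteq> 0" "\<forall>Z\<in>U \<times> U. snd (snd (fst Z)) * snd (snd (snd Z)) \<noteq> 0"
    by (intro ballI no_zero_divisors bspec[OF nz(1)] bspec[OF nz(2)]; simp add: mem_Times_iff)+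
  have cont: "continuous_on (U \<times> U) (\<lambda>Z. 1 - of_real c * pairing snd Z)"
    "continuous_on (U \<times> U) (\<lambda>Z. - of_real c * pairing fst Z)"
    "continuous_on (U \<times> U) (\<lambda>Z. - of_real c * pairing (\<lambda>p. snd p * snd p) Z)"
    "continuous_on (U \<times> U) (\<lambda>Z. - 1 - of_real c * pairing snd Z)"
    by (intro continuous_intros Ic; simp)+
  have cont_k: "continuous_on (U \<times> U) (\<lambda>Z. - of_real (1 - c) / (fst (fst Z) * fst (snd Z)) - of_real c * pairing (\<lambda>_. 1) Z)"
    by (intro continuous_intros Ic nzZ; simp)
  have cont_b: "continuous_on (U \<times> U) (\<lambda>Z. 1 / (snd (snd (fst Z)) * snd (snd (snd Z))) - of_real c * pairing (\<lambda>p. snd p * fst p) Z)"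
    by (intro continuous_intros Ic nzZ; simp)
  note zero = zero_iff[OF sol0[folded w0_def], THEN conjunct1] zero_iff[OF sol0[folded w0_def], THEN conjunct2]
  have "\<exists>r \<rho> u. 0 < r \<and> 0 < \<rho> \<and> (\<lambda>w. fst (u w)) holomorphic_on ball w0 r \<and> (\<lambda>w. snd (u w)) holomorphic_on ball w0 r \<and>
      (\<forall>w\<in>ball w0 r. \<forall>v\<in>ball (M0, G0) \<rho>. \<Phi> (w, v) = 0 \<longrightarrow> \<Psi> (w, v) = 0 \<longrightarrow> v = u w)"
    by (rule implicit_function_slopes[where \<Phi>=\<Phi> and \<Psi>=\<Psi> and U=U and ?w0.0=w0 and ?u0.0="(M0, G0)"
        and a="\<lambda>Z. 1 - of_real c * pairing snd Z" and b="\<lambda>Z. - of_real c * pairing fst Z"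
        and k="\<lambda>Z. - of_real (1 - c) / (fst (fst Z) * fst (snd Z)) - of_real c * pairing (\<lambda>_. 1) Z"
        and a'="\<lambda>Z. - of_real c * pairing (\<lambda>p. snd p * snd p) Z"
        and b'="\<lambda>Z. 1 / (snd (snd (fst Z)) * snd (snd (snd Z))) - of_real c * pairing (\<lambda>p. snd p * fst p) Z"
        and k'="\<lambda>Z. - 1 - of_real c * pairing snd Z",
        unfolded fst_conv snd_conv, OF U slope1 slope2 cont(1,2) cont_k cont(3) cont_b cont(4) zero det])
  then obtain r \<rho> u where r: "0 < r" and \<rho>: "0 < \<rho>" and hol: "(\<lambda>w. fst (u w)) holomorphic_on ball w0 r"
    and uniq: "\<forall>w\<in>ball w0 r. \<forall>v\<in>ball (M0, G0) \<rho>. \<Phi> (w, v) = 0 \<longrightarrow> \<Psi> (w, v) = 0 \<longrightarrow> v = u w"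
    by (elim exE conjE)
  have cx: "csqrt (of_real x) = w0" 
    unfolding w0_def by (rule of_real_sqrt[OF less_imp_le[OF x], symmetric])
  have "isCont csqrt (of_real x)" using x by (intro continuous_at_csqrt) (auto simp: complex_nonpos_Reals_iff)
  then obtain r1 where r1: "0 < r1" "\<And>z. dist z (of_real x) < r1 \<Longrightarrow> dist (csqrt z) w0 < r"
    using r unfolding continuous_at_eps_delta cx by metis
  have "\<forall>\<^sub>F z in at (of_real x) within \<complex>\<^sup>+. dist (M z, G z) (M0, G0) < \<rho>"
    by (rule tendstoD[OF tendsto_Pair[OF lim] \<rho>])
  then obtain r2 where r2: "0 < r2" "\<And>z. 0 < Im z \<Longrightarrow> z \<noteq> of_real x \<Longrightarrow> dist z (of_real x) < r2 \<Longrightarrow> dist (M z, G z) (M0, G0) < \<rho>"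
    unfolding eventually_at by auto
  define r3 where "r3 = min x (min r1 r2)"
  have r3: "0 < r3" "r3 \<le> x" "r3 \<le> r1" "r3 \<le> r2" using x r1 r2 by (auto simp: r3_def)
  have Repos: "0 < Re z" if "z \<in> ball (of_real x) r3" for z
  proof -
    have "\<bar>Re (z - of_real x)\<bar> < x" using that r3 abs_Re_le_cmod[of "z - of_real x"] by (auto simp: dist_norm norm_minus_commute)
    then show ?thesis by simp
  qed
  have hc: "csqrt holomorphic_on ball (of_real x) r3"
    unfolding holomorphic_on_def using Repos
    by (intro ballI field_differentiable_within_csqrt) (auto simp: complex_nonpos_Reals_iff not_le)
  have hol_u: "(\<lambda>w. fst (u w)) \<circ> csqrt holomorphic_on ball (of_real x) r3"
    by (rule holomorphic_on_compose_gen[OF hc hol]) (use r1 r3 in \<open>auto simp: dist_commute\<close>)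
  have eq_u: "M z = ((\<lambda>w. fst (u w)) \<circ> csqrt) z" if z: "z \<in> ball (of_real x) r3" "0 < Im z" for z
  proof -
    have "z \<noteq> of_real x" using z by auto
    then have "(M z, G z) = u (csqrt z)"
      using z r1 r2 r3 zero_iff[OF sol[OF z(2)]] by (intro uniq[rule_format]) (auto simp: dist_commute)
    then show ?thesis by (metis comp_apply fst_conv)
  qed
  show ?thesis using r3(1) hol_u eq_u by blast
qed

end

section \<open>The limit law is supported on the nonnegative half-line\<close>

text \<open>An eigenvector \<open>v\<close> satisfies \<open>l * |v|^2 = |u|^2 / N\<close> for \<open>u = mat_adjoint A *\<^sub>v v\<close>.\<close>

lemma Re_eigenvalue_gram:
  assumes "l \<in># proots (char_poly (gram N A))"
  shows "0 \<le> Re l"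
proof -
  define k m where "k = dim_row A" and "m = dim_col A"
  have A: "A \<in> carrier_mat k m" by (simp add: k_def m_def)
  have adj: "mat_adjoint A \<in> carrier_mat m k" unfolding mat_adjoint_def k_def m_def by (auto simp: mat_of_rows_def)
  have adj_ij: "mat_adjoint A $$ (j, i) = cnj (A $$ (i, j))" if "i < k" "j < m" for i j
    using that unfolding mat_adjoint_def k_def m_def by (simp add: mat_of_rows_def)
  have gram: "gram N A \<in> carrier_mat k k" using A adj by (simp add: gram_def)
  have "char_poly (gram N A) \<noteq> 0" using degree_monic_char_poly[OF gram] by auto
  then have "poly (char_poly (gram N A)) l = 0" using assms by simp
  then have "eigenvalue (gram N A) l" using eigenvalue_root_char_poly[OF gram] by simp
  then obtain v where "eigenvector (gram N A) v l" unfolding eigenvalue_def by blast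
  then have v: "v \<in> carrier_vec k" "v \<noteq> 0\<^sub>v k" and ev: "gram N A *\<^sub>v v = l \<cdot>\<^sub>v v"
    using gram by (auto simp: eigenvector_def)
  define u where "u = mat_adjoint A *\<^sub>v v"
  have u: "u \<in> carrier_vec m" using adj v by (simp add: u_def)
  have u_j: "cnj (vec_index u j) = (\<Sum>i<k. A $$ (i, j) * cnj (vec_index v i))" if "j < m" for j
    using that adj v adj_ij unfolding u_def
    by (simp add: scalar_prod_def atLeast0LessThan carrier_matD)
  have gv: "gram N A *\<^sub>v v = complex_of_real (1 / real N) \<cdot>\<^sub>v (A *\<^sub>v u)"
  proof -
    have "(x \<cdot>\<^sub>m B) *\<^sub>v v = x \<cdot>\<^sub>v (B *\<^sub>v v)" if "B \<in> carrier_mat k k" for B and x :: complex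
      by (rule eq_vecI) (use that v in \<open>auto simp: scalar_prod_def sum_distrib_left mult.assoc\<close>)
    from this[OF mult_carrier_mat[OF A adj]]
    have "gram N A *\<^sub>v v = complex_of_real (1 / real N) \<cdot>\<^sub>v ((A * mat_adjoint A) *\<^sub>v v)"
      unfolding gram_def .
    also have "(A * mat_adjoint A) *\<^sub>v v = A *\<^sub>v u" unfolding u_def by (rule assoc_mult_mat_vec[OF A adj v(1)])
    finally show ?thesis .
  qed
  have row: "l * vec_index v i = complex_of_real (1 / real N) * (\<Sum>j<m. A $$ (i, j) * vec_index u j)" if "i < k" for i
  proof -
    have "(l \<cdot>\<^sub>v v) $ i = vec_index (complex_of_real (1 / real N) \<cdot>\<^sub>v (A *\<^sub>v u)) i" using ev gv by simp
    then show ?thesis using that v u A by (simp add: scalar_prod_def atLeast0LessThan)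
  qed
  have "l * (\<Sum>i<k. vec_index v i * cnj (vec_index v i)) = (\<Sum>i<k. (l * vec_index v i) * cnj (vec_index v i))"
    by (simp add: sum_distrib_left mult.assoc)
  also have "\<dots> = (\<Sum>i<k. complex_of_real (1 / real N) * (\<Sum>j<m. A $$ (i, j) * vec_index u j) * cnj (vec_index v i))"
    by (rule sum.cong) (simp_all only: row lessThan_iff)
  also have "\<dots> = complex_of_real (1 / real N) * (\<Sum>i<k. \<Sum>j<m. vec_index u j * (A $$ (i, j) * cnj (vec_index v i)))"
    by (simp add: sum_distrib_left sum_distrib_right mult_ac)
  also have "(\<Sum>i<k. \<Sum>j<m. vec_index u j * (A $$ (i, j) * cnj (vec_index v i))) = (\<Sum>j<m. \<Sum>i<k. vec_index u j * (A $$ (i, j) * cnj (vec_index v i)))"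
    by (rule sum.swap)
  also have "\<dots> = (\<Sum>j<m. vec_index u j * cnj (vec_index u j))"
    by (rule sum.cong) (simp_all add: u_j sum_distrib_left)
  finally have eq: "l * (\<Sum>i<k. vec_index v i * cnj (vec_index v i)) = complex_of_real (1 / real N) * (\<Sum>j<m. vec_index u j * cnj (vec_index u j))" .
  have sq: "(\<Sum>i\<in>S. vec_index a i * cnj (vec_index a i)) = complex_of_real (\<Sum>i\<in>S. (cmod (vec_index a i))^2)" for S and a :: "complex vec"
    by (simp add: complex_norm_square[symmetric] del: of_real_power)
  have "l * complex_of_real (\<Sum>i<k. (cmod (vec_index v i))^2) = complex_of_real (1 / real N * (\<Sum>j<m. (cmod (vec_index u j))^2))"
    using eq unfolding sq by simp
  from arg_cong[OF this, of Re]
  have "Re l * (\<Sum>i<k. (cmod (vec_index v i))^2) = 1 / real N * (\<Sum>j<m. (cmod (vec_index u j))^2)" by simp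
  moreover have "0 \<le> 1 / real N * (\<Sum>j<m. (cmod (vec_index u j))^2)" by (simp add: sum_nonneg)
  moreover have "0 < (\<Sum>i<k. (cmod (vec_index v i))^2)"
  proof -
    obtain i where "i < k" "vec_index v i \<noteq> 0" using v by (metis carrier_vecD eq_vecI index_zero_vec(1) index_zero_vec(2))
    then show ?thesis by (intro sum_pos2[of _ i]) auto
  qed
  ultimately show ?thesis by (metis mult_le_0_iff linorder_not_le mult_neg_pos)
qed

lemma distribution_functionD:
  assumes "distribution_function F"
  shows "x \<le> y \<Longrightarrow> F x \<le> F y" "continuous (at_right x) F" "(F \<longlongrightarrow> 0) at_bot" "(F \<longlongrightarrow> 1) at_top"
  using assms by (auto simp: distribution_function_def dest: monoD)

lemma real_distribution_of_distribution_function: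
  assumes "distribution_function F"
  shows "real_distribution (interval_measure F)" "cdf (interval_measure F) = F"
  using distribution_functionD[OF assms]
  by (auto intro!: real_distribution_interval_measure cdf_interval_measure)

lemma distribution_function_nonneg: "distribution_function F \<Longrightarrow> 0 \<le> F x"
  using tendsto_upperbound[OF distribution_functionD(3), of F "F x"] distribution_functionD(1)[of F]
  by (auto simp: eventually_at_bot_linorder)

text \<open>Weak convergence only speaks about continuity points; these are dense, and \<open>F\<close> is monotone.\<close>

lemma limit_distribution_nonneg:
  assumes "distribution_function F" and conv: "weak_conv (\<lambda>n. esd (gram (N n) (A n))) F" and x: "x < 0"
  shows "F x = 0"
proof -
  have mono: "mono F" using assms(1) by (simp add: distribution_function_def)
  have "\<exists>y. x < y \<and> y < 0 \<and> isCont F y"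
  proof -
    have "countable {a. \<not> isCont F a}" by (rule mono_ctble_discont[OF mono])
    moreover have "uncountable {x<..<0}" using x by (simp add: uncountable_open_interval)
    ultimately have "\<not> {x<..<0} \<subseteq> {a. \<not> isCont F a}" by (meson countable_subset)
    then show ?thesis by auto
  qed
  then obtain y where y: "x < y" "y < 0" "isCont F y" by blast
  have "esd (gram (N n) (A n)) y = 0" for n
  proof -
    have "{#l \<in># proots (char_poly (gram (N n) (A n))). Re l \<le> y#} = {#}"
      using Re_eigenvalue_gram y(2) by (force simp: filter_mset_eq_mempty_iff)
    then show ?thesis by (simp add: esd_def)
  qed
  then have "(\<lambda>_. 0) \<longlonglongrightarrow> F y" using conv y(3) by (auto simp: weak_conv_def)
  then have "F y = 0" by (simp add: LIMSEQ_const_iff)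
  then show ?thesis using monoD[OF mono less_imp_le[OF y(1)]] distribution_function_nonneg[OF assms(1), of x] by simp
qed

lemma AE_nonneg_interval_measure:
  assumes F: "distribution_function F" and neg: "\<And>x. x < 0 \<Longrightarrow> F x = 0"
  shows "AE l in interval_measure F. 0 \<le> l"
proof -
  have "{..- 1 / real (Suc n)} \<in> null_sets (interval_measure F)" for n
    using emeasure_interval_measure_Iic[of F "- 1 / real (Suc n)"] distribution_functionD[OF F] neg[of "- 1 / real (Suc n)"]
    by (intro null_setsI) auto
  then have "(\<Union>n. {..- 1 / real (Suc n)}) \<in> null_sets (interval_measure F)" by (intro null_sets_UN) auto
  moreover have "{l \<in> space (interval_measure F). \<not> 0 \<le> l} \<subseteq> (\<Union>n. {..- 1 / real (Suc n)})"
  proof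
    fix l :: real assume "l \<in> {l \<in> space (interval_measure F). \<not> 0 \<le> l}"
    then have "0 < - l" by auto
    then obtain n where "1 / real (Suc n) < - l" using nat_approx_posE by blast
    then show "l \<in> (\<Union>n. {..- 1 / real (Suc n)})" by (intro UN_I[of n]) auto
  qed
  ultimately show ?thesis by (rule AE_I'[rotated -1, rotated])
qed

section \<open>Stieltjes transforms of distribution functions\<close>

text \<open>The mixture \<open>(1 - c) I + c F\<close> is the law of a variable that is distributed according to \<open>F\<close> with
  probability \<open>c\<close> and is 0 otherwise; uniqueness of the measure with a given distribution function
  then transfers the integrals.\<close>

lemma stieltjes_lower_df:
  assumes F: "distribution_function F" and c: "0 \<le> c" "c \<le> 1" and z: "0 < Im z"
  shows "distribution_function (lower_df c F)"
    and "stieltjes (lower_df c F) z = - of_real (1 - c) / z + of_real c * stieltjes F z"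
proof -
  interpret F: real_distribution "interval_measure F" by (rule real_distribution_of_distribution_function[OF F])
  let ?B = "measure_pmf (bernoulli_pmf c)"
  let ?\<nu> = "distr (?B \<Otimes>\<^sub>M interval_measure F) borel (\<lambda>(b, l). if b then l else (0::real))"
  interpret B: pair_prob_space ?B "interval_measure F" ..
  have meas[measurable]: "(\<lambda>(b, l). if b then l else (0::real)) \<in> borel_measurable (?B \<Otimes>\<^sub>M interval_measure F)"
    by measurable
  have int: "(\<integral>l. h l \<partial>?\<nu>) = c *\<^sub>R (\<integral>l. h l \<partial>interval_measure F) + (1 - c) *\<^sub>R h 0"
    if [measurable]: "h \<in> borel_measurable borel" and b: "\<And>l. norm (h l) \<le> K" for h :: "real \<Rightarrow> complex" and K
  proof -
    have i: "integrable (?B \<Otimes>\<^sub>M interval_measure F) (\<lambda>p. h (case p of (b, l) \<Rightarrow> if b then l else 0))"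
      by (rule B.integrable_const_bound[where B=K]) (use b in auto)
    have "(\<integral>l. h l \<partial>?\<nu>) = (\<integral>p. h (case p of (b, l) \<Rightarrow> if b then l else 0) \<partial>(?B \<Otimes>\<^sub>M interval_measure F))"
      by (rule integral_distr) measurable
    also have "\<dots> = (\<integral>b. (\<integral>l. h (if b then l else 0) \<partial>interval_measure F) \<partial>?B)"
      using B.integral_fst'[OF i] by simp
    also have "\<dots> = (\<Sum>b\<in>UNIV. pmf (bernoulli_pmf c) b *\<^sub>R (\<integral>l. h (if b then l else 0) \<partial>interval_measure F))"
      by (rule integral_measure_pmf) auto
    also have "\<dots> = c *\<^sub>R (\<integral>l. h l \<partial>interval_measure F) + (1 - c) *\<^sub>R h 0"
      using c F.prob_space by (simp add: UNIV_bool)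
    finally show ?thesis .
  qed
  have \<nu>: "real_distribution ?\<nu>"
    unfolding real_distribution_def real_distribution_axioms_def using B.prob_space_distr[OF meas] by simp
  interpret N: real_distribution ?\<nu> by (rule \<nu>)
  have cdf: "cdf ?\<nu> = lower_df c F"
  proof
    fix x
    let ?h = "\<lambda>l::real. complex_of_real (indicator {..x} l)"
    have "complex_of_real (measure ?\<nu> {..x}) = (\<integral>l. ?h l \<partial>?\<nu>)" by simp
    also have "\<dots> = c *\<^sub>R (\<integral>l. ?h l \<partial>interval_measure F) + (1 - c) *\<^sub>R ?h 0"
      by (rule int) (auto simp: indicator_def)
    also have "(\<integral>l. ?h l \<partial>interval_measure F) = complex_of_real (measure (interval_measure F) {..x})"
      by simp
    also have "measure (interval_measure F) {..x} = F x"
      using real_distribution_of_distribution_function(2)[OF F] by (metis cdf_def)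
    finally have "complex_of_real (measure ?\<nu> {..x}) = complex_of_real (lower_df c F x)"
      by (simp add: lower_df_def scaleR_conv_of_real indicator_def)
    then show "cdf ?\<nu> x = lower_df c F x" unfolding cdf_def of_real_eq_iff .
  qed
  show L: "distribution_function (lower_df c F)"
    unfolding distribution_function_def cdf[symmetric]
    using N.cdf_nondecreasing N.cdf_is_right_cont N.cdf_lim_at_bot N.cdf_lim_at_top_prob by (auto intro: monoI)
  have eq: "interval_measure (lower_df c F) = ?\<nu>"
    by (rule cdf_unique[OF real_distribution_of_distribution_function(1)[OF L] \<nu>])
      (simp only: real_distribution_of_distribution_function(2)[OF L] cdf)
  have "stieltjes (lower_df c F) z = c *\<^sub>R stieltjes F z + (1 - c) *\<^sub>R (1 / (complex_of_real 0 - z))"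
    unfolding stieltjes_def eq
  proof (rule int)
    fix l :: real
    have "Im z \<le> cmod (complex_of_real l - z)" using abs_Im_le_cmod[of "complex_of_real l - z"] by simp
    then show "cmod (1 / (complex_of_real l - z)) \<le> 1 / Im z" using z by (simp add: norm_divide frac_le)
  qed measurable
  then show "stieltjes (lower_df c F) z = - of_real (1 - c) / z + of_real c * stieltjes F z"
    by (simp add: scaleR_conv_of_real diff_divide_distrib)
qed

lemma stieltjes_integrable:
  assumes F: "distribution_function F" and z: "0 < Im z"
  shows "integrable (interval_measure F) (\<lambda>l. 1 / (complex_of_real l - z))"
proof -
  interpret F: real_distribution "interval_measure F" by (rule real_distribution_of_distribution_function[OF F])
  have "cmod (1 / (complex_of_real l - z)) \<le> 1 / Im z" for l
  proof -
    have "Im z \<le> cmod (complex_of_real l - z)" using abs_Im_le_cmod[of "complex_of_real l - z"] by simp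
    then show ?thesis using z by (simp add: norm_divide frac_le)
  qed
  then show ?thesis by (intro F.integrable_const_bound[where B="1 / Im z"]) auto
qed

lemma Im_csqrt_pos: "0 < Im z \<Longrightarrow> 0 < Im (csqrt z)"
  using Im_csqrt_eq_0_iff[of z] complex_Re_le_cmod[of z] by (auto simp: complex_nonneg_Reals_iff order_less_le)

text \<open>The map \<open>w \<mapsto> w * m (w^2)\<close> is the Stieltjes transform of the symmetrised law of the square roots. The
  numerator of \<open>Im (w / (l - w^2))\<close> is \<open>(l + |w|^2) Im w\<close>, positive because \<open>l \<ge> 0\<close>.\<close>

lemma Im_csqrt_stieltjes_pos:
  assumes F: "distribution_function F" and neg: "\<And>x. x < 0 \<Longrightarrow> F x = 0" and z: "0 < Im z"
  shows "0 < Im (csqrt z * stieltjes F z)"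
proof -
  interpret F: real_distribution "interval_measure F" by (rule real_distribution_of_distribution_function[OF F])
  define w where "w = csqrt z"
  have w: "0 < Im w" "w * w = z" using Im_csqrt_pos[OF z] by (auto simp: w_def power2_eq_square[symmetric])
  note i = integrable_mult_right[OF stieltjes_integrable[OF F z], of w]
  have Imk: "0 < Im (w * (1 / (complex_of_real l - z)))" if "0 \<le> l" for l
  proof -
    define q where "q = complex_of_real l - z"
    have q: "q \<noteq> 0" using z by (auto simp: q_def complex_eq_iff)
    have "Im (w / q) = Im (w * cnj q) / (cmod q)^2" by (simp add: Im_divide cmod_power2)
    also have "w * cnj q = complex_of_real l * w - complex_of_real ((cmod w)^2) * cnj w"
      unfolding q_def w(2)[symmetric] complex_norm_square by (simp add: algebra_simps)
    also have "Im \<dots> = (l + (cmod w)^2) * Im w" by (simp add: algebra_simps)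
    finally have "Im (w / q) = (l + (cmod w)^2) * Im w / (cmod q)^2" .
    moreover have "0 < (cmod w)^2" using w by auto
    ultimately show ?thesis using that w q by (simp add: q_def add_nonneg_pos)
  qed
  have nn: "AE l in interval_measure F. 0 < Im (w * (1 / (complex_of_real l - z)))"
  proof -
    have "AE l in interval_measure F. 0 \<le> l" by (rule AE_nonneg_interval_measure[OF F]) (rule neg)
    then show ?thesis by eventually_elim (rule Imk)
  qed
  have nn0: "AE l in interval_measure F. 0 \<le> Im (w * (1 / (complex_of_real l - z)))"
    using nn by eventually_elim (rule less_imp_le)
  have eq: "Im (w * stieltjes F z) = (\<integral>l. Im (w * (1 / (complex_of_real l - z))) \<partial>interval_measure F)"
    unfolding stieltjes_def integral_Im[OF i] by (simp only: integral_mult_right_zero)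
  have "(\<integral>l. Im (w * (1 / (complex_of_real l - z))) \<partial>interval_measure F) \<noteq> 0"
  proof
    assume "(\<integral>l. Im (w * (1 / (complex_of_real l - z))) \<partial>interval_measure F) = 0"
    then have "AE l in interval_measure F. Im (w * (1 / (complex_of_real l - z))) = 0"
      using integral_nonneg_eq_0_iff_AE[OF integrable_Im[OF i] nn0] by simp
    with nn have "AE l in interval_measure F. False" by eventually_elim simp
    then show False by (simp add: F.AE_False)
  qed
  then show ?thesis unfolding w_def[symmetric] eq using integral_nonneg_AE[OF nn0] by linarith
qed

lemma stieltjes_continuous:
  assumes F: "distribution_function F" and d: "0 < d"
    and far: "AE l in interval_measure F. \<forall>z\<in>U. d \<le> cmod (complex_of_real l - z)"
  shows "continuous_on U (stieltjes F)"
proof (unfold continuous_on_sequentially, intro ballI allI impI, elim conjE)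
  interpret F: real_distribution "interval_measure F" by (rule real_distribution_of_distribution_function[OF F])
  fix z z0 assume z0: "z0 \<in> U" and z: "\<forall>n::nat. z n \<in> U" and lim: "z \<longlonglongrightarrow> z0"
  show "(stieltjes F \<circ> z) \<longlonglongrightarrow> stieltjes F z0"
    unfolding o_def stieltjes_def
  proof (rule integral_dominated_convergence[where w="\<lambda>_. 1 / d"])
    show "AE l in interval_measure F. (\<lambda>n. 1 / (complex_of_real l - z n)) \<longlonglongrightarrow> 1 / (complex_of_real l - z0)"
      using far
    proof eventually_elim
      case (elim l)
      then have "complex_of_real l - z0 \<noteq> 0" using z0 d by auto
      then show ?case by (intro tendsto_intros lim)
    qed
    show "AE l in interval_measure F. norm (1 / (complex_of_real l - z n)) \<le> 1 / d" for n
      using far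
    proof eventually_elim
      case (elim l)
      then have "d \<le> cmod (complex_of_real l - z n)" using z by blast
      then show ?case using d by (simp add: norm_divide frac_le)
    qed
  qed simp_all
qed

lemma stieltjes_continuous_upper:
  assumes F: "distribution_function F"
  shows "continuous_on \<complex>\<^sup>+ (stieltjes F)"
proof (rule continuous_at_imp_continuous_on, rule ballI)
  fix z assume z: "z \<in> \<complex>\<^sup>+"
  have "continuous_on {u. Im z / 2 < Im u} (stieltjes F)"
  proof (rule stieltjes_continuous[OF F, of "Im z / 2"])
    show "AE l in interval_measure F. \<forall>u\<in>{u. Im z / 2 < Im u}. Im z / 2 \<le> cmod (complex_of_real l - u)"
    proof (intro always_eventually allI ballI)
      fix l u assume "u \<in> {u. Im z / 2 < Im u}"
      then show "Im z / 2 \<le> cmod (complex_of_real l - u)" using abs_Im_le_cmod[of "complex_of_real l - u"] by simp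
    qed
  qed (use z in simp)
  then show "isCont (stieltjes F) z"
    using z by (subst (asm) continuous_on_eq_continuous_at[OF open_halfspace_Im_gt]) auto
qed

section \<open>Stieltjes inversion\<close>

lemma at_within_upper_nontrivial: "at (complex_of_real x) within \<complex>\<^sup>+ \<noteq> bot"
proof -
  have "complex_of_real x islimpt \<complex>\<^sup>+"
    unfolding islimpt_approachable
  proof (intro allI impI)
    fix e :: real assume "e > 0"
    then show "\<exists>z\<in>\<complex>\<^sup>+. z \<noteq> complex_of_real x \<and> dist z (complex_of_real x) < e"
      by (intro bexI[of _ "Complex x (e / 2)"]) (auto simp: dist_norm cmod_def complex_eq_iff)
  qed
  then show ?thesis by (simp add: trivial_limit_within)
qed

lemma boundary_extension_continuous:
  fixes f :: "complex \<Rightarrow> complex" and m :: "real \<Rightarrow> complex"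
  assumes f: "continuous_on \<complex>\<^sup>+ f"
    and lim: "\<And>x. x \<in> A \<Longrightarrow> (f \<longlongrightarrow> m x) (at (of_real x) within \<complex>\<^sup>+)"
  shows "continuous_on {z. 0 < Im z \<or> Im z = 0 \<and> Re z \<in> A} (\<lambda>z. if 0 < Im z then f z else m (Re z))"
    (is "continuous_on ?D ?h")
proof (unfold continuous_on_def, rule ballI)
  fix z0 assume z0: "z0 \<in> ?D"
  show "(?h \<longlongrightarrow> ?h z0) (at z0 within ?D)"
  proof (cases "0 < Im z0")
    case True
    have "isCont f z0"
      using f True by (subst (asm) continuous_on_eq_continuous_at[OF open_halfspace_Im_gt[of 0]]) auto
    then have "(f \<longlongrightarrow> f z0) (at z0 within ?D)"
      by (simp add: isCont_def tendsto_within_subset[of _ _ _ UNIV])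
    moreover have "\<forall>\<^sub>F z in at z0 within ?D. f z = ?h z"
    proof -
      have "\<forall>\<^sub>F z in at z0. z \<in> {u. 0 < Im u}"
        using True by (intro eventually_at_topological[THEN iffD2] exI[of _ "{u. 0 < Im u}"]) (auto simp: open_halfspace_Im_gt)
      then have "\<forall>\<^sub>F z in at z0 within ?D. z \<in> {u. 0 < Im u}" by (rule filter_leD[OF at_le, rotated]) simp
      then show ?thesis by eventually_elim simp
    qed
    ultimately show ?thesis using True by (simp add: Lim_transform_eventually)
  next
    case False
    define x where "x = Re z0"
    have x: "x \<in> A" "z0 = complex_of_real x" using False z0 by (auto simp: x_def complex_eq_iff)
    have hz0: "?h z0 = m x" using False by (simp add: x_def)
    show ?thesis
    proof (rule tendstoI)
      fix e :: real assume e: "e > 0"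
      have "\<forall>\<^sub>F z in at (of_real x) within \<complex>\<^sup>+. dist (f z) (m x) < e / 2"
        by (rule tendstoD[OF lim[OF x(1)]]) (use e in simp)
      then obtain d where d: "d > 0" and near: "\<And>z. 0 < Im z \<Longrightarrow> z \<noteq> of_real x \<Longrightarrow> dist z (of_real x) < d \<Longrightarrow> dist (f z) (m x) < e / 2"
        unfolding eventually_at by auto
      have near2: "dist (m y) (m x) \<le> e / 2" if y: "y \<in> A" "dist (complex_of_real y) (of_real x) < d" for y
      proof (rule tendsto_upperbound[OF _ _ at_within_upper_nontrivial[of y]])
        show "((\<lambda>z. dist (f z) (m x)) \<longlongrightarrow> dist (m y) (m x)) (at (of_real y) within \<complex>\<^sup>+)"
          by (intro tendsto_intros lim y)
        have "\<forall>\<^sub>F z in at (complex_of_real y). z \<in> ball (of_real x) d"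
          using y by (intro eventually_at_topological[THEN iffD2] exI[of _ "ball (of_real x) d"]) (auto simp: dist_commute)
        then have 1: "\<forall>\<^sub>F z in at (complex_of_real y) within \<complex>\<^sup>+. z \<in> ball (of_real x) d"
          by (rule filter_leD[OF at_le, rotated]) simp
        have 2: "\<forall>\<^sub>F z in at (complex_of_real y) within \<complex>\<^sup>+. z \<in> \<complex>\<^sup>+"
          by (simp add: eventually_at_filter)
        show "\<forall>\<^sub>F z in at (complex_of_real y) within \<complex>\<^sup>+. dist (f z) (m x) \<le> e / 2"
          using 1 2
        proof eventually_elim
          case (elim z)
          then have "z \<noteq> of_real x" by auto
          then show ?case using near[of z] elim by (auto simp: dist_commute intro: less_imp_le)
        qed
      qed
      show "\<forall>\<^sub>F z in at z0 within ?D. dist (?h z) (?h z0) < e"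
        unfolding eventually_at
      proof (intro exI[of _ d] conjI d ballI impI)
        fix z assume z: "z \<in> ?D" "z \<noteq> z0 \<and> dist z z0 < d"
        show "dist (?h z) (?h z0) < e"
          unfolding hz0
        proof (cases "0 < Im z")
          case True
          moreover have "z \<noteq> of_real x" using True by auto
          moreover have "dist z (of_real x) < d" using z x by blast
          ultimately have "dist (f z) (m x) < e / 2" by (intro near)
          then show "dist (?h z) (m x) < e" using True e by simp
        next
          case False
          then have zr: "complex_of_real (Re z) = z" "Re z \<in> A" using z(1) by (auto simp: complex_eq_iff)
          have "dist (m (Re z)) (m x) \<le> e / 2"
            by (rule near2[OF zr(2)]) (unfold zr(1), use z x in blast)
          then show "dist (?h z) (m x) < e" using False e by simp
        qed
      qed
    qed
  qed
qed

lemma tendsto_vertical: "(\<lambda>n. Complex x (1 / real (Suc n))) \<longlonglongrightarrow> complex_of_real x"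
proof -
  have "(\<lambda>n. Complex x (1 / real (Suc n))) \<longlonglongrightarrow> Complex x 0"
    by (intro tendsto_Complex tendsto_const LIMSEQ_Suc[OF lim_inverse_n'])
  then show ?thesis by (simp add: complex_of_real_def)
qed

lemma filterlim_vertical:
  "filterlim (\<lambda>n. Complex x (1 / real (Suc n))) (at (complex_of_real x) within \<complex>\<^sup>+) sequentially"
  using tendsto_vertical[of x] by (auto simp: filterlim_at complex_eq_iff)

lemma Im_Poisson_kernel:
  assumes y: "0 < y"
  shows "Im (1 / (complex_of_real l - Complex t y)) = y / ((t - l)^2 + y^2)"
  by (simp add: Im_divide power2_commute[of t l])

text \<open>An atom at \<open>x\<close> would make \<open>Im (stieltjes F (x + i y))\<close> at least of order \<open>1 / y\<close>.\<close>

lemma no_atom_of_boundary_limit: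
  assumes F: "distribution_function F"
    and lim: "(stieltjes F \<longlongrightarrow> m) (at (complex_of_real x) within \<complex>\<^sup>+)"
  shows "measure (interval_measure F) {x} = 0"
proof -
  interpret F: real_distribution "interval_measure F" by (rule real_distribution_of_distribution_function[OF F])
  let ?y = "\<lambda>n. 1 / real (Suc n)"
  let ?z = "\<lambda>n. Complex x (?y n)"
  have le: "measure (interval_measure F) {x} \<le> ?y n * Im (stieltjes F (?z n))" for n
  proof -
    have y: "0 < ?y n" by simp
    have i: "integrable (interval_measure F) (\<lambda>l. 1 / (complex_of_real l - ?z n))"
      by (rule stieltjes_integrable[OF F]) simp
    have "measure (interval_measure F) {x} = (\<integral>l. indicator {x} l \<partial>interval_measure F)" by simp
    also have "\<dots> \<le> (\<integral>l. ?y n * Im (1 / (complex_of_real l - ?z n)) \<partial>interval_measure F)"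
    proof (rule integral_mono)
      show "integrable (interval_measure F) (\<lambda>l. ?y n * Im (1 / (complex_of_real l - ?z n)))"
        by (intro integrable_mult_right integrable_Im i)
      show "indicator {x} l \<le> ?y n * Im (1 / (complex_of_real l - ?z n))" for l
        unfolding Im_Poisson_kernel[OF y] using y by (auto simp: indicator_def power2_eq_square)
      show "integrable (interval_measure F) (indicator {x} :: real \<Rightarrow> real)"
        by (rule F.integrable_const_bound[where B=1]) (auto simp: indicator_def)
    qed
    also have "\<dots> = ?y n * Im (stieltjes F (?z n))"
      unfolding stieltjes_def integral_Im[OF i, symmetric] by simp
    finally show ?thesis .
  qed
  have "(\<lambda>n. ?y n * Im (stieltjes F (?z n))) \<longlonglongrightarrow> 0 * Im m"
    by (intro tendsto_mult LIMSEQ_Suc[OF lim_inverse_n'] tendsto_Im filterlim_compose[OF lim filterlim_vertical])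
  then have "measure (interval_measure F) {x} \<le> 0 * Im m"
    by (rule LIMSEQ_le_const) (use le in auto)
  then show ?thesis using measure_nonneg[of "interval_measure F" "{x}"] by simp
qed

lemma integral_Im_stieltjes:
  assumes F: "distribution_function F" and ab: "a \<le> b" and y: "0 < y"
  shows "integral {a..b} (\<lambda>t. Im (stieltjes F (Complex t y)))
    = (\<integral>l. arctan ((b - l) / y) - arctan ((a - l) / y) \<partial>interval_measure F)"
proof -
  interpret F: real_distribution "interval_measure F" by (rule real_distribution_of_distribution_function[OF F])
  interpret P: pair_sigma_finite lborel "interval_measure F" ..
  define k where "k t l = y / ((t - l)^2 + y^2)" for t l
  have pos: "0 < (t - l)^2 + y^2" for t l using y by (simp add: add_nonneg_pos)
  have k: "0 \<le> k t l" "k t l \<le> 1 / y" for t l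
  proof -
    show "0 \<le> k t l" using y by (simp add: k_def)
    have "y / ((t - l)^2 + y^2) \<le> y / y^2" using y by (intro divide_left_mono) (auto simp: add_nonneg_pos)
    then show "k t l \<le> 1 / y" using y by (simp add: k_def power2_eq_square)
  qed
  have [measurable]: "(\<lambda>p. k (fst p) (snd p)) \<in> borel_measurable (lborel \<Otimes>\<^sub>M interval_measure F)"
    unfolding k_def by measurable
  have ki: "integrable (interval_measure F) (k t)" for t
  proof (rule F.integrable_const_bound[where B="1 / y"])
    show "AE l in interval_measure F. norm (k t l) \<le> 1 / y" using k by simp
    show "k t \<in> borel_measurable (interval_measure F)" unfolding k_def by measurable
  qed
  have S: "Im (stieltjes F (Complex t y)) = (\<integral>l. k t l \<partial>interval_measure F)" for t
  proof -
    have i: "integrable (interval_measure F) (\<lambda>l. 1 / (complex_of_real l - Complex t y))"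
      by (rule stieltjes_integrable[OF F]) (simp add: y)
    show ?thesis
      unfolding stieltjes_def integral_Im[OF i, symmetric] Im_Poisson_kernel[OF y] k_def ..
  qed
  have cont: "continuous_on {a..b} (\<lambda>t. Im (stieltjes F (Complex t y)))"
    by (intro continuous_intros continuous_on_compose2[OF stieltjes_continuous_upper[OF F]])
      (use y in \<open>auto simp: Complex_eq intro!: continuous_intros\<close>)
  have si: "set_integrable lborel {a..b} (\<lambda>t. Im (stieltjes F (Complex t y)))"
    by (rule borel_integrable_atLeastAtMost'[OF cont])
  define f where "f t l = indicator {a..b} t * k t l" for t l
  have fi: "integrable (lborel \<Otimes>\<^sub>M interval_measure F) (case_prod f)"
  proof (rule P.Fubini_integrable)
    show "case_prod f \<in> borel_measurable (lborel \<Otimes>\<^sub>M interval_measure F)"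
      unfolding f_def split_beta by measurable
    have "(\<lambda>t. \<integral>l. norm (case (t, l) of (x, y) \<Rightarrow> f x y) \<partial>interval_measure F)
        = (\<lambda>t. indicator {a..b} t *\<^sub>R Im (stieltjes F (Complex t y)))"
      unfolding S f_def using k by (simp add: abs_mult fun_eq_iff)
    then show "integrable lborel (\<lambda>t. \<integral>l. norm (case (t, l) of (x, y) \<Rightarrow> f x y) \<partial>interval_measure F)"
      using si by (simp add: set_integrable_def)
    show "AE t in lborel. integrable (interval_measure F) (\<lambda>l. case (t, l) of (x, y) \<Rightarrow> f x y)"
      using ki by (simp add: f_def)
  qed
  have "integral {a..b} (\<lambda>t. Im (stieltjes F (Complex t y))) = (LINT t : {a..b} | lborel. Im (stieltjes F (Complex t y)))"
    by (rule set_borel_integral_eq_integral(2)[OF si, symmetric])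
  also have "\<dots> = (\<integral>t. (\<integral>l. f t l \<partial>interval_measure F) \<partial>lborel)"
    unfolding set_lebesgue_integral_def S f_def by simp
  also have "\<dots> = (\<integral>l. (\<integral>t. f t l \<partial>lborel) \<partial>interval_measure F)"
    by (rule P.Fubini_integral[OF fi, symmetric])
  also have "(\<lambda>l. \<integral>t. f t l \<partial>lborel) = (\<lambda>l. arctan ((b - l) / y) - arctan ((a - l) / y))"
  proof
    fix l
    have "(\<integral>t. k t l * indicator {a..b} t \<partial>lborel) = arctan ((b - l) / y) - arctan ((a - l) / y)"
    proof (rule integral_FTC_Icc_real[OF ab])
      fix t
      have "((\<lambda>t. arctan ((t - l) / y)) has_real_derivative inverse (1 + ((t - l) / y)^2) * (1 / y)) (at t)"
        by (rule DERIV_chain2[OF DERIV_arctan]) (use y in \<open>auto intro!: derivative_eq_intros\<close>)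
      moreover have "inverse (1 + ((t - l) / y)^2) * (1 / y) = k t l"
      proof -
        have "1 + ((t - l) / y)^2 = ((t - l)^2 + y^2) / y^2" using y by (simp add: power_divide field_simps)
        then show ?thesis using y by (simp add: k_def power2_eq_square)
      qed
      ultimately show "((\<lambda>t. arctan ((t - l) / y)) has_real_derivative k t l) (at t)" by simp
      show "isCont (\<lambda>t. k t l) t"
        unfolding k_def using pos[of t l] by (intro continuous_intros) auto
    qed
    then show "(\<integral>t. f t l \<partial>lborel) = arctan ((b - l) / y) - arctan ((a - l) / y)"
      by (simp add: f_def mult.commute)
  qed
  finally show ?thesis .
qed

text \<open>As \<open>y\<close> decreases to 0, the integrated Poisson kernel converges to \<open>pi\<close> times the indicator of the interval
  away from its endpoints, which carry no mass; on the other side the boundary values are attained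
  uniformly on \<open>[a, b]\<close>.\<close>

lemma stieltjes_inversion:
  assumes F: "distribution_function F" and ab: "a < b"
    and lim: "\<And>x. x \<in> {a..b} \<Longrightarrow> (stieltjes F \<longlongrightarrow> m x) (at (of_real x) within \<complex>\<^sup>+)"
  shows "F b - F a = 1 / pi * integral {a..b} (\<lambda>t. Im (m t))"
proof -
  interpret F: real_distribution "interval_measure F" by (rule real_distribution_of_distribution_function[OF F])
  let ?y = "\<lambda>n. 1 / real (Suc n)"
  define h where "h z = (if 0 < Im z then stieltjes F z else m (Re z))" for z
  have hc: "continuous_on {z. 0 < Im z \<or> Im z = 0 \<and> Re z \<in> {a..b}} h"
    unfolding h_def[abs_def] by (rule boundary_extension_continuous[OF stieltjes_continuous_upper[OF F] lim])
  have "continuous_on ({0..1} \<times> cbox a b) (\<lambda>(y, t). Im (h (Complex t y)))"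
    unfolding split_beta
    by (intro continuous_intros continuous_on_compose2[OF hc])
      (auto simp: Complex_eq less_eq_real_def intro!: continuous_intros)
  then have "continuous_on {0..1} (\<lambda>y. integral (cbox a b) (\<lambda>t. Im (h (Complex t y))))"
    by (rule integral_continuous_on_param)
  then have "(\<lambda>n. integral (cbox a b) (\<lambda>t. Im (h (Complex t (?y n))))) \<longlonglongrightarrow> integral (cbox a b) (\<lambda>t. Im (h (Complex t 0)))"
    by (rule continuous_on_tendsto_compose[OF _ LIMSEQ_Suc[OF lim_inverse_n']]) auto
  then have 1: "(\<lambda>n. integral {a..b} (\<lambda>t. Im (stieltjes F (Complex t (?y n))))) \<longlonglongrightarrow> integral {a..b} (\<lambda>t. Im (m t))"
    by (simp add: h_def)
  have arct: "(\<lambda>n. arctan (u / ?y n)) \<longlonglongrightarrow> sgn u * (pi / 2)" for u :: real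
  proof -
    have "filterlim (\<lambda>n. real (Suc n)) at_top sequentially" by (rule filterlim_compose[OF filterlim_real_sequentially filterlim_Suc])
    note s = this
    consider "u = 0" | "0 < u" | "u < 0" by linarith
    then show ?thesis
    proof cases
      case 2
      have "filterlim (\<lambda>n. u * real (Suc n)) at_top sequentially"
        by (rule filterlim_tendsto_pos_mult_at_top[OF tendsto_const 2 s])
      from filterlim_compose[OF tendsto_arctan_at_top this] show ?thesis using 2 by simp
    next
      case 3
      have "filterlim (\<lambda>n. u * real (Suc n)) at_bot sequentially"
        by (rule filterlim_tendsto_neg_mult_at_bot[OF tendsto_const 3 s])
      from filterlim_compose[OF tendsto_arctan_at_bot this] show ?thesis using 3 by simp
    qed simp
  qed
  have atom: "AE l in interval_measure F. l \<noteq> x" if x: "x \<in> {a..b}" for x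
  proof (rule AE_I'[where N="{x}"])
    show "{x} \<in> null_sets (interval_measure F)"
      using no_atom_of_boundary_limit[OF F lim[OF x]] by (simp add: null_sets_def F.emeasure_eq_measure)
  qed auto
  have atoms: "AE l in interval_measure F. l \<noteq> a" "AE l in interval_measure F. l \<noteq> b"
    using ab by (auto intro!: atom)
  have "(\<lambda>n. \<integral>l. arctan ((b - l) / ?y n) - arctan ((a - l) / ?y n) \<partial>interval_measure F)
      \<longlonglongrightarrow> (\<integral>l. pi * indicator {a<..b} l \<partial>interval_measure F)"
  proof (rule integral_dominated_convergence[where w="\<lambda>_. pi"])
    show "AE l in interval_measure F. (\<lambda>n. arctan ((b - l) / ?y n) - arctan ((a - l) / ?y n)) \<longlonglongrightarrow> pi * indicator {a<..b} l"
      using atoms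
    proof eventually_elim
      case (elim l)
      have "(\<lambda>n. arctan ((b - l) / ?y n) - arctan ((a - l) / ?y n)) \<longlonglongrightarrow> sgn (b - l) * (pi / 2) - sgn (a - l) * (pi / 2)"
        by (intro tendsto_diff arct)
      also have "sgn (b - l) * (pi / 2) - sgn (a - l) * (pi / 2) = pi * indicator {a<..b} l"
      proof -
        consider "l < a" | "a < l" "l < b" | "b < l" using elim by linarith
        then show ?thesis using ab by cases simp_all
      qed
      finally show ?case .
    qed
    show "AE l in interval_measure F. norm (arctan ((b - l) / ?y n) - arctan ((a - l) / ?y n)) \<le> pi" for n
    proof (rule always_eventually, rule allI)
      fix l
      show "norm (arctan ((b - l) / ?y n) - arctan ((a - l) / ?y n)) \<le> pi"
        using arctan_bounded[of "(b - l) / ?y n"] arctan_bounded[of "(a - l) / ?y n"] unfolding real_norm_def by linarith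
    qed
  qed auto
  moreover have "(\<integral>l. pi * indicator {a<..b} l \<partial>interval_measure F) = pi * (F b - F a)"
    using measure_interval_measure_Ioc[of a b F] distribution_functionD[OF F] ab by simp
  moreover have "(\<lambda>n. integral {a..b} (\<lambda>t. Im (stieltjes F (Complex t (?y n)))))
      = (\<lambda>n. \<integral>l. arctan ((b - l) / ?y n) - arctan ((a - l) / ?y n) \<partial>interval_measure F)"
    using integral_Im_stieltjes[OF F less_imp_le[OF ab]] by simp
  ultimately have eq: "integral {a..b} (\<lambda>t. Im (m t)) = pi * (F b - F a)"
    using LIMSEQ_unique[OF 1] by metis
  show ?thesis unfolding eq by simp
qed

lemma density_of_boundary_limit:
  assumes F: "distribution_function F" and A: "open A"
    and lim: "\<And>x. x \<in> A \<Longrightarrow> (stieltjes F \<longlongrightarrow> m x) (at (of_real x) within \<complex>\<^sup>+)"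
  shows "continuous_on A m" and "x \<in> A \<Longrightarrow> (F has_real_derivative 1 / pi * Im (m x)) (at x)"
proof -
  have "continuous_on A (\<lambda>x. (\<lambda>z. if 0 < Im z then stieltjes F z else m (Re z)) (complex_of_real x))"
    by (rule continuous_on_compose2[OF boundary_extension_continuous[OF stieltjes_continuous_upper[OF F] lim]])
      (auto intro!: continuous_intros)
  then show cont: "continuous_on A m" by simp
  assume x: "x \<in> A"
  then obtain e where e: "e > 0" "cball x e \<subseteq> A" using A open_contains_cball by blast
  define a b where "a = x - e" and "b = x + e"
  have ab: "{a..b} \<subseteq> A" "a < x" "x < b" using e by (auto simp: a_def b_def cball_def dist_real_def abs_le_iff subset_iff)
  have c: "continuous_on {a..b} (\<lambda>t. Im (m t))"
    by (intro continuous_intros continuous_on_subset[OF cont ab(1)])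
  have "((\<lambda>u. integral {a..u} (\<lambda>t. Im (m t))) has_real_derivative Im (m x)) (at x within {a..b})"
    by (rule integral_has_real_derivative[OF c]) (use ab in simp)
  then have d: "((\<lambda>u. integral {a..u} (\<lambda>t. Im (m t))) has_real_derivative Im (m x)) (at x)"
    using at_within_Icc_at[OF ab(2,3)] by simp
  have "((\<lambda>u. F a + 1 / pi * integral {a..u} (\<lambda>t. Im (m t))) has_real_derivative 0 + 1 / pi * Im (m x)) (at x)"
    by (intro DERIV_add DERIV_const DERIV_cmult d)
  then have "((\<lambda>u. F a + 1 / pi * integral {a..u} (\<lambda>t. Im (m t))) has_real_derivative 1 / pi * Im (m x)) (at x)" by simp
  then show "(F has_real_derivative 1 / pi * Im (m x)) (at x)"
  proof (rule has_field_derivative_transform_within_open[of _ _ _ "{a<..<b}"])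
    fix u assume u: "u \<in> {a<..<b}"
    have "F u - F a = 1 / pi * integral {a..u} (\<lambda>t. Im (m t))"
    proof (rule stieltjes_inversion[OF F])
      show "a < u" using u by simp
      fix x assume "x \<in> {a..u}"
      then have "x \<in> A" using u ab(1) by auto
      then show "(stieltjes F \<longlongrightarrow> m x) (at (of_real x) within \<complex>\<^sup>+)" by (rule lim)
    qed
    then show "F a + 1 / pi * integral {a..u} (\<lambda>t. Im (m t)) = F u" by linarith
  qed (use ab in auto)
qed

section \<open>Density of the limit law\<close>

lemma spectral_law_of_moments:
  assumes "prob_space H" and sets: "sets H = sets borel" and supp: "AE p in H. 0 \<le> fst p \<and> 0 \<le> snd p"
    and t: "(\<integral>\<^sup>+p. ennreal (snd p) \<partial>H) < \<infinity>" and inv: "(\<integral>\<^sup>+p. inverse (ennreal (snd p)) \<partial>H) < \<infinity>"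
    and c: "0 < c" "c \<le> 1"
  shows "spectral_law H c"
proof -
  interpret prob_space H by fact
  have [measurable]: "fst \<in> borel_measurable H" "snd \<in> borel_measurable H"
    by (simp_all add: measurable_cong_sets[OF sets refl] borel_measurable_continuous_onI continuous_on_fst continuous_on_snd)
  have t0: "AE p in H. 0 \<le> snd p" using supp by eventually_elim simp
  have "AE p in H. inverse (ennreal (snd p)) \<noteq> \<infinity>"
    using inv by (intro nn_integral_PInf_AE) auto
  then have t_pos: "AE p in H. 0 < snd p"
    using t0 by eventually_elim (auto simp: order_less_le)
  have "(\<integral>\<^sup>+p. ennreal (1 / snd p) \<partial>H) = (\<integral>\<^sup>+p. inverse (ennreal (snd p)) \<partial>H)"
  proof (rule nn_integral_cong_AE, use t_pos in eventually_elim)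
    fix p :: "real \<times> real" assume "0 < snd p"
    then show "ennreal (1 / snd p) = inverse (ennreal (snd p))" by (simp add: inverse_ennreal divide_inverse)
  qed
  then have i: "(\<integral>\<^sup>+p. ennreal (1 / snd p) \<partial>H) < \<infinity>" using inv by simp
  show ?thesis
  proof
    show "sets H = sets borel" "0 < c" "c \<le> 1" by fact+
    show "AE p in H. 0 \<le> fst p" using supp by eventually_elim simp
    show "AE p in H. 0 < snd p" by (rule t_pos)
    show "integrable H snd" by (rule integrableI_nonneg[OF _ t0 t]) measurable
    show "integrable H (\<lambda>p. 1 / snd p)"
      by (rule integrableI_nonneg[OF _ _ i]) (measurable, use t_pos in \<open>auto elim: eventually_mono\<close>)
  qed
qed

context spectral_law
begin

text \<open>With \<open>w^2 = z\<close> the denominator of the given equations is \<open>- w * Q\<close>. The default \<open>1 / 0 = 0\<close> makes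
  \<open>gl \<noteq> 0\<close> exclude \<open>1 + c g = 0\<close>.\<close>

lemma companion_solves:
  fixes z m g :: complex
  assumes z: "0 < Im z"
    and m: "has_bochner_integral H (\<lambda>p. 1 / denom c z m g p) m"
    and g: "has_bochner_integral H (\<lambda>p. of_real (snd p) / denom c z m g p) g"
    and gl: "gl = - 1 / (z * (1 + of_real c * g))" "gl \<noteq> 0"
  shows "solves (csqrt z) (csqrt z * (- of_real (1 - c) / z + of_real c * m)) (csqrt z * gl)"
proof -
  define w where "w = csqrt z"
  define k where "k = 1 + of_real c * g"
  define ml where "ml = - of_real (1 - c) / z + of_real c * m"
  have z0: "z \<noteq> 0" using z by auto
  have w: "w * w = z" by (simp add: w_def power2_eq_square[symmetric])
  have w0: "w \<noteq> 0" using z0 w by auto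
  have k0: "k \<noteq> 0" using gl by (auto simp: k_def)
  have glk: "gl = - 1 / (z * k)" using gl(1) by (simp only: k_def)
  have ik: "1 / k = - (z * gl)" unfolding glk using z0 k0 by simp
  have den: "denom c z m g p = - (w * (w + of_real (fst p) * (w * gl) + of_real (snd p) * (w * ml)))" for p
  proof -
    have zml: "z * ml = - of_real (1 - c) + of_real c * m * z"
      unfolding ml_def using z0 by (simp add: distrib_left)
    have "denom c z m g p = of_real (fst p) * (1 / k) - z - of_real (snd p) * (z * ml)"
      unfolding zml by (simp add: denom_def k_def split_beta algebra_simps)
    also have "\<dots> = - (z + of_real (fst p) * (z * gl) + of_real (snd p) * (z * ml))"
      unfolding ik by simp
    also have "z + of_real (fst p) * (z * gl) + of_real (snd p) * (z * ml)
        = w * (w + of_real (fst p) * (w * gl) + of_real (snd p) * (w * ml))"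
      unfolding w[symmetric] by (simp add: algebra_simps)
    finally show ?thesis .
  qed
  have res: "resolvent w (w * ml) (w * gl) p = - w * (1 / denom c z m g p)" for p
    unfolding den resolvent_def using w0 by (simp add: divide_inverse)
  have i1: "has_bochner_integral H (resolvent w (w * ml) (w * gl)) (- w * m)"
    unfolding res[abs_def] by (rule has_bochner_integral_mult_right[OF m])
  have "has_bochner_integral H (\<lambda>p. - w * (of_real (snd p) / denom c z m g p)) (- w * g)"
    by (rule has_bochner_integral_mult_right[OF g])
  then have i2: "has_bochner_integral H (\<lambda>p. of_real (snd p) * resolvent w (w * ml) (w * gl) p) (- w * g)"
    unfolding res by (simp add: ac_simps)
  have "w * ml = - of_real (1 - c) / w - of_real c * (- w * m)"
  proof -
    have "w / z = 1 / w" using w w0 z0 by (simp add: field_simps)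
    then have "w * (- of_real (1 - c) / z) = - of_real (1 - c) / w" by (metis times_divide_eq_right mult.commute mult.right_neutral times_divide_eq_left)
    then show ?thesis unfolding ml_def distrib_left by simp
  qed
  moreover have "- 1 / (w * gl) = w - of_real c * (- w * g)"
  proof -
    have "- 1 / (w * gl) = z * k / w" unfolding glk using z0 k0 w0 by simp
    also have "\<dots> = w * k" unfolding w[symmetric] using w0 by simp
    finally show ?thesis unfolding k_def by (simp add: algebra_simps)
  qed
  ultimately show ?thesis
    unfolding solves_def w_def[symmetric] ml_def[symmetric]
      has_bochner_integral_integral_eq[OF i1] has_bochner_integral_integral_eq[OF i2]
    using has_bochner_integral_iff[THEN iffD1, OF i1] has_bochner_integral_iff[THEN iffD1, OF i2] by blast
qed

end

text \<open>The Taylor coefficients are complex, but the increments \<open>y - x\<close> are real, so imaginary parts can be taken termwise.\<close>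

lemma real_analytic_Im_of_holomorphic:
  assumes h: "h holomorphic_on ball (of_real x) r" and r: "0 < r"
    and f: "\<And>y. \<bar>y - x\<bar> < r \<Longrightarrow> f y = a * Im (h (of_real y))"
  shows "real_analytic_at f x"
  unfolding real_analytic_at_def
proof (intro exI conjI allI impI)
  let ?c = "\<lambda>k. (deriv ^^ k) h (of_real x) / fact k"
  show "0 < r" by (rule r)
  fix y assume y: "\<bar>y - x\<bar> < r"
  then have "complex_of_real y \<in> ball (of_real x) r"
    by (simp add: dist_norm norm_minus_commute flip: of_real_diff)
  from holomorphic_power_series[OF h this]
  have "(\<lambda>k. Im (?c k * (of_real y - of_real x) ^ k)) sums Im (h (of_real y))" by (rule sums_Im)
  then have s: "(\<lambda>k. a * Im (?c k * (of_real y - of_real x) ^ k)) sums (a * Im (h (of_real y)))" by (rule sums_mult)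
  have eq: "a * Im (?c k * (of_real y - of_real x) ^ k) = a * Im (?c k) * (y - x) ^ k" for k
  proof -
    have pow: "(complex_of_real y - of_real x) ^ k = of_real ((y - x) ^ k)" by simp
    have im: "Im (u * complex_of_real v) = Im u * v" for u v by simp
    show ?thesis unfolding pow im by (simp only: mult.assoc)
  qed
  show "(\<lambda>k. a * Im (?c k) * (y - x) ^ k) sums f y" using s unfolding eq f[OF y] .
qed

theorem theorem3:
  fixes P :: "'w measure"
    and c :: real
    and N :: "nat \<Rightarrow> nat"
    and X :: "nat \<Rightarrow> nat \<Rightarrow> nat \<Rightarrow> 'w \<Rightarrow> complex"
    and R T :: "nat \<Rightarrow> complex mat"
    and s t :: "nat \<Rightarrow> nat \<Rightarrow> real"
    and H :: "(real \<times> real) measure"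
    and F :: "real \<Rightarrow> real"
    and g :: "complex \<Rightarrow> complex"
  assumes "0 < c" and "c \<le> 1"
    and "information_plus_noise P c N X R T s t H"
    and "distribution_function F"
    and "AE \<omega> in P. weak_conv (\<lambda>n. esd (info_noise_matrix N R T X n \<omega>)) F"
    and "companion c H (stieltjes F) g"
    and "(\<integral>\<^sup>+p. ennreal (snd p) \<partial>H) < \<infinity>"
    and "(\<integral>\<^sup>+p. inverse (ennreal (snd p)) \<partial>H) < \<infinity>"
    and "(\<integral>\<^sup>+p. ennreal (fst p) / ennreal (snd p) \<partial>H) \<le> ennreal (1 / c)"
  shows "\<exists>(m :: real \<Rightarrow> complex) (f :: real \<Rightarrow> real).
    (\<forall>x. x \<noteq> 0 \<longrightarrow>
       (stieltjes (lower_df c F) \<longlongrightarrow> m x) (at (complex_of_real x) within \<complex>\<^sup>+)) \<and>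
    continuous_on (- {0}) m \<and>
    (\<forall>x. x \<noteq> 0 \<longrightarrow> f x = 1 / pi * Im (m x)) \<and>
    (\<forall>x. x \<noteq> 0 \<longrightarrow> (lower_df c F has_real_derivative f x) (at x)) \<and>
    continuous_on (- {0}) f \<and>
    (\<forall>x>0. Im (m x) > 0 \<longrightarrow> real_analytic_at f x)"
proof -
  interpret model: information_plus_noise P c N X R T s t H by fact
  interpret spectral_law H c
    by (rule spectral_law_of_moments) (fact model.prob_H model.sets_H model.support_H assms)+
  note F = \<open>distribution_function F\<close>
  have F_neg: "F x = 0" if "x < 0" for x
  proof (rule ccontr)
    assume "F x \<noteq> 0"
    have "AE \<omega> in P. False"
      using \<open>AE \<omega> in P. weak_conv (\<lambda>n. esd (info_noise_matrix N R T X n \<omega>)) F\<close>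
    proof eventually_elim
      case (elim \<omega>)
      then have "F x = 0"
        unfolding info_noise_matrix_def by (rule limit_distribution_nonneg[OF F _ that])
      then show False using \<open>F x \<noteq> 0\<close> by simp
    qed
    then show False by (simp add: model.AE_False)
  qed
  define L where "L = lower_df c F"
  have c01: "0 \<le> c" "c \<le> 1" using assms(1,2) by auto
  have L: "distribution_function L"
    unfolding L_def by (rule stieltjes_lower_df(1)[OF F c01, of \<i>]) simp
  have SL: "stieltjes L z = - of_real (1 - c) / z + of_real c * stieltjes F z" if "0 < Im z" for z
    unfolding L_def by (rule stieltjes_lower_df(2)[OF F c01 that])
  have L_neg: "L x = 0" if "x < 0" for x
    using that F_neg by (simp add: L_def lower_df_def)
  obtain K where K: "distribution_function K" "\<And>x. x < 0 \<Longrightarrow> K x = 0"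
    and gl: "\<And>z. 0 < Im z \<Longrightarrow> - 1 / (z * (1 + of_real c * g z)) = stieltjes K z"
    and m_int: "\<And>z. 0 < Im z \<Longrightarrow> has_bochner_integral H (\<lambda>p. 1 / denom c z (stieltjes F z) (g z) p) (stieltjes F z)"
    and g_int: "\<And>z. 0 < Im z \<Longrightarrow> has_bochner_integral H (\<lambda>p. of_real (snd p) / denom c z (stieltjes F z) (g z) p) (g z)"
    using \<open>companion c H (stieltjes F) g\<close> unfolding companion_def by auto
  define M where "M z = csqrt z * stieltjes L z" for z
  define G where "G z = csqrt z * stieltjes K z" for z
  have posM: "0 < Im (M z)" if "0 < Im z" for z
    unfolding M_def by (rule Im_csqrt_stieltjes_pos[OF L L_neg that])
  have posG: "0 < Im (G z)" if "0 < Im z" for z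
    unfolding G_def by (rule Im_csqrt_stieltjes_pos[OF K that])
  have sol: "solves (csqrt z) (M z) (G z)" if z: "0 < Im z" for z
  proof -
    have "stieltjes K z \<noteq> 0" using posG[OF z] by (auto simp: G_def)
    from companion_solves[OF z m_int[OF z] g_int[OF z] gl[OF z, symmetric] this]
    show ?thesis unfolding M_def G_def SL[OF z] .
  qed
  have ex: "\<exists>l. (stieltjes L \<longlongrightarrow> l) (at (of_real x) within \<complex>\<^sup>+) \<and>
      (0 < x \<longrightarrow> 0 < Im l \<longrightarrow> (\<exists>r h. 0 < r \<and> h holomorphic_on ball (of_real x) r \<and>
        (\<forall>z\<in>ball (of_real x) r. 0 < Im z \<longrightarrow> stieltjes L z = h z)))" if "x \<noteq> 0" for x
  proof (cases "0 < x")
    case False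
    then have x: "x < 0" using that by linarith
    have "continuous_on {z. Re z < x / 2} (stieltjes L)"
    proof (rule stieltjes_continuous[OF L, of "- x / 2"])
      have "AE l in interval_measure L. 0 \<le> l" by (rule AE_nonneg_interval_measure[OF L]) (rule L_neg)
      then show "AE l in interval_measure L. \<forall>z\<in>{z. Re z < x / 2}. - x / 2 \<le> cmod (complex_of_real l - z)"
      proof eventually_elim
        case (elim l)
        show ?case
        proof
          fix z :: complex assume "z \<in> {z. Re z < x / 2}"
          then show "- x / 2 \<le> cmod (complex_of_real l - z)"
            using complex_Re_le_cmod[of "complex_of_real l - z"] elim by simp
        qed
      qed
    qed (use x in simp)
    then have "isCont (stieltjes L) (of_real x)"
      using x by (subst (asm) continuous_on_eq_continuous_at[OF open_halfspace_Re_lt]) auto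
    then have "(stieltjes L \<longlongrightarrow> stieltjes L (of_real x)) (at (of_real x) within \<complex>\<^sup>+)"
      unfolding isCont_def by (rule tendsto_within_subset) simp
    then show ?thesis using False by blast
  next
    case x: True
    obtain M0 G0 where lim: "(M \<longlongrightarrow> M0) (at (of_real x) within \<complex>\<^sup>+)" "(G \<longlongrightarrow> G0) (at (of_real x) within \<complex>\<^sup>+)"
      and sol0: "solves (of_real (sqrt x)) M0 G0" and G0: "G0 \<noteq> 0" "0 \<le> Im G0"
      by (rule boundary_limit[OF sol posM posG x])
    have SLM: "stieltjes L z = M z / csqrt z" if "0 < Im z" for z
    proof -
      have "csqrt z \<noteq> 0" using that by auto
      then show ?thesis by (simp add: M_def)
    qed
    have sx: "csqrt (of_real x) = of_real (sqrt x)" by (rule of_real_sqrt[OF less_imp_le[OF x], symmetric])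
    have sx0: "complex_of_real (sqrt x) \<noteq> 0" using x by simp
    have "isCont csqrt (of_real x)" using x by (intro continuous_at_csqrt) (auto simp: complex_nonpos_Reals_iff)
    then have "(csqrt \<longlongrightarrow> of_real (sqrt x)) (at (of_real x) within \<complex>\<^sup>+)"
      unfolding isCont_def sx by (rule tendsto_within_subset) simp
    from tendsto_divide[OF lim(1) this sx0]
    have "((\<lambda>z. M z / csqrt z) \<longlongrightarrow> M0 / of_real (sqrt x)) (at (of_real x) within \<complex>\<^sup>+)" .
    then have 1: "(stieltjes L \<longlongrightarrow> M0 / of_real (sqrt x)) (at (of_real x) within \<complex>\<^sup>+)"
      by (rule Lim_transform_eventually) (simp add: eventually_at_filter SLM)
    have "\<exists>r h. 0 < r \<and> h holomorphic_on ball (of_real x) r \<and>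
        (\<forall>z\<in>ball (of_real x) r. 0 < Im z \<longrightarrow> stieltjes L z = h z)" if "0 < Im (M0 / of_real (sqrt x))"
    proof -
      have M0: "0 < Im M0" using that x by (simp add: zero_less_divide_iff)
      obtain r \<mu> where r: "0 < r" and \<mu>: "\<mu> holomorphic_on ball (of_real x) r"
        and eq: "\<And>z. z \<in> ball (of_real x) r \<Longrightarrow> 0 < Im z \<Longrightarrow> M z = \<mu> z"
        using boundary_analytic[OF sol x lim sol0 G0 M0] by blast
      define r' where "r' = min r x"
      have r': "0 < r'" "r' \<le> r" "r' \<le> x" using r x by (auto simp: r'_def)
      have Repos: "0 < Re z" if "z \<in> ball (of_real x) r'" for z
      proof -
        have "\<bar>Re (z - of_real x)\<bar> < x"
          using that r' abs_Re_le_cmod[of "z - of_real x"] by (auto simp: dist_norm norm_minus_commute)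
        then show ?thesis by simp
      qed
      have "(\<lambda>z. \<mu> z / csqrt z) holomorphic_on ball (of_real x) r'"
      proof (intro holomorphic_on_divide)
        show "\<mu> holomorphic_on ball (of_real x) r'" by (rule holomorphic_on_subset[OF \<mu>]) (use r' in auto)
        show "csqrt holomorphic_on ball (of_real x) r'"
          unfolding holomorphic_on_def using Repos
          by (intro ballI field_differentiable_within_csqrt) (auto simp: complex_nonpos_Reals_iff not_le)
        fix z assume "z \<in> ball (complex_of_real x) r'"
        then show "csqrt z \<noteq> 0" using Repos[of z] by auto
      qed
      moreover have "stieltjes L z = \<mu> z / csqrt z" if "z \<in> ball (of_real x) r'" "0 < Im z" for z
      proof -
        have "z \<in> ball (of_real x) r" using that r' by auto
        then show ?thesis unfolding SLM[OF that(2)] by (simp only: eq[OF _ that(2)])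
      qed
      ultimately show ?thesis using r'(1) by blast
    qed
    with 1 show ?thesis by blast
  qed
  then obtain m where lim: "\<And>x. x \<noteq> 0 \<Longrightarrow> (stieltjes L \<longlongrightarrow> m x) (at (of_real x) within \<complex>\<^sup>+)"
    and ana: "\<And>x. x \<noteq> 0 \<Longrightarrow> 0 < x \<Longrightarrow> 0 < Im (m x) \<Longrightarrow> \<exists>r h. 0 < r \<and> h holomorphic_on ball (of_real x) r \<and>
        (\<forall>z\<in>ball (of_real x) r. 0 < Im z \<longrightarrow> stieltjes L z = h z)"
    by metis
  define f where "f x = 1 / pi * Im (m x)" for x
  have lim': "x \<in> - {0} \<Longrightarrow> (stieltjes L \<longlongrightarrow> m x) (at (of_real x) within \<complex>\<^sup>+)" for x
    using lim by simp
  have open0: "open (- {0 :: real})" by auto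
  have m_cont: "continuous_on (- {0}) m"
    by (rule density_of_boundary_limit(1)[OF L open0]) (rule lim')
  have L_deriv: "(L has_real_derivative f x) (at x)" if "x \<noteq> 0" for x
    unfolding f_def by (rule density_of_boundary_limit(2)[OF L open0]) (use that in \<open>auto intro: lim'\<close>)
  have an: "real_analytic_at f x" if x: "0 < x" "0 < Im (m x)" for x
  proof -
    obtain r h where r: "0 < r" and h: "h holomorphic_on ball (of_real x) r"
      and eq: "\<And>z. z \<in> ball (of_real x) r \<Longrightarrow> 0 < Im z \<Longrightarrow> stieltjes L z = h z"
      using ana[of x] x by blast
    define r' where "r' = min r x"
    have r': "0 < r'" "r' \<le> r" "r' \<le> x" using r x by (auto simp: r'_def)
    have "m y = h (of_real y)" if y: "\<bar>y - x\<bar> < r'" for y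
    proof (rule tendsto_unique[OF at_within_upper_nontrivial[of y]])
      have yb: "complex_of_real y \<in> ball (of_real x) r"
        using y r' by (simp add: dist_norm norm_minus_commute flip: of_real_diff)
      show "(stieltjes L \<longlongrightarrow> m y) (at (of_real y) within \<complex>\<^sup>+)" by (rule lim) (use y r' in auto)
      have "isCont h (of_real y)"
        using holomorphic_on_imp_continuous_on[OF h] yb by (simp add: continuous_on_eq_continuous_at)
      then have "(h \<longlongrightarrow> h (of_real y)) (at (of_real y) within \<complex>\<^sup>+)"
        unfolding isCont_def by (rule tendsto_within_subset) simp
      moreover have "\<forall>\<^sub>F z in at (of_real y) within \<complex>\<^sup>+. h z = stieltjes L z"
      proof -
        have "\<forall>\<^sub>F z in at (complex_of_real y). z \<in> ball (of_real x) r"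
          using yb by (intro eventually_at_topological[THEN iffD2] exI[of _ "ball (of_real x) r"]) auto
        then have 1: "\<forall>\<^sub>F z in at (complex_of_real y) within \<complex>\<^sup>+. z \<in> ball (of_real x) r"
          by (rule filter_leD[OF at_le, rotated]) simp
        have 2: "\<forall>\<^sub>F z in at (complex_of_real y) within \<complex>\<^sup>+. z \<in> \<complex>\<^sup>+" by (simp add: eventually_at_filter)
        show ?thesis using 1 2 by eventually_elim (simp add: eq)
      qed
      ultimately show "(stieltjes L \<longlongrightarrow> h (of_real y)) (at (of_real y) within \<complex>\<^sup>+)"
        by (rule Lim_transform_eventually)
    qed
    then show ?thesis
      using r' by (intro real_analytic_Im_of_holomorphic[OF holomorphic_on_subset[OF h, of "ball (of_real x) r'"], where a="1 / pi"])
        (auto simp: f_def)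
  qed
  show ?thesis
  proof (intro exI[of _ m] exI[of _ f] conjI allI impI)
    fix x :: real assume x: "x \<noteq> 0"
    show "(stieltjes (lower_df c F) \<longlongrightarrow> m x) (at (complex_of_real x) within \<complex>\<^sup>+)"
      using lim[OF x] by (simp only: L_def)
    show "(lower_df c F has_real_derivative f x) (at x)"
      using L_deriv[OF x] by (simp only: L_def)
  next
    show "continuous_on (- {0}) m" by (rule m_cont)
    then show "continuous_on (- {0}) f" unfolding f_def by (intro continuous_intros)
  qed (simp_all add: f_def an)
qed

end
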